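(* Let $X$ be a rearrangement invariant space on $[0,1]$ that admits a special modular. Then the following statements are equivalent: (1) $X$ has the $X'$-order Banach-Saks property ($X'$-$oBSP$). (2) $X$ has the weak order Banach-Saks property ($w$-$oBSP$). (3) Every weakly null sequence in $X_a$ has a subsequence whose Cesàro sequence is dominated in $X$.
   Context: $L^0$ is the vector lattice of real measurable functions on $[0,1]$ (Lebesgue measure), modulo a.e. equality; inequalities are a.e. A Banach function space $X$ on $[0,1]$ is a Banach space that is a linear subspace of $L^0$ such that $f\in X$ and $\|f\|_X\le\|g\|_X$ whenever $f \in L^0$, $g\in X$ and $|f|\le|g|$. $X_+=\{f\in X: f\ge 0\}$. For $h\in L^0$ the decreasing rearrangement is $h^*(t)=\inf\{\lambda: |\{|h|>\lambda\}|\le t\}$, $t\in(0,1]$. A rearrangement invariant (r.i.) space is a Banach function space $X\ne\{0\}$ such that whenever $h\in L^0$ satisfies $h^*=f^*$ for some $f\in X$, then $h\in X$ and $\|h\|_X=\|f\|_X$. The associate space $X'$ is the space of all $g\in L^0$ with $\int_0^1|fg|\,dt<\infty$ for all $f\in X$. A sequence $\{f_n\}$ is $\sigma(X,X')$-null if $\int_0^1 f_ng\,dt\to0$ for every $g\in X'$. A sequence $\{f_n\}$ in $X$ is dominated in $X$ if there is $h\in X_+$ with $|f_n|\le h$ for all $n$. It order converges to $f\in X$ (written $f_n\xrightarrow{o}f$) if there is a sequence $\{g_n\}$ in $X$ with $g_n\downarrow0$ and $|f_n-f|\le g_n$ for all $n$; equivalently, it is dominated in $X$ and $f_n\to f$ a.e.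 The Cesàro sequence of $\{f_n\}$ is $\{\frac1m\sum_{n=1}^m f_n\}_m$. The order continuous part $X_a$ of $X$ is the (closed) subspace of all $f\in X$ such that $\|f_n\|_X\to0$ whenever $f_n\xrightarrow{o}0$ and $|f_n|\le|f|$. $X$ has $w$-$oBSP$ if every weakly null sequence in $X$ has a subsequence whose Cesàro sequence order converges in $X$. $X$ has $X'$-$oBSP$ if every $\sigma(X,X')$-null norm bounded sequence in $X$ has a subsequence whose Cesàro sequence order converges in $X$. A special modular on $X$ is a functional $\rho:X\to[0,\infty]$ such that: (M1) if $f\in X_+$ and $\rho(f)<\infty$, then $\rho(f_n)\to0$ whenever $f_n\xrightarrow{o}0$ and $0\le f_n\le f$; (M2) if $\{f_n\}$ is a sequence in $X$ with $\sum_{n=1}^\infty\rho(f_n)<\infty$, then a subsequence of $\{f_n\}$ is dominated in $X$; (M3) $\rho(f)<\infty$ for every $f$ in the closed unit ball of $X$. *)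

theory Defs
  imports "HOL-Analysis.Analysis"
begin

text \<open>
  Elements of \<open>L\<^sup>0\<close> are represented by measurable functions; only their restriction to
  \<open>[0,1]\<close> up to null sets matters.  A space \<open>X \<subseteq> L\<^sup>0\<close> is represented by the set of
  all representatives of its elements, and a norm \<open>N\<close> is only meaningful on \<open>X\<close>.
\<close>

abbreviation leb01 :: "real measure" where
  "leb01 \<equiv> lebesgue_on {0..1}"

definition L0 :: "(real \<Rightarrow> real) set" where
  "L0 = borel_measurable leb01"

text \<open>
  The ideal property makes \<open>X\<close> closed under a.e. equality and \<open>N\<close> invariant under it.
\<close>

locale banach_function_space =
  fixes X :: "(real \<Rightarrow> real) set" and N :: "(real \<Rightarrow> real) \<Rightarrow> real"
  assumes subset_L0: "X \<subseteq> L0"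
    and zero_mem: "(\<lambda>_. 0) \<in> X"
    and add_mem: "\<lbrakk>f \<in> X; g \<in> X\<rbrakk> \<Longrightarrow> (\<lambda>t. f t + g t) \<in> X"
    and scale_mem: "f \<in> X \<Longrightarrow> (\<lambda>t. c * f t) \<in> X"
    and norm_nonneg: "f \<in> X \<Longrightarrow> 0 \<le> N f"
    and norm_eq_0_iff: "f \<in> X \<Longrightarrow> N f = 0 \<longleftrightarrow> (AE t in leb01. f t = 0)"
    and norm_triangle: "\<lbrakk>f \<in> X; g \<in> X\<rbrakk> \<Longrightarrow> N (\<lambda>t. f t + g t) \<le> N f + N g"
    and norm_scale: "f \<in> X \<Longrightarrow> N (\<lambda>t. c * f t) = \<bar>c\<bar> * N f"
    and ideal: "\<lbrakk>f \<in> L0; g \<in> X; AE t in leb01. \<bar>f t\<bar> \<le> \<bar>g t\<bar>\<rbrakk> \<Longrightarrow> f \<in> X \<and> N f \<le> N g"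
    and complete: "\<lbrakk>\<And>n. F n \<in> X;
        \<And>e. e > 0 \<Longrightarrow> \<exists>K. \<forall>m\<ge>K. \<forall>n\<ge>K. N (\<lambda>t. F m t - F n t) < e\<rbrakk>
      \<Longrightarrow> \<exists>f\<in>X. (\<lambda>n. N (\<lambda>t. F n t - f t)) \<longlonglongrightarrow> 0"

text \<open>
  Only \<open>\<lambda> \<ge> 0\<close> is admitted: at \<open>t = 1\<close> every negative \<open>\<lambda>\<close> would satisfy the
  condition and the set would be unbounded below.
\<close>

definition decr_rearr :: "(real \<Rightarrow> real) \<Rightarrow> real \<Rightarrow> real" where
  "decr_rearr h t = Inf {l. 0 \<le> l \<and> measure leb01 {x \<in> {0..1}. \<bar>h x\<bar> > l} \<le> t}"

locale ri_space = banach_function_space +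
  assumes nontrivial: "\<exists>f\<in>X. \<not> (AE t in leb01. f t = 0)"
    and rearr_inv: "\<lbrakk>h \<in> L0; f \<in> X; \<forall>t\<in>{0<..1}. decr_rearr h t = decr_rearr f t\<rbrakk>
      \<Longrightarrow> h \<in> X \<and> N h = N f"

definition pos_cone :: "(real \<Rightarrow> real) set \<Rightarrow> (real \<Rightarrow> real) set" where
  "pos_cone X = {f \<in> X. AE t in leb01. 0 \<le> f t}"

definition associate_space :: "(real \<Rightarrow> real) set \<Rightarrow> (real \<Rightarrow> real) set" where
  "associate_space X = {g \<in> L0. \<forall>f\<in>X. integrable leb01 (\<lambda>t. f t * g t)}"

definition assoc_null :: "(real \<Rightarrow> real) set \<Rightarrow> (nat \<Rightarrow> real \<Rightarrow> real) \<Rightarrow> bool" where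
  "assoc_null X F \<longleftrightarrow> (\<forall>n. F n \<in> X) \<and>
     (\<forall>g\<in>associate_space X. (\<lambda>n. LINT t|leb01. F n t * g t) \<longlonglongrightarrow> 0)"

definition bounded_functional ::
    "(real \<Rightarrow> real) set \<Rightarrow> ((real \<Rightarrow> real) \<Rightarrow> real) \<Rightarrow> ((real \<Rightarrow> real) \<Rightarrow> real) \<Rightarrow> bool" where
  "bounded_functional Y N \<phi> \<longleftrightarrow>
     (\<forall>f\<in>Y. \<forall>g\<in>Y. \<phi> (\<lambda>t. f t + g t) = \<phi> f + \<phi> g) \<and>
     (\<forall>f\<in>Y. \<forall>c. \<phi> (\<lambda>t. c * f t) = c * \<phi> f) \<and>
     (\<exists>C. \<forall>f\<in>Y. \<bar>\<phi> f\<bar> \<le> C * N f)"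

definition weakly_null ::
    "(real \<Rightarrow> real) set \<Rightarrow> ((real \<Rightarrow> real) \<Rightarrow> real) \<Rightarrow> (nat \<Rightarrow> real \<Rightarrow> real) \<Rightarrow> bool" where
  "weakly_null Y N F \<longleftrightarrow> (\<forall>n. F n \<in> Y) \<and>
     (\<forall>\<phi>. bounded_functional Y N \<phi> \<longrightarrow> (\<lambda>n. \<phi> (F n)) \<longlonglongrightarrow> 0)"

definition dominated_in :: "(real \<Rightarrow> real) set \<Rightarrow> (nat \<Rightarrow> real \<Rightarrow> real) \<Rightarrow> bool" where
  "dominated_in X F \<longleftrightarrow> (\<exists>h\<in>pos_cone X. \<forall>n. AE t in leb01. \<bar>F n t\<bar> \<le> h t)"

text \<open>\<open>g\<^sub>n \<down> 0\<close> in the lattice sense: decreasing with infimum \<open>0\<close> in \<open>X\<close>.\<close>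

definition decreases_to_0 :: "(real \<Rightarrow> real) set \<Rightarrow> (nat \<Rightarrow> real \<Rightarrow> real) \<Rightarrow> bool" where
  "decreases_to_0 X G \<longleftrightarrow> (\<forall>n. G n \<in> X) \<and>
     (\<forall>n. AE t in leb01. G (Suc n) t \<le> G n t) \<and>
     (\<forall>n. AE t in leb01. 0 \<le> G n t) \<and>
     (\<forall>u\<in>X. (\<forall>n. AE t in leb01. u t \<le> G n t) \<longrightarrow> (AE t in leb01. u t \<le> 0))"

definition order_converges ::
    "(real \<Rightarrow> real) set \<Rightarrow> (nat \<Rightarrow> real \<Rightarrow> real) \<Rightarrow> (real \<Rightarrow> real) \<Rightarrow> bool" where
  "order_converges X F f \<longleftrightarrow> (\<forall>n. F n \<in> X) \<and> f \<in> X \<and>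
     (\<exists>G. decreases_to_0 X G \<and> (\<forall>n. AE t in leb01. \<bar>F n t - f t\<bar> \<le> G n t))"

text \<open>Sequences are indexed from \<open>0\<close>, so the \<open>m\<close>-th Cesaro mean averages \<open>m + 1\<close> terms.\<close>

definition cesaro :: "(nat \<Rightarrow> real \<Rightarrow> real) \<Rightarrow> nat \<Rightarrow> real \<Rightarrow> real" where
  "cesaro F m = (\<lambda>t. (\<Sum>n\<le>m. F n t) / real (Suc m))"

definition oc_part :: "(real \<Rightarrow> real) set \<Rightarrow> ((real \<Rightarrow> real) \<Rightarrow> real) \<Rightarrow> (real \<Rightarrow> real) set" where
  "oc_part X N = {f \<in> X. \<forall>F. order_converges X F (\<lambda>_. 0) \<and>
       (\<forall>n. AE t in leb01. \<bar>F n t\<bar> \<le> \<bar>f t\<bar>) \<longrightarrow> (\<lambda>n. N (F n)) \<longlonglongrightarrow> 0}"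

definition weak_oBSP :: "(real \<Rightarrow> real) set \<Rightarrow> ((real \<Rightarrow> real) \<Rightarrow> real) \<Rightarrow> bool" where
  "weak_oBSP X N \<longleftrightarrow> (\<forall>F. weakly_null X N F \<longrightarrow>
     (\<exists>r f. strict_mono r \<and> order_converges X (cesaro (F \<circ> r)) f))"

definition assoc_oBSP :: "(real \<Rightarrow> real) set \<Rightarrow> ((real \<Rightarrow> real) \<Rightarrow> real) \<Rightarrow> bool" where
  "assoc_oBSP X N \<longleftrightarrow> (\<forall>F. assoc_null X F \<and> (\<exists>C. \<forall>n. N (F n) \<le> C) \<longrightarrow>
     (\<exists>r f. strict_mono r \<and> order_converges X (cesaro (F \<circ> r)) f))"

text \<open>The first conjunct says that \<open>\<rho>\<close> is well defined on a.e. classes.\<close>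

definition special_modular ::
    "(real \<Rightarrow> real) set \<Rightarrow> ((real \<Rightarrow> real) \<Rightarrow> real) \<Rightarrow> ((real \<Rightarrow> real) \<Rightarrow> ennreal) \<Rightarrow> bool" where
  "special_modular X N \<rho> \<longleftrightarrow>
     (\<forall>f\<in>X. \<forall>g\<in>X. (AE t in leb01. f t = g t) \<longrightarrow> \<rho> f = \<rho> g) \<and>
     (\<forall>f\<in>pos_cone X. \<forall>F. \<rho> f < \<infinity> \<and> order_converges X F (\<lambda>_. 0) \<and>
        (\<forall>n. AE t in leb01. 0 \<le> F n t \<and> F n t \<le> f t) \<longrightarrow> (\<lambda>n. \<rho> (F n)) \<longlonglongrightarrow> 0) \<and>
     (\<forall>F. (\<forall>n. F n \<in> X) \<and> (\<Sum>n. \<rho> (F n)) < \<infinity> \<longrightarrow>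
        (\<exists>r. strict_mono r \<and> dominated_in X (F \<circ> r))) \<and>
     (\<forall>f\<in>X. N f \<le> 1 \<longrightarrow> \<rho> f < \<infinity>)"

end

theory Submission
  imports Defs "HOL-Library.Diagonal_Subsequence"
begin

text \<open>Only the implication from (3) to (1) is deep. Let \<open>f\<^sub>n\<close> be norm bounded and
  \<open>\<sigma>(X, X')\<close>-null. Averaging over cyclic shifts gives \<open>X \<subseteq> L\<^sup>1\<close>, so by
  Komlos's theorem one may assume that the Cesaro means of all subsequences converge a.e. to one
  function; it remains to dominate the Cesaro means of some subsequence in \<open>X\<close>. By (M1), \<open>f\<^sub>n\<close>
  can be cut at a height so large that the modulars of the cut-off parts are summable; by (M2) a
  subsequence of these parts is dominated. The bounded parts \<open>u\<^sub>n\<close> are still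
  \<open>\<sigma>(X, X')\<close>-null. If the norms of indicators of sets of positive measure are bounded away
  from \<open>0\<close>, then \<open>X\<close> consists of bounded functions and \<open>f\<^sub>n\<close> itself is dominated. Otherwise
  these norms tend to \<open>0\<close> with the measure of the set, bounded functions lie in \<open>X\<^sub>a\<close>, and by
  Radon-Nikodym the functionals on \<open>X\<^sub>a\<close> act on bounded functions as integration against
  elements of \<open>X'\<close>; hence \<open>u\<^sub>n\<close> is weakly null in \<open>X\<^sub>a\<close> and (3) applies.

  Komlos's theorem is proved for nonnegative functions by truncating the \<open>j\<close>-th term of a
  subsequence at height \<open>j\<close>, subtracting the weak limit of the truncations at that height,
  and selecting the subsequence so that the differences are nearly orthogonal; Etemadi's
  argument then replaces maximal inequalities.\<close>

section \<open>Densities of set functions\<close>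

text \<open>Komlos's theorem, (M2) and (3) each extract a subsequence, but a.e. convergence and
  domination of Cesaro means do not pass to subsequences. This fixes the order of the extractions:
  Komlos's theorem comes first, with a limit valid along every subsequence; (M2) dominates the terms
  themselves, which is inherited; (3), which dominates only means, comes last. A limit along every
  subsequence has a price inside Komlos's theorem: a term may end up at any earlier position, so it
  must be controlled at all heights up to its own stage. The uniform L^1 bound enters there as
  summability of the limiting tail measures, which pays for the cut-off parts, for the second
  moments and for the a.e. convergence of the weak limits. The implication from (1) to (2) rests on
  two automatic boundedness facts: elements of X' act as bounded functionals, by completeness of X,
  and weakly null sequences are norm bounded, by a gliding hump built from Hahn-Banach
  functionals.\<close>

lemma real_less_iff_nat_ceiling: "real j < x \<longleftrightarrow> j < nat \<lceil>x\<rceil>"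
  by (simp add: zless_nat_eq_int_zless less_ceiling_iff)

lemma sum_of_bool_less:
  fixes x :: real
  shows "(\<Sum>j<n. of_bool (real j < x)) = real (min n (nat \<lceil>x\<rceil>))"
proof -
  have "(\<Sum>j<n. of_bool (real j < x) :: real) = real (card {j\<in>{..<n}. j < nat \<lceil>x\<rceil>})"
    by (simp add: real_less_iff_nat_ceiling of_bool_def sum.If_cases Int_def)
  also have "{j\<in>{..<n}. j < nat \<lceil>x\<rceil>} = {..<min n (nat \<lceil>x\<rceil>)}"
    by auto
  finally show ?thesis by simp
qed

lemma layer_cake_bounds:
  fixes x :: real
  assumes "0 \<le> x" "x \<le> real n"
  shows "x \<le> (\<Sum>j<n. of_bool (real j < x))" "(\<Sum>j<n. of_bool (real j < x)) \<le> x + 1"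
proof -
  have "min n (nat \<lceil>x\<rceil>) = nat \<lceil>x\<rceil>"
    using assms by (simp add: min_def nat_le_iff) linarith
  then show "x \<le> (\<Sum>j<n. of_bool (real j < x))" "(\<Sum>j<n. of_bool (real j < x)) \<le> x + 1"
    unfolding sum_of_bool_less using assms by linarith+
qed

text \<open>The function is shifted to be nonnegative and stretched by \<open>n\<close>; counting
  the integers below the result costs at most 1, hence at most \<open>1 / n\<close> after scaling
  back. The approximating sets are superlevel sets, not the cells of a partition.\<close>

lemma bounded_simple_approx:
  fixes g :: "'a \<Rightarrow> real"
  assumes g: "g \<in> borel_measurable M" and B: "\<And>x. x \<in> space M \<Longrightarrow> \<bar>g x\<bar> \<le> B" and "e > 0"
  obtains m :: nat and c A where "\<And>i. A i \<in> sets M"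
    "\<And>x. x \<in> space M \<Longrightarrow> \<bar>g x - (\<Sum>i<m. c i * indicator (A i) x)\<bar> \<le> e"
proof -
  obtain n :: nat where n: "n > 0" "1 / real n < e"
    using reals_Archimedean[OF \<open>e > 0\<close>] by (metis inverse_eq_divide zero_less_Suc)
  define L where "L = nat \<lceil>2 * n * \<bar>B\<bar>\<rceil>"
  \<comment> \<open>Index 0 carries the constant that undoes the shift, so level \<open>j\<close>
    sits at index \<open>j + 1\<close>; hence \<open>i - 1\<close> in \<open>A\<close>.\<close>
  define c where "c = (\<lambda>i::nat. if i = 0 then - \<bar>B\<bar> else 1 / real n)"
  define A where "A = (\<lambda>i::nat. if i = 0 then space M else {x\<in>space M. real (i - 1) < n * (g x + \<bar>B\<bar>)})"
  have "A i \<in> sets M" for i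
    unfolding A_def using g by auto
  moreover have "\<bar>g x - (\<Sum>i<Suc L. c i * indicator (A i) x)\<bar> \<le> e" if x: "x \<in> space M" for x
  proof -
    let ?y = "n * (g x + \<bar>B\<bar>)"
    let ?s = "\<Sum>j<L. of_bool (real j < ?y)"
    have gB: "\<bar>g x\<bar> \<le> \<bar>B\<bar>"
      using B[OF x] by linarith
    then have "g x + \<bar>B\<bar> \<le> 2 * \<bar>B\<bar>" by linarith
    then have "n * (g x + \<bar>B\<bar>) \<le> n * (2 * \<bar>B\<bar>)"
      by (intro mult_left_mono) auto
    then have "?y \<le> real L"
      unfolding L_def by (simp add: algebra_simps) linarith
    moreover have "0 \<le> ?y"
      using gB by simp
    ultimately have s: "?y \<le> ?s" "?s \<le> ?y + 1"
      using layer_cake_bounds by blast+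
    have "(\<Sum>i<Suc L. c i * indicator (A i) x) = - \<bar>B\<bar> + ?s / n"
      unfolding sum.lessThan_Suc_shift using x
      by (auto simp: c_def A_def sum_divide_distrib indicator_def simp del: sum_of_bool_eq intro!: sum.cong)
    moreover have "\<bar>g x - (- \<bar>B\<bar> + ?s / n)\<bar> = \<bar>?y - ?s\<bar> / n"
      proof -
      have "?y - ?s = n * (g x - (- \<bar>B\<bar> + ?s / n))"
        using n(1) by (simp add: field_simps del: sum_of_bool_eq)
      then have "\<bar>?y - ?s\<bar> = n * \<bar>g x - (- \<bar>B\<bar> + ?s / n)\<bar>"
        by (metis abs_mult abs_of_nat)
      then show ?thesis using n(1) by simp
    qed
    moreover have "\<bar>?y - ?s\<bar> / n \<le> 1 / n"
      using s n(1) by (intro divide_right_mono) auto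
    ultimately show ?thesis using n(2) by linarith
  qed
  ultimately show ?thesis by (rule that)
qed

text \<open>Absolute continuity in epsilon-delta form works twice: it gives continuity at the empty
  set, which upgrades finite to countable additivity, and it makes null sets null for
  \<open>p\<close>, as Radon-Nikodym requires.\<close>

lemma (in finite_measure) positive_set_function_density:
  fixes p :: "'a set \<Rightarrow> real"
  assumes nonneg: "\<And>A. A \<in> sets M \<Longrightarrow> 0 \<le> p A"
    and additive: "\<And>A B. A \<in> sets M \<Longrightarrow> B \<in> sets M \<Longrightarrow> A \<inter> B = {} \<Longrightarrow> p (A \<union> B) = p A + p B"
    and ac: "\<And>e. e > 0 \<Longrightarrow> \<exists>d>0. \<forall>A\<in>sets M. measure M A < d \<longrightarrow> p A < e"
  obtains D where "integrable M D" "\<And>x. 0 \<le> D x" "\<And>A. A \<in> sets M \<Longrightarrow> p A = (LINT x|M. D x * indicator A x)"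
proof -
  have p0: "p {} = 0"
    using additive[of "{}" "{}"] by simp
  have null: "p A = 0" if "A \<in> null_sets M" for A
  proof (rule antisym)
    show "p A \<le> 0"
    proof (rule field_le_epsilon)
      fix e :: real assume "e > 0"
      from ac[OF this] that show "p A \<le> 0 + e"
        by (fastforce simp: null_sets_def measure_def)
    qed
  qed (use that nonneg in auto)
  define P where "P = measure_of (space M) (sets M) (\<lambda>A. ennreal (p A))"
  have sets_P[simp, measurable_cong]: "sets P = sets M" and space_P[simp]: "space P = space M"
    by (simp_all add: P_def)
  have ca: "countably_additive (sets M) (\<lambda>A. ennreal (p A))"
  proof (rule sets.empty_continuous_imp_countably_additive)
    show "positive (sets M) (\<lambda>A. ennreal (p A))"
      by (simp add: positive_def p0)
    show "Measure_Space.additive (sets M) (\<lambda>A. ennreal (p A))"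
      by (auto simp: Measure_Space.additive_def additive nonneg)
    fix A :: "nat \<Rightarrow> 'a set" assume A: "range A \<subseteq> sets M" "decseq A" "(\<Inter>i. A i) = {}"
    have "(\<lambda>i. measure M (A i)) \<longlonglongrightarrow> measure M (\<Inter>i. A i)"
      using A by (intro finite_Lim_measure_decseq) auto
    then have m: "(\<lambda>i. measure M (A i)) \<longlonglongrightarrow> 0" using A(3) by simp
    have "(\<lambda>i. p (A i)) \<longlonglongrightarrow> 0"
    proof (rule LIMSEQ_I)
      fix e :: real assume "e > 0"
      from ac[OF this] obtain d where d: "d > 0" "\<forall>A\<in>sets M. measure M A < d \<longrightarrow> p A < e" by blast
      have "\<forall>\<^sub>F i in sequentially. measure M (A i) < d"
        using m d(1) by (rule order_tendstoD)
      then show "\<exists>no. \<forall>n\<ge>no. norm (p (A n) - 0) < e"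
        using d(2) A(1) nonneg unfolding eventually_sequentially
        by (metis abs_of_nonneg diff_zero range_subsetD real_norm_def)
    qed
    then show "(\<lambda>i. ennreal (p (A i))) \<longlonglongrightarrow> 0"
      using tendsto_ennrealI by force
  qed simp
  have em: "emeasure P A = ennreal (p A)" if "A \<in> sets M" for A
    unfolding P_def
    by (rule emeasure_measure_of_sigma[OF sets.sigma_algebra_axioms _ ca that])
      (simp add: positive_def p0)
  have finP: "finite_measure P"
    by (rule finite_measureI) (simp add: em)
  have "absolutely_continuous M P"
    unfolding absolutely_continuous_def by (auto simp: null_sets_def em null)
  from real_RN_deriv[OF finP this sets_P] obtain D where D: "D \<in> borel_measurable M"
    "AE x in M. RN_deriv M P x = ennreal (D x)" "AE x in P. 0 < D x" "\<And>x. 0 \<le> D x"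
    by blast
  have dens: "density M (RN_deriv M P) = P"
    using density_RN_deriv[OF \<open>absolutely_continuous M P\<close> sets_P] .
  have nn: "(\<integral>\<^sup>+ x. ennreal (D x * indicator A x) \<partial>M) = ennreal (p A)" if A: "A \<in> sets M" for A
  proof -
    have "(\<integral>\<^sup>+ x. ennreal (D x * indicator A x) \<partial>M) = (\<integral>\<^sup>+ x. RN_deriv M P x * indicator A x \<partial>M)"
      using D(2) by (intro nn_integral_cong_AE) (auto simp: indicator_def)
    also have "\<dots> = emeasure (density M (RN_deriv M P)) A"
      using A by (simp add: emeasure_density)
    finally show ?thesis by (simp add: dens em A)
  qed
  have "integrable M D"
    using nn[of "space M"] D(1,4) by (intro integrableI_nonneg) (auto cong: nn_integral_cong_simp)
  moreover have "p A = (LINT x|M. D x * indicator A x)" if "A \<in> sets M" for A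
    using nn[OF that] D(1,4) that nonneg[OF that] by (subst integral_eq_nn_integral) auto
  ultimately show ?thesis using D(4) that by blast
qed

text \<open>The positive variation \<open>A \<mapsto> sup {\<nu> B | B \<subseteq> A}\<close> splits \<open>\<nu>\<close> into two positive set functions.\<close>

lemma (in finite_measure) signed_set_function_density:
  fixes \<nu> :: "'a set \<Rightarrow> real"
  assumes additive: "\<And>A B. A \<in> sets M \<Longrightarrow> B \<in> sets M \<Longrightarrow> A \<inter> B = {} \<Longrightarrow> \<nu> (A \<union> B) = \<nu> A + \<nu> B"
    and ac: "\<And>e. e > 0 \<Longrightarrow> \<exists>d>0. \<forall>A\<in>sets M. measure M A < d \<longrightarrow> \<bar>\<nu> A\<bar> < e"
    and bounded: "\<And>A. A \<in> sets M \<Longrightarrow> \<bar>\<nu> A\<bar> \<le> K"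
  obtains g where "integrable M g" "\<And>A. A \<in> sets M \<Longrightarrow> \<nu> A = (LINT x|M. g x * indicator A x)"
proof -
  define p where "p = (\<lambda>A. Sup (\<nu> ` {B\<in>sets M. B \<subseteq> A}))"
  have \<nu>0: "\<nu> {} = 0"
    using additive[of "{}" "{}"] by simp
  have bdd: "bdd_above (\<nu> ` {B\<in>sets M. B \<subseteq> A})" for A
    using bounded by (intro bdd_aboveI[of _ K]) (auto simp: abs_le_iff)
  have up: "\<nu> B \<le> p A" if "B \<in> sets M" "B \<subseteq> A" for A B
    unfolding p_def using that bdd by (intro cSup_upper) auto
  have le: "p A \<le> c" if "\<And>B. B \<in> sets M \<Longrightarrow> B \<subseteq> A \<Longrightarrow> \<nu> B \<le> c" for A c
    unfolding p_def using that by (intro cSup_least) auto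
  have p_nonneg: "0 \<le> p A" for A
    using up[of "{}" A] \<nu>0 by simp
  have p_add: "p (A \<union> B) = p A + p B" if AB: "A \<in> sets M" "B \<in> sets M" "A \<inter> B = {}" for A B
  proof (rule antisym)
    show "p (A \<union> B) \<le> p A + p B"
    proof (rule le)
      fix C assume C: "C \<in> sets M" "C \<subseteq> A \<union> B"
      have "\<nu> C = \<nu> ((C \<inter> A) \<union> (C \<inter> B))"
        using C by (intro arg_cong[where f = \<nu>]) auto
      also have "\<dots> = \<nu> (C \<inter> A) + \<nu> (C \<inter> B)"
        using C AB by (intro additive) auto
      also have "\<dots> \<le> p A + p B"
        using C AB by (intro add_mono up) auto
      finally show "\<nu> C \<le> p A + p B" .
    qed
    have "p A \<le> p (A \<union> B) - p B"
    proof (rule le)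
      fix C assume C: "C \<in> sets M" "C \<subseteq> A"
      have "p B \<le> p (A \<union> B) - \<nu> C"
      proof (rule le)
        fix D assume D: "D \<in> sets M" "D \<subseteq> B"
        have "\<nu> C + \<nu> D = \<nu> (C \<union> D)"
          using C D AB by (intro additive[symmetric]) auto
        also have "\<dots> \<le> p (A \<union> B)"
          using C D by (intro up) auto
        finally show "\<nu> D \<le> p (A \<union> B) - \<nu> C" by simp
      qed
      then show "\<nu> C \<le> p (A \<union> B) - p B" by simp
    qed
    then show "p A + p B \<le> p (A \<union> B)" by simp
  qed
  \<comment> \<open>All subsets of a set of small measure have small measure, so the bound for
    \<open>\<nu>\<close> passes to its supremum \<open>p\<close> and thereby to
    \<open>p - \<nu>\<close>.\<close>
  have p_ac: "\<exists>d>0. \<forall>A\<in>sets M. measure M A < d \<longrightarrow> p A < e \<and> p A - \<nu> A < e" if e: "e > 0" for e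
  proof -
    from ac[of "e / 2"] e obtain d where d: "d > 0" "\<forall>A\<in>sets M. measure M A < d \<longrightarrow> \<bar>\<nu> A\<bar> < e / 2"
      by auto
    have "p A < e \<and> p A - \<nu> A < e" if A: "A \<in> sets M" "measure M A < d" for A
    proof -
      have "\<nu> B \<le> e / 2" if "B \<in> sets M" "B \<subseteq> A" for B
        using finite_measure_mono[OF that(2) A(1)] d(2) A(2) that(1) by fastforce
      then have "p A \<le> e / 2" by (rule le)
      moreover have "\<bar>\<nu> A\<bar> < e / 2" using A d(2) by blast
      ultimately show ?thesis using e by linarith
    qed
    then show ?thesis using d(1) by blast
  qed
  obtain D1 where D1: "integrable M D1" "\<And>A. A \<in> sets M \<Longrightarrow> p A = (LINT x|M. D1 x * indicator A x)"
  proof (rule positive_set_function_density[of p])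
    show "\<exists>d>0. \<forall>A\<in>sets M. measure M A < d \<longrightarrow> p A < e" if "e > 0" for e
      using p_ac[OF that] by blast
  qed (simp_all add: p_nonneg p_add)
  obtain D2 where D2: "integrable M D2" "\<And>A. A \<in> sets M \<Longrightarrow> p A - \<nu> A = (LINT x|M. D2 x * indicator A x)"
  proof (rule positive_set_function_density[of "\<lambda>A. p A - \<nu> A"])
    show "0 \<le> p A - \<nu> A" if "A \<in> sets M" for A
      using up[OF that order_refl] by simp
    show "p (A \<union> B) - \<nu> (A \<union> B) = (p A - \<nu> A) + (p B - \<nu> B)"
      if "A \<in> sets M" "B \<in> sets M" "A \<inter> B = {}" for A B
      using p_add[OF that] additive[OF that] by simp
    show "\<exists>d>0. \<forall>A\<in>sets M. measure M A < d \<longrightarrow> p A - \<nu> A < e" if "e > 0" for e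
      using p_ac[OF that] by blast
  qed simp
  have "\<nu> A = (LINT x|M. (D1 x - D2 x) * indicator A x)" if "A \<in> sets M" for A
    using D1(2)[OF that] D2(2)[OF that] integrable_real_mult_indicator[OF that D1(1)]
      integrable_real_mult_indicator[OF that D2(1)]
    by (simp add: left_diff_distrib)
  with D1(1) D2(1) show ?thesis
    by (intro that[of "\<lambda>x. D1 x - D2 x"]) auto
qed

section \<open>Weak-star compactness of bounded sequences\<close>

lemma convergent_comp_strict_mono:
  fixes a :: "nat \<Rightarrow> real"
  shows "convergent a \<Longrightarrow> strict_mono r \<Longrightarrow> convergent (a \<circ> r)"
  using LIMSEQ_subseq_LIMSEQ unfolding convergent_def by blast

text \<open>The diagonal sequence is a subsequence of the \<open>i\<close>-th extraction only from
  some index on. A property that passes to subsequences thus holds for a tail of it, and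
  \<open>tail\<close> recovers the whole sequence.\<close>

lemma eventual_property_diagonal:
  fixes Q :: "nat \<Rightarrow> (nat \<Rightarrow> nat) \<Rightarrow> bool"
  assumes ex: "\<And>i s. strict_mono (s::nat\<Rightarrow>nat) \<Longrightarrow> \<exists>r. strict_mono r \<and> Q i (s \<circ> r)"
    and sub: "\<And>i s r. strict_mono r \<Longrightarrow> Q i s \<Longrightarrow> Q i (s \<circ> r)"
    and tail: "\<And>i s k. Q i (\<lambda>n. s (k + n)) \<Longrightarrow> Q i s"
  obtains r where "strict_mono (r::nat\<Rightarrow>nat)" "\<And>i. Q i r"
proof -
  interpret subseqs Q
    by unfold_locales (rule ex)
  have "Q i (diagseq \<circ> ((+) (Suc i)))" for i
    by (rule diagseq_holds) (rule sub)
  then have "Q i diagseq" for i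
    using tail[of i diagseq "Suc i"] by (simp add: o_def)
  with subseq_diagseq show ?thesis by (rule that)
qed

lemma bounded_convergent_diagonal:
  fixes a :: "nat \<Rightarrow> nat \<Rightarrow> real"
  assumes "\<And>i n. \<bar>a i n\<bar> \<le> B i"
  obtains r where "strict_mono r" "\<And>i. convergent (\<lambda>n. a i (r n))"
proof -
  obtain r :: "nat \<Rightarrow> nat" where r: "strict_mono r" "\<And>i. convergent (a i \<circ> r)"
  proof (rule eventual_property_diagonal[of "\<lambda>i s. convergent (a i \<circ> s)"])
    fix i and s :: "nat \<Rightarrow> nat" assume "strict_mono s"
    have "bounded (range (a i \<circ> s))"
      using assms by (auto simp: bounded_iff)
    then have "\<exists>l r. strict_mono r \<and> ((a i \<circ> s) \<circ> r) \<longlonglongrightarrow> l"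
      using bounded_imp_convergent_subsequence by metis
    then show "\<exists>r. strict_mono r \<and> convergent (a i \<circ> (s \<circ> r))"
      by (auto simp: convergent_def o_assoc)
  next
    fix i and s r :: "nat \<Rightarrow> nat" assume "strict_mono r" "convergent (a i \<circ> s)"
    then show "convergent (a i \<circ> (s \<circ> r))"
      using convergent_comp_strict_mono[of "a i \<circ> s"] by (simp add: o_assoc)
  next
    fix i and s :: "nat \<Rightarrow> nat" and k assume "convergent (a i \<circ> (\<lambda>n. s (k + n)))"
    then show "convergent (a i \<circ> s)"
      using convergent_ignore_initial_segment[of "a i \<circ> s" k] by (simp add: o_def add.commute)
  qed blast
  then show ?thesis by (intro that[of r]) (simp_all add: o_def)
qed

section \<open>Measure and integral of bounded functions on the unit interval\<close>

lemma finite_measure_leb01: "finite_measure leb01"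
  by (rule finite_measure_lebesgue_on) auto

interpretation leb01: finite_measure leb01
  by (rule finite_measure_leb01)

lemma measure_leb01: "measure leb01 A = measure lebesgue A" if "A \<subseteq> {0..1}"
  using that by (simp add: measure_restrict_space)

lemma sets_leb01_iff: "A \<in> sets leb01 \<longleftrightarrow> A \<in> sets lebesgue \<and> A \<subseteq> {0..1}"
  by (auto simp: sets_restrict_space_iff)

lemma measure_leb01_space [simp]: "measure leb01 {0..1} = 1"
  by (simp add: measure_leb01)

lemma AE_neq_1: "AE t in leb01. t \<noteq> (1::real)"
proof -
  have "{1} \<in> null_sets leb01" by (simp add: null_sets_restrict_space)
  from AE_not_in[OF this] show ?thesis by simp
qed

lemma measure_leb01_le_1: "measure leb01 A \<le> 1"
  using leb01.bounded_measure[of A] by simp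

lemma integrable_bounded_leb01:
  assumes "g \<in> borel_measurable leb01" "\<And>x. x \<in> {0..1} \<Longrightarrow> \<bar>g x\<bar> \<le> (B::real)"
  shows "integrable leb01 g"
  using assms by (intro leb01.integrable_const_bound[of g B] AE_I2) auto

lemma integral_bounded_leb01:
  assumes "g \<in> borel_measurable leb01" "\<And>x. x \<in> {0..1} \<Longrightarrow> \<bar>g x\<bar> \<le> (B::real)"
  shows "\<bar>LINT x|leb01. g x\<bar> \<le> B"
proof -
  have "\<bar>LINT x|leb01. g x\<bar> \<le> (LINT x|leb01. \<bar>g x\<bar>)"
    by (rule integral_abs_bound)
  also have "\<dots> \<le> (LINT x|leb01. B)"
    using assms integrable_bounded_leb01[OF assms] by (intro integral_mono) auto
  finally show ?thesis by simp
qed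

lemma integral_indicator_bound:
  assumes "g \<in> borel_measurable leb01" "\<And>x. x \<in> {0..1} \<Longrightarrow> \<bar>g x\<bar> \<le> (B::real)" "A \<in> sets leb01"
  shows "\<bar>LINT x|leb01. g x * indicator A x\<bar> \<le> B * measure leb01 A"
proof -
  have "integrable leb01 (\<lambda>x. g x * indicator A x)"
    using integrable_real_mult_indicator[OF assms(3) integrable_bounded_leb01[OF assms(1,2)]] .
  moreover have "integrable leb01 (\<lambda>x. B * indicator A x)"
    using assms(3) by (intro integrable_mult_right integrable_real_indicator) (simp_all add: leb01.emeasure_finite less_top[symmetric])
  ultimately have "(LINT x|leb01. \<bar>g x * indicator A x\<bar>) \<le> (LINT x|leb01. B * indicator A x)"
    using assms by (intro integral_mono) (auto simp: indicator_def)
  also have "\<dots> = B * measure leb01 A"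
    using assms(3) sets.Int_space_eq2[OF assms(3)] by simp
  finally show ?thesis
    using integral_abs_bound[of leb01 "\<lambda>x. g x * indicator A x"] by linarith
qed

lemma sigma_sets_atMost: "sigma_sets UNIV (range (\<lambda>a::real. {..a})) = sets borel"
  by (subst borel_eq_atMost) simp

text \<open>The Borel sets over which the integrals converge form a Dynkin system.\<close>

lemma convergent_on_borel_sets:
  fixes u :: "nat \<Rightarrow> real \<Rightarrow> real"
  assumes meas: "\<And>n. u n \<in> borel_measurable leb01"
    and bound: "\<And>n x. x \<in> {0..1} \<Longrightarrow> \<bar>u n x\<bar> \<le> K"
    and conv: "\<And>a. convergent (\<lambda>n. LINT x|leb01. u n x * indicator ({..a} \<inter> {0..1}) x)"
    and "A \<in> sets borel"
  shows "convergent (\<lambda>n. LINT x|leb01. u n x * indicator (A \<inter> {0..1}) x)"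
proof -
  have int: "integrable leb01 (u n)" for n
    using integrable_bounded_leb01[OF meas bound] by blast
  have sets01: "A \<inter> {0..1} \<in> sets leb01" if "A \<in> sets borel" for A
    using that by (auto simp: sets_leb01_iff)
  have intA: "integrable leb01 (\<lambda>x. u n x * indicator (A \<inter> {0..1}) x)" if "A \<in> sets borel" for A n
    using integrable_real_mult_indicator[OF sets01[OF that] int] .
  have "Int_stable (range (\<lambda>a::real. {..a}))" "range (\<lambda>a::real. {..a}) \<subseteq> Pow UNIV"
    "A \<in> sigma_sets UNIV (range (\<lambda>a::real. {..a}))"
    using assms(4) by (auto simp: Int_stable_def sigma_sets_atMost)
  then show ?thesis
  proof (induct rule: sigma_sets_induct_disjoint)
    case (basic A)
    then show ?case using conv by auto
  next
    case empty
    then show ?case by (simp add: convergent_const)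
  next
    case (compl A)
    then have A: "A \<in> sets borel" by (simp add: sigma_sets_atMost)
    \<comment> \<open>\<open>{..1} \<inter> {0..1}\<close> is the whole interval, so the generating
      sets already provide the total integral.\<close>
    have "(LINT x|leb01. u n x * indicator ((UNIV - A) \<inter> {0..1}) x) =
      (LINT x|leb01. u n x * indicator ({..1} \<inter> {0..1}) x) - (LINT x|leb01. u n x * indicator (A \<inter> {0..1}) x)" for n
    proof (subst Bochner_Integration.integral_diff[symmetric])
      show "integrable leb01 (\<lambda>x. u n x * indicator ({..1} \<inter> {0..1}) x)" "integrable leb01 (\<lambda>x. u n x * indicator (A \<inter> {0..1}) x)"
        by (rule intA; use A in simp)+
    qed (auto intro!: Bochner_Integration.integral_cong simp: indicator_def)
    then show ?case
      using convergent_diff[OF conv[of 1] compl(2)] by simp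
  next
    case (union A)
    then have A: "A i \<in> sets borel" for i by (auto simp: sigma_sets_atMost)
    define B where "B = (\<lambda>i. A i \<inter> {0..1})"
    have B: "B i \<in> sets leb01" for i
      unfolding B_def using sets01 A by simp
    have disj: "disjoint_family B"
      using union(1) by (auto simp: disjoint_family_on_def B_def)
    have UB: "(\<Union>i. A i) \<inter> {0..1} = (\<Union>i. B i)" by (auto simp: B_def)
    have sums: "(\<lambda>i. measure leb01 (B i)) sums measure leb01 (\<Union>i. B i)"
      using B disj by (intro leb01.finite_measure_UNION) auto
    have eq: "(LINT x|leb01. u n x * indicator (\<Union>i. B i) x) = (\<Sum>i. LINT x|leb01. u n x * indicator (B i) x)" for n
    proof -
      have "(LINT x:(\<Union>i. B i)|leb01. u n x) = (\<Sum>i. LINT x:(B i)|leb01. u n x)"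
      proof (rule lebesgue_integral_countable_add)
        show "set_integrable leb01 (\<Union>i. B i) (u n)"
          unfolding set_integrable_def real_scaleR_def
          using integrable_real_mult_indicator[OF _ int[of n], of "\<Union>i. B i"] B by (simp add: mult.commute)
      qed (use B disj in \<open>auto simp: disjoint_family_on_def\<close>)
      then show ?thesis
        by (simp add: set_lebesgue_integral_def mult.commute)
    qed
    have "\<forall>i. \<exists>l. (\<lambda>n. LINT x|leb01. u n x * indicator (B i) x) \<longlonglongrightarrow> l"
      using union(3) by (simp add: convergent_def B_def)
    then obtain l where l: "\<And>i. (\<lambda>n. LINT x|leb01. u n x * indicator (B i) x) \<longlonglongrightarrow> l i" by metis
    \<comment> \<open>Tannery's theorem exchanges limit and sum: the uniform bound on
      \<open>u\<close> gives the majorant \<open>K * measure leb01 (B i)\<close>, summable by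
      disjointness.\<close>
    have "(\<lambda>n. \<Sum>i. LINT x|leb01. u n x * indicator (B i) x) \<longlonglongrightarrow> (\<Sum>i. l i)"
    proof (rule tannerys_theorem[THEN conjunct2, THEN conjunct2])
      show "summable (\<lambda>i. K * measure leb01 (B i))"
        using sums by (intro summable_mult) (simp add: sums_iff)
      show "\<forall>\<^sub>F (i, n) in at_top \<times>\<^sub>F sequentially.
        norm (LINT x|leb01. u n x * indicator (B i) x) \<le> K * measure leb01 (B i)"
        using integral_indicator_bound[OF meas bound B] by (intro always_eventually) auto
    qed (use l in auto)
    then show ?case
      unfolding UB eq convergent_def by blast
  qed
qed

text \<open>Convergence spreads from few sets to all: a diagonal argument on initial intervals with
  rational end points, equicontinuity in the end point for the other initial intervals, the Dynkin
  argument for Borel sets, null sets for Lebesgue sets. The limit set function is bounded by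
  \<open>K\<close> times the measure and so has a density.\<close>

lemma bounded_weak_star_compact_sets:
  fixes u :: "nat \<Rightarrow> real \<Rightarrow> real"
  assumes meas: "\<And>n. u n \<in> borel_measurable leb01"
    and bound: "\<And>n x. x \<in> {0..1} \<Longrightarrow> \<bar>u n x\<bar> \<le> K"
  obtains r b where "strict_mono r" "b \<in> borel_measurable leb01" "integrable leb01 b"
    "\<And>A. A \<in> sets leb01 \<Longrightarrow>
      (\<lambda>n. LINT x|leb01. u (r n) x * indicator A x) \<longlonglongrightarrow> (LINT x|leb01. b x * indicator A x)"
proof -
  have int: "integrable leb01 (u n)" for n
    using integrable_bounded_leb01[OF meas bound] by blast
  have K: "0 \<le> K" using bound[of 0 0] by simp
  define I where "I = (\<lambda>n A. LINT x|leb01. u n x * indicator A x)"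
  have I_bound: "\<bar>I n A\<bar> \<le> K * measure leb01 A" if "A \<in> sets leb01" for n A
    unfolding I_def using integral_indicator_bound[OF meas bound that] .
  have I_add: "I n (A \<union> B) = I n A + I n B"
    if "A \<in> sets leb01" "B \<in> sets leb01" "A \<inter> B = {}" for n A B
  proof -
    have "I n (A \<union> B) = (LINT x|leb01. u n x * indicator A x + u n x * indicator B x)"
      unfolding I_def using that(3)
      by (intro Bochner_Integration.integral_cong) (auto simp: indicator_def)
    also have "\<dots> = I n A + I n B"
      unfolding I_def using integrable_real_mult_indicator[OF _ int] that
      by (intro Bochner_Integration.integral_add) auto
    finally show ?thesis .
  qed
  define q where "q = (from_nat :: nat \<Rightarrow> rat)"
  have q: "range q = UNIV"
    unfolding q_def by (rule surj_from_nat)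
  let ?T = "\<lambda>a::real. {..a} \<inter> {0..1}"
  have T: "?T a \<in> sets leb01" for a by (auto simp: sets_leb01_iff)
  have "\<bar>I n (?T (of_rat (q i)))\<bar> \<le> K" for i n
    using I_bound[OF T, of n "of_rat (q i)"] mult_left_mono[OF measure_leb01_le_1 K]
    by (metis dual_order.trans mult.right_neutral)
  then obtain r where r: "strict_mono r" "\<And>i. convergent (\<lambda>n. I (r n) (?T (of_rat (q i))))"
    using bounded_convergent_diagonal[of "\<lambda>i n. I n (?T (of_rat (q i)))" "\<lambda>_. K"] by blast
  have conv_T: "convergent (\<lambda>n. I (r n) (?T a))" for a
  proof (rule Cauchy_convergent, rule CauchyI)
    fix e :: real assume e: "e > 0"
    \<comment> \<open>Moving the end point by \<open>d\<close> changes each integral by at most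
      \<open>K * d\<close>, which is at most \<open>e / 4\<close>; the summand 1 covers
      \<open>K = 0\<close>.\<close>
    define d where "d = e / (4 * (K + 1))"
    have d: "d > 0" using e K by (simp add: d_def)
    obtain p where p: "a < of_rat p" "of_rat p < a + d"
      using of_rat_dense[of a "a + d"] d by auto
    obtain i where i: "p = q i" using q by (metis rangeE UNIV_I)
    have close: "\<bar>I n (?T a) - I n (?T (of_rat p))\<bar> \<le> e / 4" for n
    proof -
      let ?D = "{a<..of_rat p} \<inter> {0..1}"
      have D: "?D \<in> sets leb01" by (auto simp: sets_leb01_iff)
      have "?T (of_rat p) = ?T a \<union> ?D" "?T a \<inter> ?D = {}" using p(1) by auto
      then have "I n (?T (of_rat p)) = I n (?T a) + I n ?D"
        using I_add[OF T D, of a n] by simp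
      moreover have "\<bar>I n ?D\<bar> \<le> K * d"
      proof -
        have "measure leb01 ?D \<le> measure lebesgue {a<..of_rat p}"
          unfolding measure_leb01[OF Int_lower2]
          by (rule measure_mono_fmeasurable)
            (auto intro: bounded_set_imp_lmeasurable)
        also have "\<dots> \<le> d" using p by simp
        finally show ?thesis
          using I_bound[OF D, of n] mult_left_mono[OF _ K] by (meson order_trans)
      qed
      moreover have "K * d \<le> e / 4"
        using e K by (simp add: d_def field_simps)
      ultimately show ?thesis by linarith
    qed
    have "Cauchy (\<lambda>n. I (r n) (?T (of_rat p)))"
      unfolding i using r(2) by (rule convergent_Cauchy)
    from CauchyD[OF this, of "e / 4"] e obtain M where M: "\<And>m n. m \<ge> M \<Longrightarrow> n \<ge> M \<Longrightarrow>
        norm (I (r m) (?T (of_rat p)) - I (r n) (?T (of_rat p))) < e / 4"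
      by auto
    have "norm (I (r m) (?T a) - I (r n) (?T a)) < e" if "m \<ge> M" "n \<ge> M" for m n
      using M[OF that] close[of "r m"] close[of "r n"] e unfolding real_norm_def by linarith
    then show "\<exists>M. \<forall>m\<ge>M. \<forall>n\<ge>M. norm (I (r m) (?T a) - I (r n) (?T a)) < e" by blast
  qed
  have conv: "convergent (\<lambda>n. I (r n) A)" if A: "A \<in> sets leb01" for A
  proof -
    \<comment> \<open>A Lebesgue set is a Borel set up to a null set, which the integrals
      ignore.\<close>
    from A have "A \<in> sets (completion lborel)" "A \<subseteq> {0..1}" by (auto simp: sets_leb01_iff)
    then obtain S N N' where S: "A = S \<union> N" "N \<subseteq> N'" "N' \<in> null_sets lborel" "S \<in> sets lborel"
      using sets_completionE by metis
    then have SA: "S \<inter> {0..1} = S" using \<open>A \<subseteq> {0..1}\<close> by auto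
    have "N' \<in> null_sets lebesgue" using S(3) by (rule null_sets_completionI)
    then have "AE x in lebesgue. x \<notin> N'" by (rule AE_not_in)
    then have "AE x in leb01. x \<notin> N'"
      by (subst AE_restrict_space_iff) (simp, erule eventually_mono, simp)
    have S01: "S \<in> sets leb01"
      using S(4) SA by (auto simp: sets_leb01_iff)
    have "I n A = I n S" for n
      unfolding I_def
    proof (rule integral_cong_AE)
      show "(\<lambda>x. u n x * indicator A x) \<in> borel_measurable leb01" "(\<lambda>x. u n x * indicator S x) \<in> borel_measurable leb01"
        using meas A S01 by auto
      show "AE x in leb01. u n x * indicator A x = u n x * indicator S x"
        using \<open>AE x in leb01. x \<notin> N'\<close> by eventually_elim (use S(1,2) in \<open>auto simp: indicator_def\<close>)
    qed
    moreover have "convergent (\<lambda>n. LINT x|leb01. u (r n) x * indicator (S \<inter> {0..1}) x)"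
    proof (rule convergent_on_borel_sets[of "\<lambda>n. u (r n)" K])
      show "convergent (\<lambda>n. LINT x|leb01. u (r n) x * indicator ({..a} \<inter> {0..1}) x)" for a
        using conv_T[of a] by (simp only: I_def)
    qed (use meas bound S(4) in simp_all)
    ultimately show ?thesis unfolding SA by (simp add: I_def)
  qed
  define \<nu> where "\<nu> = (\<lambda>A. lim (\<lambda>n. I (r n) A))"
  have lim: "(\<lambda>n. I (r n) A) \<longlonglongrightarrow> \<nu> A" if "A \<in> sets leb01" for A
    unfolding \<nu>_def using conv[OF that] by (simp add: convergent_LIMSEQ_iff)
  have \<nu>_bound: "\<bar>\<nu> A\<bar> \<le> K * measure leb01 A" if A: "A \<in> sets leb01" for A
    using lim[OF A, THEN tendsto_rabs] I_bound[OF A] by (intro LIMSEQ_le_const2) auto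
  obtain b where b: "integrable leb01 b" "\<And>A. A \<in> sets leb01 \<Longrightarrow> \<nu> A = (LINT x|leb01. b x * indicator A x)"
  proof (rule leb01.signed_set_function_density[of \<nu> K])
    fix A B assume AB: "A \<in> sets leb01" "B \<in> sets leb01" "A \<inter> B = {}"
    have "(\<lambda>n. I (r n) (A \<union> B)) \<longlonglongrightarrow> \<nu> A + \<nu> B"
      unfolding I_add[OF AB] using AB by (intro tendsto_add lim) auto
    then show "\<nu> (A \<union> B) = \<nu> A + \<nu> B"
      using lim[of "A \<union> B"] AB LIMSEQ_unique by blast
  next
    fix e :: real assume e: "e > 0"
    have "\<bar>\<nu> A\<bar> < e" if A: "A \<in> sets leb01" "measure leb01 A < e / (K + 1)" for A
    proof -
      have "K * measure leb01 A \<le> (K + 1) * measure leb01 A"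
        by (simp add: mult_right_mono)
      also have "\<dots> < e" using A(2) K by (simp add: field_simps)
      finally show ?thesis using \<nu>_bound[OF A(1)] by linarith
    qed
    then show "\<exists>d>0. \<forall>A\<in>sets leb01. measure leb01 A < d \<longrightarrow> \<bar>\<nu> A\<bar> < e"
      using e K by (intro exI[of _ "e / (K + 1)"]) auto
  next
    show "\<bar>\<nu> A\<bar> \<le> K" if "A \<in> sets leb01" for A
      using \<nu>_bound[OF that] mult_left_mono[OF measure_leb01_le_1 K, of A] by simp
  qed blast
  show ?thesis
    using r(1) b lim by (intro that[of r b]) (auto simp: I_def)
qed

lemma integrable_mult_bounded:
  fixes f g :: "real \<Rightarrow> real"
  assumes f: "integrable leb01 f" and g: "g \<in> borel_measurable leb01" "\<And>x. x \<in> {0..1} \<Longrightarrow> \<bar>g x\<bar> \<le> B"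
  shows "integrable leb01 (\<lambda>x. f x * g x)"
proof (rule Bochner_Integration.integrable_bound[of _ "\<lambda>x. B * f x"])
  have "norm (f x * g x) \<le> norm (B * f x)" if "x \<in> {0..1}" for x
  proof -
    have "\<bar>f x\<bar> * \<bar>g x\<bar> \<le> \<bar>f x\<bar> * \<bar>B\<bar>"
      by (rule mult_left_mono) (use g(2)[OF that] in auto)
    then show ?thesis by (simp add: abs_mult mult.commute)
  qed
  then show "AE x in leb01. norm (f x * g x) \<le> norm (B * f x)"
    by (intro AE_I2) simp
qed (use f g in auto)

text \<open>Convergence on sets gives convergence on simple functions. These approximate
  \<open>g\<close> uniformly, and the common L^1 bound makes the replacement error uniform in
  \<open>n\<close>.\<close>

lemma weak_convergence_bounded_test:
  fixes u :: "nat \<Rightarrow> real \<Rightarrow> real"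
  assumes int: "\<And>n. integrable leb01 (u n)" "integrable leb01 b"
    and L1: "\<And>n. (LINT x|leb01. \<bar>u n x\<bar>) \<le> K"
    and sets: "\<And>A. A \<in> sets leb01 \<Longrightarrow>
      (\<lambda>n. LINT x|leb01. u n x * indicator A x) \<longlonglongrightarrow> (LINT x|leb01. b x * indicator A x)"
    and g: "g \<in> borel_measurable leb01" "\<And>x. x \<in> {0..1} \<Longrightarrow> \<bar>g x\<bar> \<le> B"
  shows "(\<lambda>n. LINT x|leb01. u n x * g x) \<longlonglongrightarrow> (LINT x|leb01. b x * g x)"
proof (rule LIMSEQ_I)
  fix e :: real assume e: "e > 0"
  \<comment> \<open>A positive common bound for the L^1 norms of all \<open>u n\<close> and of
    \<open>b\<close>, which turns a uniform error \<open>d\<close> into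
    \<open>e / 4\<close>.\<close>
  define K' where "K' = \<bar>K\<bar> + (LINT x|leb01. \<bar>b x\<bar>) + 1"
  have "0 \<le> (LINT x|leb01. \<bar>b x\<bar>)" by simp
  then have K': "K' > 0" "K \<le> K'" "(LINT x|leb01. \<bar>b x\<bar>) \<le> K'" unfolding K'_def by linarith+
  define d where "d = e / (4 * K')"
  have d: "d > 0" using e K' by (simp add: d_def)
  obtain m :: nat and c A where A: "\<And>i. A i \<in> sets leb01"
    and approx: "\<And>x. x \<in> space leb01 \<Longrightarrow> \<bar>g x - (\<Sum>i<m. c i * indicator (A i) x)\<bar> \<le> d"
  proof (rule bounded_simple_approx[OF g(1) _ d, of B])
    show "\<bar>g x\<bar> \<le> B" if "x \<in> space leb01" for x
      using g(2) that by simp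
  qed blast
  define s where "s = (\<lambda>x. \<Sum>i<m. c i * indicator (A i) x)"
  have s_meas: "s \<in> borel_measurable leb01"
    unfolding s_def using A by measurable
  have eq: "(LINT x|leb01. f x * s x) = (\<Sum>i<m. c i * (LINT x|leb01. f x * indicator (A i) x))"
    and near: "\<bar>(LINT x|leb01. f x * g x) - (LINT x|leb01. f x * s x)\<bar> \<le> e / 4"
    if f: "integrable leb01 f" "(LINT x|leb01. \<bar>f x\<bar>) \<le> K'" for f
  proof -
    have fA: "integrable leb01 (\<lambda>x. f x * indicator (A i) x)" for i
      using integrable_real_mult_indicator[OF A f(1)] .
    have "(LINT x|leb01. f x * s x) = (LINT x|leb01. (\<Sum>i<m. c i * (f x * indicator (A i) x)))"
      unfolding s_def by (intro Bochner_Integration.integral_cong) (auto simp: sum_distrib_left mult_ac simp del: sum_mult_indicator intro!: sum.cong)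
    also have "\<dots> = (\<Sum>i<m. c i * (LINT x|leb01. f x * indicator (A i) x))"
      using fA by (subst Bochner_Integration.integral_sum) auto
    finally show "(LINT x|leb01. f x * s x) = (\<Sum>i<m. c i * (LINT x|leb01. f x * indicator (A i) x))" .
    have fs: "integrable leb01 (\<lambda>x. f x * s x)"
    proof -
      have "integrable leb01 (\<lambda>x. \<Sum>i<m. c i * (f x * indicator (A i) x))"
        using fA by auto
      then show ?thesis by (simp add: s_def sum_distrib_left mult_ac del: sum_mult_indicator)
    qed
    have fg: "integrable leb01 (\<lambda>x. f x * g x)"
      using integrable_mult_bounded[OF f(1) g] .
    have "(LINT x|leb01. f x * g x) - (LINT x|leb01. f x * s x) = (LINT x|leb01. f x * (g x - s x))"
      using fs fg by (simp add: right_diff_distrib)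
    also have "\<bar>\<dots>\<bar> \<le> (LINT x|leb01. \<bar>f x * (g x - s x)\<bar>)"
      by (rule integral_abs_bound)
    also have "\<dots> \<le> (LINT x|leb01. \<bar>f x\<bar> * d)"
    proof (rule integral_mono)
      show "integrable leb01 (\<lambda>x. \<bar>f x * (g x - s x)\<bar>)"
        using fs fg by (auto simp: right_diff_distrib)
      show "integrable leb01 (\<lambda>x. \<bar>f x\<bar> * d)" using f(1) by auto
      fix x assume "x \<in> space leb01"
      then show "\<bar>f x * (g x - s x)\<bar> \<le> \<bar>f x\<bar> * d"
        using approx[of x] unfolding abs_mult s_def by (intro mult_left_mono) auto
    qed
    also have "\<dots> = (LINT x|leb01. \<bar>f x\<bar>) * d" by simp
    also have "\<dots> \<le> K' * d" using f(2) d by (intro mult_right_mono) auto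
    also have "\<dots> = e / 4" using K'(1) by (simp add: d_def)
    finally show "\<bar>(LINT x|leb01. f x * g x) - (LINT x|leb01. f x * s x)\<bar> \<le> e / 4" .
  qed
  have u: "integrable leb01 (u n)" "(LINT x|leb01. \<bar>u n x\<bar>) \<le> K'" for n
    using int(1) L1[of n] K'(2) by auto
  have "(\<lambda>n. LINT x|leb01. u n x * s x) \<longlonglongrightarrow> (LINT x|leb01. b x * s x)"
    unfolding eq[OF u] eq[OF int(2) K'(3)] using sets[OF A] by (intro tendsto_intros)
  then obtain n0 where n0: "\<And>n. n \<ge> n0 \<Longrightarrow> \<bar>(LINT x|leb01. u n x * s x) - (LINT x|leb01. b x * s x)\<bar> < e / 4"
    using LIMSEQ_D[of _ _ "e / 4"] e by fastforce
  have "norm ((LINT x|leb01. u n x * g x) - (LINT x|leb01. b x * g x)) < e" if "n \<ge> n0" for n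
    using n0[OF that] near[OF u, of n] near[OF int(2) K'(3)] e unfolding real_norm_def by linarith
  then show "\<exists>no. \<forall>n\<ge>no. norm ((LINT x|leb01. u n x * g x) - (LINT x|leb01. b x * g x)) < e" by blast
qed

lemma AE_le_of_integral_indicator_le:
  fixes b :: "real \<Rightarrow> real"
  assumes b: "integrable leb01 b"
    and le: "\<And>A. A \<in> sets leb01 \<Longrightarrow> (LINT x|leb01. b x * indicator A x) \<le> K * measure leb01 A"
  shows "AE x in leb01. b x \<le> K"
proof -
  \<comment> \<open>The test set is the exceptional set itself: there \<open>b - K\<close> is
    positive, yet its integral is at most 0.\<close>
  define A where "A = {x\<in>space leb01. K < b x}"
  have A: "A \<in> sets leb01"
    unfolding A_def using borel_measurable_integrable[OF b] by measurable
  have i1: "integrable leb01 (\<lambda>x. b x * indicator A x)"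
    using integrable_real_mult_indicator[OF A b] .
  have i2: "integrable leb01 (\<lambda>x. K * indicator A x)"
    using A by (intro integrable_mult_right integrable_real_indicator) (simp_all add: leb01.emeasure_finite less_top[symmetric])
  have "(LINT x|leb01. (b x - K) * indicator A x) \<le> 0"
    using le[OF A] i1 i2 A sets.Int_space_eq2[OF A] by (simp add: left_diff_distrib)
  moreover have nonneg: "0 \<le> (b x - K) * indicator A x" for x
    by (simp add: A_def indicator_def)
  then have "0 \<le> (LINT x|leb01. (b x - K) * indicator A x)" by simp
  ultimately have "(LINT x|leb01. (b x - K) * indicator A x) = 0" by linarith
  then have "AE x in leb01. (b x - K) * indicator A x = 0"
    using i1 i2 nonneg by (subst (asm) integral_nonneg_eq_0_iff_AE) (auto simp: left_diff_distrib)
  then show ?thesis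
    by (rule AE_mp) (auto simp: A_def indicator_def intro!: AE_I2)
qed

lemma bounded_weak_star_compact:
  fixes u :: "nat \<Rightarrow> real \<Rightarrow> real"
  assumes meas: "\<And>n. u n \<in> borel_measurable leb01"
    and bound: "\<And>n x. x \<in> {0..1} \<Longrightarrow> \<bar>u n x\<bar> \<le> K"
  obtains r b where "strict_mono r" "b \<in> borel_measurable leb01" "\<And>x. \<bar>b x\<bar> \<le> K"
    "\<And>g B. g \<in> borel_measurable leb01 \<Longrightarrow> (\<And>x. x \<in> {0..1} \<Longrightarrow> \<bar>g x\<bar> \<le> B) \<Longrightarrow>
      (\<lambda>n. LINT x|leb01. u (r n) x * g x) \<longlonglongrightarrow> (LINT x|leb01. b x * g x)"
proof (rule bounded_weak_star_compact_sets[of u K, OF meas bound])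
  fix r :: "nat \<Rightarrow> nat" and b :: "real \<Rightarrow> real"
  assume r: "strict_mono r" and b: "b \<in> borel_measurable leb01" "integrable leb01 b"
    and lim: "\<And>A. A \<in> sets leb01 \<Longrightarrow>
      (\<lambda>n. LINT x|leb01. u (r n) x * indicator A x) \<longlonglongrightarrow> (LINT x|leb01. b x * indicator A x)"
  have K: "0 \<le> K" using bound[of 0 0] by simp
  have b_bound: "\<bar>LINT x|leb01. b x * indicator A x\<bar> \<le> K * measure leb01 A" if A: "A \<in> sets leb01" for A
    using lim[OF A, THEN tendsto_rabs] integral_indicator_bound[OF meas bound A]
    by (intro LIMSEQ_le_const2) auto
  have "AE x in leb01. b x \<le> K"
    using b(2) b_bound by (intro AE_le_of_integral_indicator_le) (auto simp: abs_le_iff)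
  moreover have "AE x in leb01. - b x \<le> K"
    using b(2) b_bound by (intro AE_le_of_integral_indicator_le) (auto simp: abs_le_iff)
  ultimately have AE_b: "AE x in leb01. max (- K) (min K (b x)) = b x"
    by eventually_elim (auto simp: max_def min_def)
  \<comment> \<open>Clipping changes \<open>b\<close> only on a null set and turns the a.e. bound
    into a pointwise one.\<close>
  define b' where "b' = (\<lambda>x. max (- K) (min K (b x)))"
  have b': "b' \<in> borel_measurable leb01" "\<And>x. \<bar>b' x\<bar> \<le> K"
    using b(1) K by (auto simp: b'_def)
  have "(\<lambda>n. LINT x|leb01. u (r n) x * g x) \<longlonglongrightarrow> (LINT x|leb01. b' x * g x)"
    if g: "g \<in> borel_measurable leb01" "\<And>x. x \<in> {0..1} \<Longrightarrow> \<bar>g x\<bar> \<le> B" for g B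
  proof -
    have "(\<lambda>n. LINT x|leb01. u (r n) x * g x) \<longlonglongrightarrow> (LINT x|leb01. b x * g x)"
    proof (rule weak_convergence_bounded_test[OF _ b(2) _ lim g])
      show "integrable leb01 (u (r n))" for n
        using integrable_bounded_leb01[OF meas bound] .
      show "(LINT x|leb01. \<bar>u (r n) x\<bar>) \<le> K" for n
        using integral_bounded_leb01[of "\<lambda>x. \<bar>u (r n) x\<bar>" K] meas bound by auto
    qed
    moreover have "(LINT x|leb01. b x * g x) = (LINT x|leb01. b' x * g x)"
    proof (rule integral_cong_AE)
      show "AE x in leb01. b x * g x = b' x * g x"
        using AE_b by eventually_elim (simp add: b'_def)
    qed (use b(1) b'(1) g(1) in auto)
    ultimately show ?thesis by simp
  qed
  with r b' show thesis by (rule that)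
qed

section \<open>Komlos's theorem\<close>

lemma averages_tendsto:
  fixes a :: "nat \<Rightarrow> real"
  assumes "a \<longlonglongrightarrow> L"
  shows "(\<lambda>n. (\<Sum>i<n. a i) / real n) \<longlonglongrightarrow> L"
proof (rule LIMSEQ_I)
  fix e :: real assume e: "e > 0"
  from LIMSEQ_D[OF assms, of "e / 2"] e obtain N where N: "\<And>n. n \<ge> N \<Longrightarrow> \<bar>a n - L\<bar> < e / 2"
    by (auto simp: real_norm_def)
  define B where "B = (\<Sum>i<N. \<bar>a i - L\<bar>)"
  have B0: "0 \<le> B" unfolding B_def by (rule sum_nonneg) simp
  obtain M :: nat where M: "2 * B / e < real M" using reals_Archimedean2 by blast
  show "\<exists>no. \<forall>n\<ge>no. norm ((\<Sum>i<n. a i) / real n - L) < e"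
  proof (intro exI allI impI)
    fix n assume n: "n \<ge> max (Suc N) M"
    have n0: "real n > 0" using n by simp
    have "(\<Sum>i<n. a i) / real n - L = (\<Sum>i<n. a i - L) / real n"
      using n0 by (simp add: sum_subtractf field_simps)
    also have "\<bar>\<dots>\<bar> \<le> (\<Sum>i<n. \<bar>a i - L\<bar>) / real n"
      by (simp add: divide_right_mono sum_abs)
    also have "(\<Sum>i<n. \<bar>a i - L\<bar>) = B + (\<Sum>i=N..<n. \<bar>a i - L\<bar>)"
      unfolding B_def using n by (simp add: lessThan_atLeast0 sum.atLeastLessThan_concat)
    also have "\<dots> \<le> B + (\<Sum>i=N..<n. e / 2)"
      using N by (intro add_left_mono sum_mono less_imp_le) auto
    also have "\<dots> \<le> B + real n * (e / 2)"
      using e by (simp add: mult_right_mono)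
    finally have "\<bar>(\<Sum>i<n. a i) / real n - L\<bar> \<le> (B + real n * (e / 2)) / real n"
      using n0 by (simp add: divide_right_mono)
    also have "\<dots> = B / real n + e / 2" using n0 by (simp add: field_simps)
    also have "B / real n < e / 2"
    proof -
      have "2 * B / e < real n" using M n by simp
      then show ?thesis using e n0 by (simp add: field_simps)
    qed
    finally show "norm ((\<Sum>i<n. a i) / real n - L) < e" by simp
  qed
qed

text \<open>An integer version of the geometric progression with ratio \<open>1 + 1 / p\<close>, for
  positive \<open>p\<close>. The summand 1 keeps it strictly increasing while the quotient is still
  0.\<close>

primrec block :: "nat \<Rightarrow> nat \<Rightarrow> nat" where
  "block p 0 = 1"
| "block p (Suc i) = block p i + block p i div p + 1"

lemma strict_mono_block: "strict_mono (block p)"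
  by (simp add: strict_mono_Suc_iff)

lemma block_pos: "0 < block p i"
  by (cases i) auto

text \<open>Etemadi's interpolation: monotone partial sums are controlled between the block ends.\<close>

lemma averages_tendsto_of_blocks:
  fixes g :: "nat \<Rightarrow> real"
  assumes nonneg: "\<And>i. 0 \<le> g i"
    and blocks: "\<And>p. p > 0 \<Longrightarrow> (\<lambda>i. (\<Sum>j<block p i. g j) / real (block p i)) \<longlonglongrightarrow> L"
  shows "(\<lambda>n. (\<Sum>j<n. g j) / real n) \<longlonglongrightarrow> L"
proof (rule LIMSEQ_I)
  fix e :: real assume e: "e > 0"
  define T where "T = (\<lambda>n. \<Sum>j<n. g j)"
  have T_mono: "T m \<le> T n" if "m \<le> n" for m n
    unfolding T_def using that nonneg by (intro sum_mono2) auto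
  have T_nonneg: "0 \<le> T n" for n
    unfolding T_def using nonneg by (intro sum_nonneg) auto
  have L: "0 \<le> L"
    using blocks[of 1] by (rule LIMSEQ_le_const) (auto intro!: exI[of _ 0] divide_nonneg_nonneg sum_nonneg nonneg)
  \<comment> \<open>Interpolating between block ends distorts the limit by a factor close to
    \<open>1 + 1 / p\<close>; this \<open>p\<close> makes the resulting error \<open>L / p\<close>
    smaller than \<open>e\<close>.\<close>
  obtain p :: nat where p: "p > 0" "L / p < e"
  proof -
    obtain p0 :: nat where "L / e < real p0" using reals_Archimedean2 by blast
    then have "L / real (Suc p0) < e" using e by (simp add: field_simps)
    then show ?thesis using that[of "Suc p0"] by simp
  qed
  define k where "k = block p"
  have k_pos: "0 < real (k i)" for i using block_pos unfolding k_def by simp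
  have k_mono: "strict_mono k" unfolding k_def by (rule strict_mono_block)
  have lim: "(\<lambda>i. T (k i) / k i) \<longlonglongrightarrow> L"
    using blocks[OF p(1)] unfolding T_def k_def .
  \<comment> \<open>An upper bound for the ratio of consecutive block ends; the last summand
    accounts for the 1 added in \<open>block\<close>.\<close>
  define c where "c = (\<lambda>i. 1 + 1 / real p + 1 / real (k i))"
  have c_pos: "c i > 0" for i
    unfolding c_def using p(1) k_pos[of i] by (simp add: add_pos_pos)
  have step: "real (k (Suc i)) \<le> k i * c i" for i
  proof -
    have "real (k i div p * p) \<le> real (k i)" by (rule of_nat_mono) simp
    then have "real (k i div p) \<le> real (k i) / real p" using p(1) by (simp add: pos_le_divide_eq)
    then have "real (k (Suc i)) \<le> real (k i) + real (k i) / real p + 1" by (simp add: k_def)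
    also have "\<dots> = k i * c i" unfolding c_def using k_pos[of i] by (simp add: field_simps)
    finally show ?thesis .
  qed
  have "(\<lambda>i. 1 / real (k i)) \<longlonglongrightarrow> 0"
    using LIMSEQ_subseq_LIMSEQ[OF lim_1_over_n k_mono] by (simp add: o_def)
  then have c_lim: "c \<longlonglongrightarrow> 1 + 1 / p + 0"
    unfolding c_def by (intro tendsto_intros)
  have up: "(\<lambda>i. (T (k (Suc i)) / k (Suc i)) * c i) \<longlonglongrightarrow> L * (1 + 1 / p + 0)"
    using LIMSEQ_Suc[OF lim] c_lim by (rule tendsto_mult)
  have low: "(\<lambda>i. (T (k i) / k i) / c i) \<longlonglongrightarrow> L / (1 + 1 / p + 0)"
    using lim c_lim by (rule tendsto_divide) (use p(1) in \<open>simp add: add_pos_pos add_nonneg_eq_0_iff\<close>)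
  have "L * (1 + 1 / p + 0) < L + e" using p by (simp add: field_simps)
  moreover have "L - e < L / (1 + 1 / p + 0)"
  proof -
    have "(L - e) * (1 + 1 / p) = L + L / p - e - e / p" using p(1) by (simp add: field_simps)
    also have "\<dots> < L"
    proof -
      have "0 < e / p" using p(1) e by simp
      then show ?thesis using p(2) by linarith
    qed
    finally show ?thesis using p(1) by (simp add: pos_less_divide_eq add_pos_pos)
  qed
  ultimately obtain i0 where i0: "\<And>i. i \<ge> i0 \<Longrightarrow> (T (k (Suc i)) / k (Suc i)) * c i < L + e"
    "\<And>i. i \<ge> i0 \<Longrightarrow> L - e < (T (k i) / k i) / c i"
    using order_tendstoD(2)[OF up] order_tendstoD(1)[OF low] unfolding eventually_sequentially
    by (metis (no_types, lifting) nle_le order_trans)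
  show "\<exists>no. \<forall>n\<ge>no. norm ((\<Sum>j<n. g j) / real n - L) < e"
  proof (intro exI allI impI)
    fix n assume n: "n \<ge> k i0"
    have ex: "\<exists>i. n < k (Suc i)"
      using strict_mono_imp_increasing[OF k_mono, of "Suc n"] by (intro exI[of _ n]) simp
    \<comment> \<open>The block that contains \<open>n\<close>: then \<open>T n / n\<close> lies
      between \<open>T (k i) / k (Suc i)\<close> and \<open>T (k (Suc i)) / k i\<close>.\<close>
    define i where "i = (LEAST i. n < k (Suc i))"
    have i1: "n < k (Suc i)" unfolding i_def using ex by (rule LeastI_ex)
    have i2: "k i \<le> n"
    proof (cases i)
      case 0
      have "k 0 \<le> k i0" using k_mono by (simp add: strict_mono_less_eq)
      then show ?thesis using 0 n by simp
    next
      case (Suc i')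
      then have "\<not> n < k (Suc i')" unfolding i_def using not_less_Least[of i' "\<lambda>i. n < k (Suc i)"] by simp
      then show ?thesis using Suc by simp
    qed
    have "k i0 < k (Suc i)" using n i1 by simp
    then have ge: "i \<ge> i0" using k_mono by (simp add: strict_mono_less)
    have npos: "real n > 0" using i2 k_pos[of i] by (metis gr0I le_zero_eq of_nat_0_less_iff not_gr0)
    have "T n / n \<le> T (k (Suc i)) / k i"
      using T_mono[of n "k (Suc i)"] i1 i2 k_pos[of i] T_nonneg by (intro frac_le) auto
    also have "\<dots> \<le> (T (k (Suc i)) / k (Suc i)) * c i"
    proof -
      have "T (k (Suc i)) * k (Suc i) \<le> T (k (Suc i)) * (k i * c i)"
        using step[of i] T_nonneg by (rule mult_left_mono)
      then show ?thesis using k_pos[of i] k_pos[of "Suc i"] by (simp add: field_simps)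
    qed
    also have "\<dots> < L + e" using i0(1)[OF ge] .
    finally have u: "T n / n < L + e" .
    have "L - e < (T (k i) / k i) / c i" using i0(2)[OF ge] .
    also have "\<dots> = T (k i) / (k i * c i)" by simp
    also have "\<dots> \<le> T (k i) / k (Suc i)"
      using step[of i] T_nonneg k_pos[of "Suc i"] by (intro divide_left_mono) (auto intro!: mult_pos_pos simp: k_pos c_pos)
    also have "\<dots> \<le> T n / n"
      using T_mono[OF i2] i1 npos T_nonneg by (intro frac_le) auto
    finally show "norm ((\<Sum>j<n. g j) / real n - L) < e"
      using u unfolding T_def real_norm_def by linarith
  qed
qed

text \<open>A condensation argument: the block that starts at \<open>k\<close> has more than
  \<open>k / p\<close> indices, and monotonicity of \<open>V\<close> makes each contribute at least
  a fixed multiple of \<open>V k / k^2\<close>. The whole block thus recovers \<open>V k / k\<close>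
  up to a factor depending on \<open>p\<close>.\<close>

lemma summable_block_averages:
  fixes V :: "nat \<Rightarrow> real"
  assumes "p > 0" and mono: "\<And>m n. m \<le> n \<Longrightarrow> V m \<le> V n" and nonneg: "\<And>n. 0 \<le> V n"
    and summ: "summable (\<lambda>j. V j / (real (Suc j))\<^sup>2)"
  shows "summable (\<lambda>i. V (block p i) / real (block p i))"
proof -
  let ?k = "block p"
  let ?a = "\<lambda>j. V j / (real (Suc j))\<^sup>2"
  have a0: "0 \<le> ?a j" for j using nonneg by simp
  have one: "V (?k i) / real (?k i) \<le> 9 * real p * (\<Sum>j=?k i..<?k (Suc i). ?a j)" for i
  proof -
    let ?n = "?k i"
    have n: "0 < ?n" by (rule block_pos)
    have "?n div p \<le> ?n" by simp
    moreover have "?k (Suc i) = ?n + ?n div p + 1" by simp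
    \<comment> \<open>Within a block \<open>j + 1\<close> is at most three times the first index,
      whence the factor 9 for the squares.\<close>
    ultimately have 3: "?k (Suc i) \<le> 3 * ?n" using n by linarith
    have "?n < (?n div p + 1) * p"
      using assms(1) by (metis Suc_eq_plus1 dividend_less_div_times mult.commute mult_Suc_right add.commute)
    then have *: "real ?n \<le> real (?n div p + 1) * real p"
      by (metis less_imp_le of_nat_le_iff of_nat_mult)
    have "real (?n div p + 1) * (V ?n / (9 * (real ?n)\<^sup>2)) = (\<Sum>j=?n..<?k (Suc i). V ?n / (9 * (real ?n)\<^sup>2))"
      by simp
    also have "\<dots> \<le> (\<Sum>j=?n..<?k (Suc i). ?a j)"
    proof (rule sum_mono)
      fix j assume j: "j \<in> {?n..<?k (Suc i)}"
      have "real (Suc j) \<le> 3 * real ?n" using j 3 by simp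
      then have "(real (Suc j))\<^sup>2 \<le> (3 * real ?n)\<^sup>2" by (intro power_mono) auto
      then show "V ?n / (9 * (real ?n)\<^sup>2) \<le> ?a j"
        using j mono[of ?n j] nonneg by (intro frac_le) (auto simp: power_mult_distrib)
    qed
    finally have **: "real (?n div p + 1) * (V ?n / (9 * (real ?n)\<^sup>2)) \<le> (\<Sum>j=?n..<?k (Suc i). ?a j)" .
    have "V ?n / real ?n = real ?n * (V ?n / (real ?n)\<^sup>2)"
      using n by (simp add: power2_eq_square)
    also have "\<dots> \<le> (real (?n div p + 1) * real p) * (V ?n / (real ?n)\<^sup>2)"
      using * nonneg by (intro mult_right_mono) auto
    also have "\<dots> = 9 * real p * (real (?n div p + 1) * (V ?n / (9 * (real ?n)\<^sup>2)))"
      by simp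
    also have "\<dots> \<le> 9 * real p * (\<Sum>j=?n..<?k (Suc i). ?a j)"
      using ** by (intro mult_left_mono) auto
    finally show ?thesis .
  qed
  have partial: "(\<Sum>i<m. \<Sum>j=?k i..<?k (Suc i). ?a j) = (\<Sum>j=?k 0..<?k m. ?a j)" for m
  proof (induct m)
    case (Suc m)
    have "?k 0 \<le> ?k m" "?k m \<le> ?k (Suc m)" using strict_mono_block[of p] by (simp_all only: strict_mono_less_eq)
    then show ?case using Suc by (simp add: sum.atLeastLessThan_concat del: block.simps)
  qed simp
  have "summable (\<lambda>i. \<Sum>j=?k i..<?k (Suc i). ?a j)"
  proof (rule summableI_nonneg_bounded[of _ "suminf ?a"])
    show "0 \<le> (\<Sum>j=?k i..<?k (Suc i). ?a j)" for i by (rule sum_nonneg) (rule a0)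
    show "(\<Sum>i<m. \<Sum>j=?k i..<?k (Suc i). ?a j) \<le> suminf ?a" for m
      unfolding partial using summ a0 by (intro sum_le_suminf) auto
  qed
  then have "summable (\<lambda>i. 9 * real p * (\<Sum>j=?k i..<?k (Suc i). ?a j))"
    by (rule summable_mult)
  then show ?thesis
  proof (rule summable_comparison_test'[where N = 0])
    show "norm (V (?k i) / real (?k i)) \<le> 9 * real p * (\<Sum>j=?k i..<?k (Suc i). ?a j)" for i
      using one[of i] nonneg by simp
  qed
qed

text \<open>The sum of \<open>1 / (j + 1)^2\<close> over \<open>j > k\<close> is of order
  \<open>1 / k\<close>, which balances the weight \<open>2 * k + 1\<close>. Instead of exchanging a
  double sum, the induction carries the remainder \<open>V J / J\<close>.\<close>

lemma summable_weighted_tails: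
  fixes w :: "nat \<Rightarrow> real"
  assumes w: "\<And>k. 0 \<le> w k" "summable w"
  shows "summable (\<lambda>j. (\<Sum>k<j. (2 * real k + 1) * w k) / (real (Suc j))\<^sup>2)"
proof -
  define V where "V = (\<lambda>j. \<Sum>k<j. (2 * real k + 1) * w k)"
  have V0: "0 \<le> V j" for j unfolding V_def using w by (intro sum_nonneg) auto
  have pot: "(\<Sum>j<J. V j / (real (Suc j))\<^sup>2) + V J / real J \<le> 2 * (\<Sum>k<J. w k)" for J
  proof (induct J)
    case 0 then show ?case by (simp add: V_def)
  next
    case (Suc J)
    have V_Suc: "V (Suc J) = V J + (2 * real J + 1) * w J" by (simp add: V_def)
    have a: "(2 * real J + 1) * w J / real (Suc J) \<le> 2 * w J"
      using w(1)[of J] by (simp add: field_simps)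
    \<comment> \<open>The new term is absorbed by the drop of the remainder from
      \<open>V J / J\<close> to \<open>V J / (J + 1)\<close>. At \<open>J = 0\<close>, where the
      quotient is 0 by convention, everything vanishes because \<open>V 0 = 0\<close>.\<close>
    have b: "V J / (real (Suc J))\<^sup>2 + V J / real (Suc J) \<le> V J / real J"
    proof (cases "J = 0")
      case True then show ?thesis by (simp add: V_def)
    next
      case False
      have "1 / (real (Suc J))\<^sup>2 + 1 / real (Suc J) \<le> 1 / real J"
      proof -
        have "1 / S\<^sup>2 + 1 / S = (S + 1) / S\<^sup>2" if "S > 0" for S :: real
          using that by (simp add: field_simps power2_eq_square)
        from this[of "real (Suc J)"]
        have "1 / (real (Suc J))\<^sup>2 + 1 / real (Suc J) = (real J + 2) / (real (Suc J))\<^sup>2"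
          by (simp add: add.commute)
        moreover have "(real J + 2) * real J \<le> (real (Suc J))\<^sup>2"
          by (simp add: power2_eq_square algebra_simps)
        ultimately show ?thesis
          using False by (simp add: pos_le_divide_eq pos_divide_le_eq)
      qed
      from mult_left_mono[OF this V0[of J]] show ?thesis by (simp add: algebra_simps)
    qed
    have "V (Suc J) / real (Suc J) = V J / real (Suc J) + (2 * real J + 1) * w J / real (Suc J)"
      unfolding V_Suc by (rule add_divide_distrib)
    then show ?case using Suc a b by simp
  qed
  have "summable (\<lambda>j. V j / (real (Suc j))\<^sup>2)"
  proof (rule summableI_nonneg_bounded[of _ "2 * suminf w"])
    show "(\<Sum>j<J. V j / (real (Suc j))\<^sup>2) \<le> 2 * suminf w" for J
    proof -
      have "0 \<le> V J / real J" using V0 by simp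
      moreover have "(\<Sum>k<J. w k) \<le> suminf w" using w by (intro sum_le_suminf) auto
      ultimately show ?thesis using pot[of J] by linarith
    qed
  qed (use V0 in simp)
  then show ?thesis unfolding V_def .
qed

lemma summable_AE:
  fixes h :: "nat \<Rightarrow> 'a \<Rightarrow> real"
  assumes h: "\<And>n. integrable M (h n)" "\<And>n x. 0 \<le> h n x" and s: "summable (\<lambda>n. LINT x|M. h n x)"
  shows "AE x in M. summable (\<lambda>n. h n x)"
proof -
  have "(\<integral>\<^sup>+x. (\<Sum>n. ennreal (h n x)) \<partial>M) = (\<Sum>n. \<integral>\<^sup>+x. ennreal (h n x) \<partial>M)"
    using h(1) by (intro nn_integral_suminf) auto
  also have "\<dots> = (\<Sum>n. ennreal (LINT x|M. h n x))"
    using h by (intro suminf_cong nn_integral_eq_integral) auto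
  also have "\<dots> = ennreal (\<Sum>n. LINT x|M. h n x)"
    using h s by (intro suminf_ennreal2) auto
  finally have "(\<integral>\<^sup>+x. (\<Sum>n. ennreal (h n x)) \<partial>M) \<noteq> \<infinity>" by simp
  moreover have "(\<lambda>x. \<Sum>n. ennreal (h n x)) \<in> borel_measurable M"
    using h(1) by measurable
  ultimately have "AE x in M. (\<Sum>n. ennreal (h n x)) \<noteq> \<infinity>"
    by (intro nn_integral_PInf_AE) auto
  then show ?thesis
    by eventually_elim (use h(2) in \<open>auto intro: summable_suminf_not_top\<close>)
qed

text \<open>Each choice may depend on its stage and on the previously chosen index \<open>B\<close>;
  stage 0 has no predecessor and receives the dummy value 0.\<close>

lemma eventual_selection:
  fixes P :: "nat \<Rightarrow> nat \<Rightarrow> nat \<Rightarrow> bool"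
  assumes "\<And>n B. \<forall>\<^sub>F k in sequentially. P n B k"
  obtains r where "strict_mono r" "P 0 0 (r 0)" "\<And>n. P (Suc n) (r n) (r (Suc n))"
proof -
  have "\<forall>n B. \<exists>K. \<forall>k\<ge>K. P n B k"
    using assms unfolding eventually_sequentially by blast
  then obtain K where K: "\<And>n B k. k \<ge> K n B \<Longrightarrow> P n B k" by metis
  define r where "r = rec_nat (K 0 0) (\<lambda>n rn. max (Suc rn) (K (Suc n) rn))"
  have r: "r 0 = K 0 0" "r (Suc n) = max (Suc (r n)) (K (Suc n) (r n))" for n
    by (simp_all add: r_def)
  show ?thesis
    by (rule that[of r]) (auto simp: strict_mono_Suc_iff r intro!: K)
qed

text \<open>The bound is pointwise on the unit interval rather than essential, so that sums,
  products and integrals of truncations and step functions involve no exceptional sets.\<close>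

definition bounded_L0 :: "(real \<Rightarrow> real) set" where
  "bounded_L0 = {f \<in> L0. \<exists>B. \<forall>x\<in>{0..1}. \<bar>f x\<bar> \<le> B}"

lemma bounded_L0I: "f \<in> borel_measurable leb01 \<Longrightarrow> (\<And>x. x \<in> {0..1} \<Longrightarrow> \<bar>f x\<bar> \<le> B) \<Longrightarrow> f \<in> bounded_L0"
  unfolding bounded_L0_def L0_def by blast

lemma bounded_L0E:
  assumes "f \<in> bounded_L0"
  obtains B where "f \<in> borel_measurable leb01" "0 \<le> B" "\<And>x. x \<in> {0..1} \<Longrightarrow> \<bar>f x\<bar> \<le> B"
proof -
  from assms obtain B where B: "f \<in> borel_measurable leb01" "\<forall>x\<in>{0..1}. \<bar>f x\<bar> \<le> B"
    by (auto simp: bounded_L0_def L0_def)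
  then have "\<bar>f 0\<bar> \<le> B" by simp
  then have "0 \<le> B" by linarith
  with B show ?thesis using that by blast
qed

lemma bounded_L0_measurable: "f \<in> bounded_L0 \<Longrightarrow> f \<in> borel_measurable leb01"
  by (simp add: bounded_L0_def L0_def)

lemma bounded_L0_integrable: "f \<in> bounded_L0 \<Longrightarrow> integrable leb01 f"
  by (erule bounded_L0E) (rule integrable_bounded_leb01)

lemma bounded_L0_const: "(\<lambda>x. c) \<in> bounded_L0"
  by (rule bounded_L0I[of _ "\<bar>c\<bar>"]) auto

lemma bounded_L0_add:
  assumes "f \<in> bounded_L0" "g \<in> bounded_L0"
  shows "(\<lambda>x. f x + g x) \<in> bounded_L0"
proof -
  obtain B C where B: "f \<in> borel_measurable leb01" "\<And>x. x \<in> {0..1} \<Longrightarrow> \<bar>f x\<bar> \<le> B"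
    and C: "g \<in> borel_measurable leb01" "\<And>x. x \<in> {0..1} \<Longrightarrow> \<bar>g x\<bar> \<le> C"
    using assms by (metis bounded_L0E)
  have "\<bar>f x + g x\<bar> \<le> B + C" if "x \<in> {0..1}" for x
    using B(2)[OF that] C(2)[OF that] by linarith
  then show ?thesis
    using B(1) C(1) by (intro bounded_L0I) auto
qed

lemma bounded_L0_mult:
  assumes "f \<in> bounded_L0" "g \<in> bounded_L0"
  shows "(\<lambda>x. f x * g x) \<in> bounded_L0"
proof -
  obtain B C where B: "f \<in> borel_measurable leb01" "0 \<le> B" "\<And>x. x \<in> {0..1} \<Longrightarrow> \<bar>f x\<bar> \<le> B"
    and C: "g \<in> borel_measurable leb01" "\<And>x. x \<in> {0..1} \<Longrightarrow> \<bar>g x\<bar> \<le> C"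
    using assms by (metis bounded_L0E)
  have "\<bar>f x * g x\<bar> \<le> B * C" if "x \<in> {0..1}" for x
    unfolding abs_mult using B(2,3) C(2) that by (intro mult_mono) auto
  then show ?thesis
    using B(1) C(1) by (intro bounded_L0I) auto
qed

lemma bounded_L0_diff:
  assumes "f \<in> bounded_L0" "g \<in> bounded_L0"
  shows "(\<lambda>x. f x - g x) \<in> bounded_L0"
  using bounded_L0_add[OF assms(1) bounded_L0_mult[OF bounded_L0_const[of "-1"] assms(2)]] by simp

lemma bounded_L0_sum:
  assumes "\<And>i. i \<in> I \<Longrightarrow> f i \<in> bounded_L0"
  shows "(\<lambda>x. \<Sum>i\<in>I. f i x) \<in> bounded_L0"
  using assms by (induct I rule: infinite_finite_induct) (auto intro: bounded_L0_const bounded_L0_add)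

lemma bounded_L0_indicator: "A \<in> sets leb01 \<Longrightarrow> indicator A \<in> bounded_L0"
  by (rule bounded_L0I[of _ 1]) (auto simp: indicator_def)

lemma bounded_L0_abs: "f \<in> bounded_L0 \<Longrightarrow> (\<lambda>x. \<bar>f x\<bar>) \<in> bounded_L0"
  by (auto simp: bounded_L0_def L0_def)

text \<open>A layer cake formula for squares: the odd numbers \<open>2 * k + 1\<close> for
  \<open>k < N\<close> add up to \<open>N^2\<close>.\<close>

lemma square_le_weighted_level_sum:
  fixes g :: real
  assumes "0 \<le> g"
  shows "(min g (real j))\<^sup>2 \<le> (\<Sum>k<j. (2 * real k + 1) * of_bool (real k < g))"
proof -
  let ?N = "min j (nat \<lceil>g\<rceil>)"
  have "(\<Sum>k<j. (2 * real k + 1) * of_bool (real k < g)) = (\<Sum>k\<in>{k\<in>{..<j}. k < nat \<lceil>g\<rceil>}. 2 * real k + 1)"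
    by (simp add: real_less_iff_nat_ceiling of_bool_def sum.If_cases Int_def if_distrib cong: if_cong)
  also have "{k\<in>{..<j}. k < nat \<lceil>g\<rceil>} = {..<?N}" by auto
  also have "(\<Sum>k<N. 2 * real k + 1) = (real N)\<^sup>2" for N
    by (induct N) (auto simp: power2_eq_square algebra_simps)
  finally have eq: "(\<Sum>k<j. (2 * real k + 1) * of_bool (real k < g)) = (real ?N)\<^sup>2" .
  have "min g (real j) \<le> real ?N" using assms by (simp add: min_def) linarith
  then show ?thesis
    unfolding eq using assms by (intro power_mono) auto
qed

text \<open>\<open>g j\<close> splits into the centred truncation \<open>y j\<close>, the centre
  \<open>\<beta> j\<close> and the part above height \<open>j\<close>. Near orthogonality gives the
  partial sums of \<open>y\<close> a second moment of order \<open>n * V n\<close>, so their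
  averages vanish a.e. along every block sequence; the centres converge; the part above
  \<open>j\<close> vanishes for large \<open>j\<close> by Borel-Cantelli. Nonnegativity of
  \<open>g\<close> is what permits interpolation between the block ends.\<close>

lemma near_orthogonal_truncated_averages:
  fixes g \<beta> :: "nat \<Rightarrow> real \<Rightarrow> real" and w :: "nat \<Rightarrow> real"
  defines "y \<equiv> \<lambda>j x. min (g j x) (real j) - \<beta> j x"
  assumes g: "\<And>j. g j \<in> borel_measurable leb01" "\<And>j x. 0 \<le> g j x"
    and \<beta>: "\<And>j. \<beta> j \<in> borel_measurable leb01" "\<And>j x. \<bar>\<beta> j x\<bar> \<le> real j"
    and w: "\<And>j. 0 \<le> w j" "summable w"
    and tails: "\<And>j k. j \<le> k \<Longrightarrow> measure leb01 {x\<in>space leb01. real j < g k x} \<le> w j"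
    and orth: "\<And>i j. i < j \<Longrightarrow> \<bar>LINT x|leb01. y i x * y j x\<bar> \<le> (1/2) ^ j"
    and center: "\<And>j. \<bar>LINT x|leb01. y j x * \<beta> j x\<bar> \<le> 1"
    and conv: "AE x in leb01. (\<lambda>j. \<beta> j x) \<longlonglongrightarrow> b x"
  shows "AE x in leb01. (\<lambda>n. (\<Sum>j<n. g j x) / real n) \<longlonglongrightarrow> b x"
proof -
  define c where "c = (\<lambda>j x. min (g j x) (real j))"
  have c: "c j \<in> bounded_L0" for j
    unfolding c_def using g by (intro bounded_L0I[of _ "real j"]) auto
  have \<beta>b: "\<beta> j \<in> bounded_L0" for j
    using \<beta> by (intro bounded_L0I[of _ "real j"]) auto
  have y_eq: "y j = (\<lambda>x. c j x - \<beta> j x)" for j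
    by (simp add: y_def c_def)
  have y: "y j \<in> bounded_L0" for j
    unfolding y_eq using c \<beta>b by (rule bounded_L0_diff)
  define W where "W = (\<lambda>j. \<Sum>k<j. (2 * real k + 1) * w k)"
  \<comment> \<open>The summand 2 pays for twice the integral of \<open>y j * \<beta> j\<close>,
    which \<open>center\<close> bounds by 1; having \<open>V j\<close> at least 2 later absorbs the
    cross terms.\<close>
  define V where "V = (\<lambda>j. W j + 2)"
  have V_mono: "V m \<le> V n" if "m \<le> n" for m n
    unfolding V_def W_def using that w(1) by (intro add_right_mono sum_mono2) auto
  have V2: "2 \<le> V j" for j
    unfolding V_def W_def using w(1) by (auto intro!: sum_nonneg)
  have c2: "(LINT x|leb01. (c j x)\<^sup>2) \<le> W j" for j
  proof -
    let ?I = "\<lambda>k x. (2 * real k + 1) * indicator {x\<in>space leb01. real k < g j x} x"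
    have lev: "{x\<in>space leb01. real k < g j x} \<in> sets leb01" for k
      using g(1) by measurable
    have I: "?I k \<in> bounded_L0" for k
      by (intro bounded_L0_mult bounded_L0_const bounded_L0_indicator lev)
    have "(LINT x|leb01. (c j x)\<^sup>2) \<le> (LINT x|leb01. (\<Sum>k<j. ?I k x))"
    proof (rule integral_mono)
      show "integrable leb01 (\<lambda>x. (c j x)\<^sup>2)"
        unfolding power2_eq_square by (intro bounded_L0_integrable bounded_L0_mult c)
      show "integrable leb01 (\<lambda>x. \<Sum>k<j. ?I k x)"
        by (intro bounded_L0_integrable bounded_L0_sum I)
      fix x assume x: "x \<in> space leb01"
      have "(\<Sum>k<j. ?I k x) = (\<Sum>k<j. (2 * real k + 1) * of_bool (real k < g j x))"
        using x by (intro sum.cong) (auto simp: indicator_def)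
      then show "(c j x)\<^sup>2 \<le> (\<Sum>k<j. ?I k x)"
        using square_le_weighted_level_sum[OF g(2)] unfolding c_def by simp
    qed
    also have "\<dots> = (\<Sum>k<j. LINT x|leb01. ?I k x)"
      by (rule Bochner_Integration.integral_sum) (intro bounded_L0_integrable I)
    also have "\<dots> = (\<Sum>k<j. (2 * real k + 1) * measure leb01 {x\<in>space leb01. real k < g j x})"
      using sets.Int_space_eq2[OF lev] by (intro sum.cong) auto
    also have "\<dots> \<le> W j"
      unfolding W_def by (intro sum_mono mult_left_mono tails) auto
    finally show ?thesis .
  qed
  have y2: "(LINT x|leb01. (y j x)\<^sup>2) \<le> V j" for j
  proof -
    have sq: "(y j x)\<^sup>2 + (\<beta> j x)\<^sup>2 = (c j x)\<^sup>2 - 2 * (y j x * \<beta> j x)" for x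
      by (simp add: y_eq power2_eq_square algebra_simps)
    have i: "integrable leb01 (\<lambda>x. (y j x)\<^sup>2)" "integrable leb01 (\<lambda>x. (\<beta> j x)\<^sup>2)"
      "integrable leb01 (\<lambda>x. (c j x)\<^sup>2)" "integrable leb01 (\<lambda>x. y j x * \<beta> j x)"
      unfolding power2_eq_square by (intro bounded_L0_integrable bounded_L0_mult y c \<beta>b)+
    have "(LINT x|leb01. (y j x)\<^sup>2) + (LINT x|leb01. (\<beta> j x)\<^sup>2) =
        (LINT x|leb01. (y j x)\<^sup>2 + (\<beta> j x)\<^sup>2)"
      using i by simp
    also have "\<dots> = (LINT x|leb01. (c j x)\<^sup>2) - 2 * (LINT x|leb01. y j x * \<beta> j x)"
      unfolding sq using i by simp
    finally have "(LINT x|leb01. (y j x)\<^sup>2) + (LINT x|leb01. (\<beta> j x)\<^sup>2) =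
      (LINT x|leb01. (c j x)\<^sup>2) - 2 * (LINT x|leb01. y j x * \<beta> j x)" .
    moreover have "0 \<le> (LINT x|leb01. (\<beta> j x)\<^sup>2)" by simp
    ultimately show ?thesis
      using center[of j] c2[of j] unfolding V_def by linarith
  qed
  define S where "S = (\<lambda>n x. \<Sum>j<n. y j x)"
  have S: "S n \<in> bounded_L0" for n
    unfolding S_def by (intro bounded_L0_sum y)
  \<comment> \<open>Adding \<open>y n\<close> costs \<open>V n\<close> and twice the sum of
    \<open>n\<close> inner products of size at most \<open>(1/2) ^ n\<close>, together at most 2;
    since \<open>V n\<close> is at least 2, \<open>2 * V n\<close> covers both.\<close>
  have S2: "(LINT x|leb01. (S n x)\<^sup>2) \<le> (\<Sum>j<n. 2 * V j)" for n
  proof (induct n)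
    case 0 then show ?case by (simp add: S_def)
  next
    case (Suc n)
    have i: "integrable leb01 (\<lambda>x. (S n x)\<^sup>2)" "integrable leb01 (\<lambda>x. (y n x)\<^sup>2)"
      "integrable leb01 (\<lambda>x. S n x * y n x)" "integrable leb01 (\<lambda>x. y i x * y n x)" for i
      unfolding power2_eq_square by (intro bounded_L0_integrable bounded_L0_mult S y)+
    have "(LINT x|leb01. (S (Suc n) x)\<^sup>2) = (LINT x|leb01. (S n x)\<^sup>2 + 2 * (S n x * y n x) + (y n x)\<^sup>2)"
      by (intro Bochner_Integration.integral_cong) (auto simp: S_def power2_eq_square algebra_simps)
    also have "\<dots> = (LINT x|leb01. (S n x)\<^sup>2) + 2 * (LINT x|leb01. S n x * y n x) + (LINT x|leb01. (y n x)\<^sup>2)"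
      using i by simp
    also have "(LINT x|leb01. S n x * y n x) = (\<Sum>j<n. LINT x|leb01. y j x * y n x)"
      unfolding S_def sum_distrib_right using i(4) by (intro Bochner_Integration.integral_sum) auto
    also have "\<dots> \<le> (\<Sum>j<n. (1/2) ^ n)"
      using orth by (intro sum_mono) (auto simp: abs_le_iff)
    also have "(\<Sum>j<n. (1/2::real) ^ n) \<le> 1"
    proof -
      have "real n \<le> 2 ^ n" using less_exp[of n] by (metis less_imp_le of_nat_le_iff of_nat_power of_nat_numeral)
      then show ?thesis by (simp add: power_divide field_simps)
    qed
    finally show ?case using Suc y2[of n] V2[of n] by simp
  qed
  have S2': "(LINT x|leb01. (S n x)\<^sup>2) \<le> 2 * real n * V n" for n
  proof -
    have "(\<Sum>j<n. 2 * V j) \<le> (\<Sum>j<n. 2 * V n)"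
      using V_mono by (intro sum_mono) auto
    then show ?thesis using S2[of n] by simp
  qed
  have "summable (\<lambda>j. 1 / (real j)\<^sup>2)"
    using inverse_power_summable[of 2, where 'a = real] by (simp add: inverse_eq_divide)
  then have "summable (\<lambda>j. 1 / (real (Suc j))\<^sup>2)"
    by (subst summable_Suc_iff)
  then have "summable (\<lambda>j. 2 * (1 / (real (Suc j))\<^sup>2))"
    by (rule summable_mult)
  from summable_add[OF summable_weighted_tails[OF w] this]
  have "summable (\<lambda>j. V j / (real (Suc j))\<^sup>2)"
    by (simp add: V_def W_def add_divide_distrib)
  then have sumV: "summable (\<lambda>i. V (block p i) / real (block p i))" if "p > 0" for p
    using that V_mono V2 by (intro summable_block_averages) (auto intro: order_trans[of 0 2])
  have AE_S: "AE x in leb01. \<forall>p>0. (\<lambda>i. S (block p i) x / real (block p i)) \<longlonglongrightarrow> 0"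
  proof (subst AE_all_countable, intro allI)
    fix p :: nat
    show "AE x in leb01. p > 0 \<longrightarrow> (\<lambda>i. S (block p i) x / real (block p i)) \<longlonglongrightarrow> 0"
    proof (cases "p > 0")
      case True
      let ?h = "\<lambda>i x. (S (block p i) x / real (block p i))\<^sup>2"
      \<comment> \<open>The second moments of the averages at block ends are summable, so the
        squared averages are summable a.e. and in particular tend to 0.\<close>
      have "AE x in leb01. summable (\<lambda>i. ?h i x)"
      proof (rule summable_AE)
        show "integrable leb01 (?h i)" for i
          unfolding power2_eq_square divide_inverse
          by (intro bounded_L0_integrable bounded_L0_mult S bounded_L0_const)
        have le: "(LINT x|leb01. ?h i x) \<le> 2 * (V (block p i) / real (block p i))" for i
        proof -
          have n: "real (block p i) > 0" using block_pos by simp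
          have "(LINT x|leb01. ?h i x) = (LINT x|leb01. (S (block p i) x)\<^sup>2) / (real (block p i))\<^sup>2"
            by (simp add: power_divide)
          also have "\<dots> \<le> (2 * real (block p i) * V (block p i)) / (real (block p i))\<^sup>2"
            using S2' by (intro divide_right_mono) auto
          also have "\<dots> = 2 * (V (block p i) / real (block p i))"
            using n by (simp add: power2_eq_square)
          finally show ?thesis .
        qed
        show "summable (\<lambda>i. LINT x|leb01. ?h i x)"
          by (rule summable_comparison_test'[OF summable_mult[OF sumV[OF True], of 2], of 0])
            (use le in simp)
      qed simp
      then show ?thesis
      proof eventually_elim
        case (elim x)
        then have "(\<lambda>i. ?h i x) \<longlonglongrightarrow> 0" by (rule summable_LIMSEQ_zero)
        then have "(\<lambda>i. sqrt (?h i x)) \<longlonglongrightarrow> sqrt 0" by (intro tendsto_intros)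
        then have "(\<lambda>i. \<bar>S (block p i) x / real (block p i)\<bar>) \<longlonglongrightarrow> 0" by (simp only: real_sqrt_abs real_sqrt_zero)
        then show ?case by (simp only: tendsto_rabs_zero_iff simp_thms)
      qed
    qed simp
  qed
  have "AE x in leb01. \<forall>\<^sub>F j in sequentially. x \<in> space leb01 - {x\<in>space leb01. real j < g j x}"
  proof (rule borel_cantelli_AE1)
    show "{x\<in>space leb01. real j < g j x} \<in> sets leb01" for j
      using g(1) by measurable
    show "emeasure leb01 {x\<in>space leb01. real j < g j x} < \<infinity>" for j
      by (simp add: leb01.emeasure_finite less_top[symmetric])
    show "summable (\<lambda>j. measure leb01 {x\<in>space leb01. real j < g j x})"
      by (rule summable_comparison_test'[OF w(2), of 0]) (use tails[OF order_refl] in simp)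
  qed
  with AE_S conv show ?thesis
  proof eventually_elim
    case (elim x)
    have "\<forall>\<^sub>F j in sequentially. g j x - c j x = 0"
      using elim(3) by eventually_elim (auto simp: c_def)
    then have "(\<lambda>j. g j x - c j x) \<longlonglongrightarrow> 0"
      by (simp add: tendsto_eventually)
    from tendsto_add[OF elim(2) this]
    have avg: "(\<lambda>n. (\<Sum>j<n. \<beta> j x + (g j x - c j x)) / real n) \<longlonglongrightarrow> b x"
      by (intro averages_tendsto) simp
    show ?case
    proof (rule averages_tendsto_of_blocks)
      fix p :: nat assume p: "p > 0"
      have "(\<lambda>i. S (block p i) x / real (block p i) +
        (\<Sum>j<block p i. \<beta> j x + (g j x - c j x)) / real (block p i)) \<longlonglongrightarrow> 0 + b x"
        using elim(1) p LIMSEQ_subseq_LIMSEQ[OF avg strict_mono_block[of p]]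
        by (intro tendsto_add) (auto simp: o_def)
      moreover have "S n x / real n + (\<Sum>j<n. \<beta> j x + (g j x - c j x)) / real n = (\<Sum>j<n. g j x) / real n" for n
        unfolding S_def y_eq add_divide_distrib[symmetric] sum.distrib[symmetric] by simp
      ultimately show "(\<lambda>i. (\<Sum>j<block p i. g j x) / real (block p i)) \<longlonglongrightarrow> b x" by simp
    qed (use g(2) in simp)
  qed
qed

text \<open>One diagonal sequence serves all integer heights. The diagonal property only asserts
  that a weak limit exists, a form that passes to subsequences and back from tails; the limits are
  named by choice at the end.\<close>

lemma weak_limits_of_truncations:
  fixes F :: "nat \<Rightarrow> real \<Rightarrow> real"
  assumes F: "\<And>n. F n \<in> borel_measurable leb01" "\<And>n x. 0 \<le> F n x"
  obtains r q \<beta> where "strict_mono r"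
    "\<And>i. (\<lambda>n. measure leb01 {x\<in>space leb01. real i < F (r n) x}) \<longlonglongrightarrow> q i"
    "\<And>i. \<beta> i \<in> borel_measurable leb01" "\<And>i x. \<bar>\<beta> i x\<bar> \<le> real i"
    "\<And>i g. g \<in> bounded_L0 \<Longrightarrow>
      (\<lambda>n. LINT x|leb01. min (F (r n) x) (real i) * g x) \<longlonglongrightarrow> (LINT x|leb01. \<beta> i x * g x)"
proof -
  let ?p = "\<lambda>i n. measure leb01 {x\<in>space leb01. real i < F n x}"
  let ?W = "\<lambda>i s b. b \<in> borel_measurable leb01 \<and> (\<forall>x. \<bar>b x\<bar> \<le> real i) \<and>
    (\<forall>g\<in>bounded_L0. (\<lambda>n. LINT x|leb01. min (F (s n) x) (real i) * g x) \<longlonglongrightarrow> (LINT x|leb01. b x * g x))"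
  let ?Q = "\<lambda>i s. convergent (\<lambda>n. ?p i (s n)) \<and> (\<exists>b. ?W i s b)"
  obtain r :: "nat \<Rightarrow> nat" where r: "strict_mono r" "\<And>i. ?Q i r"
  proof (rule eventual_property_diagonal[of ?Q])
    fix i and s :: "nat \<Rightarrow> nat" assume "strict_mono s"
    have "\<bar>?p i (s n)\<bar> \<le> 1" for n using measure_leb01_le_1 by simp
    then obtain r1 where r1: "strict_mono r1" "convergent (\<lambda>n. ?p i (s (r1 n)))"
      using bounded_convergent_diagonal[of "\<lambda>_ n. ?p i (s n)" "\<lambda>_. 1"] by blast
    let ?u = "\<lambda>n x. min (F (s (r1 n)) x) (real i)"
    show "\<exists>r. strict_mono r \<and> ?Q i (s \<circ> r)"
    proof (rule bounded_weak_star_compact[of ?u "real i"])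
      show "?u n \<in> borel_measurable leb01" for n using F(1) by simp
      show "\<bar>?u n x\<bar> \<le> real i" for n x using F(2)[of "s (r1 n)" x] by (simp add: min_def)
      fix r2 :: "nat \<Rightarrow> nat" and b :: "real \<Rightarrow> real"
      assume r2: "strict_mono r2" and b: "b \<in> borel_measurable leb01" "\<And>x. \<bar>b x\<bar> \<le> real i"
        and lim: "\<And>g B. g \<in> borel_measurable leb01 \<Longrightarrow> (\<And>x. x \<in> {0..1} \<Longrightarrow> \<bar>g x\<bar> \<le> B) \<Longrightarrow>
          (\<lambda>n. LINT x|leb01. ?u (r2 n) x * g x) \<longlonglongrightarrow> (LINT x|leb01. b x * g x)"
      have "convergent (\<lambda>n. ?p i (s (r1 (r2 n))))"
        using convergent_comp_strict_mono[OF r1(2) r2] by (simp add: o_def)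
      moreover have "?W i (s \<circ> (r1 \<circ> r2)) b"
      proof (intro conjI ballI allI b)
        fix g assume "g \<in> bounded_L0"
        then obtain B where "g \<in> borel_measurable leb01" "\<And>x. x \<in> {0..1} \<Longrightarrow> \<bar>g x\<bar> \<le> B"
          by (rule bounded_L0E) blast
        from lim[OF this] show "(\<lambda>n. LINT x|leb01. min (F ((s \<circ> (r1 \<circ> r2)) n) x) (real i) * g x) \<longlonglongrightarrow> (LINT x|leb01. b x * g x)"
          by simp
      qed
      moreover have "strict_mono (r1 \<circ> r2)" using r1(1) r2 by (rule strict_mono_o)
      ultimately show ?thesis by (intro exI[of _ "r1 \<circ> r2"] conjI) (auto simp: o_def)
    qed
  next
    fix i and s r :: "nat \<Rightarrow> nat" assume r: "strict_mono r" and Q: "?Q i s"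
    then obtain b where b: "?W i s b" by blast
    have "?W i (s \<circ> r) b"
    proof (intro conjI ballI)
      fix g assume "g \<in> bounded_L0"
      then have "(\<lambda>n. LINT x|leb01. min (F (s n) x) (real i) * g x) \<longlonglongrightarrow> (LINT x|leb01. b x * g x)"
        using b by blast
      from LIMSEQ_subseq_LIMSEQ[OF this r]
      show "(\<lambda>n. LINT x|leb01. min (F ((s \<circ> r) n) x) (real i) * g x) \<longlonglongrightarrow> (LINT x|leb01. b x * g x)"
        by (simp add: o_def)
    qed (use b in auto)
    moreover have "convergent (\<lambda>n. ?p i ((s \<circ> r) n))"
      using convergent_comp_strict_mono[OF conjunct1[OF Q] r] by (simp add: o_def)
    ultimately show "?Q i (s \<circ> r)" by blast
  next
    fix i and s :: "nat \<Rightarrow> nat" and k assume Q: "?Q i (\<lambda>n. s (k + n))"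
    then obtain b where b: "?W i (\<lambda>n. s (k + n)) b" by blast
    have "?W i s b"
    proof (intro conjI ballI)
      fix g assume "g \<in> bounded_L0"
      then have "(\<lambda>n. LINT x|leb01. min (F (s (n + k)) x) (real i) * g x) \<longlonglongrightarrow> (LINT x|leb01. b x * g x)"
        using b by (simp add: add.commute)
      then show "(\<lambda>n. LINT x|leb01. min (F (s n) x) (real i) * g x) \<longlonglongrightarrow> (LINT x|leb01. b x * g x)"
        by (rule LIMSEQ_offset)
    qed (use b in auto)
    moreover have "convergent (\<lambda>n. ?p i (s n))"
      using Q convergent_ignore_initial_segment[of "\<lambda>n. ?p i (s n)" k] by (simp add: add.commute)
    ultimately show "?Q i s" by blast
  qed blast
  from r(2) have "\<forall>i. \<exists>b. ?W i r b" by blast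
  from choice[OF this] obtain \<beta> where \<beta>: "\<forall>i. ?W i r (\<beta> i)" ..
  have "(\<lambda>n. ?p i (r n)) \<longlonglongrightarrow> lim (\<lambda>n. ?p i (r n))" for i
    using r(2) by (simp add: convergent_LIMSEQ_iff)
  then show ?thesis
    using \<beta> by (intro that[of r "\<lambda>i. lim (\<lambda>n. ?p i (r n))" \<beta>] r(1)) blast+
qed

text \<open>At most \<open>f x + 1\<close> naturals lie below \<open>f x\<close>; integrating this
  count produces the tail measures.\<close>

lemma sum_level_measures_le:
  assumes f: "integrable leb01 f" "\<And>x. 0 \<le> f x" "(LINT x|leb01. f x) \<le> C"
  shows "(\<Sum>j<J. measure leb01 {x\<in>space leb01. real j < f x}) \<le> C + 1"
proof -
  have lev: "{x\<in>space leb01. real j < f x} \<in> sets leb01" for j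
    using borel_measurable_integrable[OF f(1)] by measurable
  have "(\<Sum>j<J. measure leb01 {x\<in>space leb01. real j < f x}) =
      (\<Sum>j<J. LINT x|leb01. indicator {x\<in>space leb01. real j < f x} x)"
    using sets.Int_space_eq2[OF lev] by (intro sum.cong) auto
  also have "\<dots> = (LINT x|leb01. (\<Sum>j<J. indicator {x\<in>space leb01. real j < f x} x))"
    using lev by (intro Bochner_Integration.integral_sum[symmetric] bounded_L0_integrable bounded_L0_indicator)
  also have "\<dots> \<le> (LINT x|leb01. f x + 1)"
  proof (rule integral_mono)
    show "integrable leb01 (\<lambda>x. \<Sum>j<J. indicator {x\<in>space leb01. real j < f x} x :: real)"
      using lev by (intro bounded_L0_integrable bounded_L0_sum bounded_L0_indicator)
    show "integrable leb01 (\<lambda>x. f x + 1)" using f(1) by simp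
    fix x assume x: "x \<in> space leb01"
    have "(\<Sum>j<J. indicator {x\<in>space leb01. real j < f x} x :: real) = (\<Sum>j<J. of_bool (real j < f x))"
      using x by (intro sum.cong) (auto simp: indicator_def)
    also have "\<dots> \<le> f x + 1"
      unfolding sum_of_bool_less using f(2)[of x] by (simp add: min_def) linarith
    finally show "(\<Sum>j<J. indicator {x\<in>space leb01. real j < f x} x) \<le> f x + 1" .
  qed
  also have "\<dots> \<le> C + 1" using f(1,3) by simp
  finally show ?thesis .
qed

text \<open>The limits \<open>q\<close> of the tail measures are summable by the L^1 bound. They
  control the tails along the final subsequence, through these the second moments, and also the
  increments of \<open>\<beta>\<close>, whose a.e. limit \<open>b\<close> is the limit of all
  averages.\<close>

lemma komlos_nonneg:
  fixes F :: "nat \<Rightarrow> real \<Rightarrow> real"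
  assumes int: "\<And>n. integrable leb01 (F n)" and nonneg: "\<And>n x. 0 \<le> F n x"
    and L1: "\<And>n. (LINT x|leb01. F n x) \<le> C"
  obtains r :: "nat \<Rightarrow> nat" and b where "strict_mono r" "b \<in> borel_measurable leb01"
    "\<And>s. strict_mono s \<Longrightarrow>
      AE x in leb01. (\<lambda>n. (\<Sum>j<n. F (r (s j)) x) / real n) \<longlonglongrightarrow> b x"
proof -
  have meas: "F n \<in> borel_measurable leb01" for n
    using int by (rule borel_measurable_integrable)
  obtain r0 q \<beta> where r0: "strict_mono r0"
    and q: "\<And>i. (\<lambda>n. measure leb01 {x\<in>space leb01. real i < F (r0 n) x}) \<longlonglongrightarrow> q i"
    and \<beta>: "\<And>i. \<beta> i \<in> borel_measurable leb01" "\<And>i x. \<bar>\<beta> i x\<bar> \<le> real i"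
    and weak: "\<And>i g. g \<in> bounded_L0 \<Longrightarrow>
      (\<lambda>n. LINT x|leb01. min (F (r0 n) x) (real i) * g x) \<longlonglongrightarrow> (LINT x|leb01. \<beta> i x * g x)"
    by (rule weak_limits_of_truncations[of F, OF meas nonneg]) blast
  define G where "G = (\<lambda>n. F (r0 n))"
  define c where "c = (\<lambda>n i x. min (G n x) (real i))"
  have c: "c n i \<in> bounded_L0" for n i
    unfolding c_def G_def using meas nonneg by (intro bounded_L0I[of _ "real i"]) auto
  have \<beta>b: "\<beta> i \<in> bounded_L0" for i
    using \<beta> by (intro bounded_L0I[of _ "real i"]) auto
  have q0: "0 \<le> q i" for i
    using q[of i] by (rule LIMSEQ_le_const) simp
  have q_summable: "summable q"
  proof (rule summableI_nonneg_bounded[of _ "C + 1"])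
    show "(\<Sum>i<J. q i) \<le> C + 1" for J
    proof (rule LIMSEQ_le_const2)
      show "(\<lambda>n. \<Sum>i<J. measure leb01 {x\<in>space leb01. real i < F (r0 n) x}) \<longlonglongrightarrow> (\<Sum>i<J. q i)"
        by (intro tendsto_sum q)
    qed (use sum_level_measures_le[OF int nonneg L1] in auto)
  qed (rule q0)
  have weak_c: "(\<lambda>n. LINT x|leb01. (c n i x - \<beta> i x) * g x) \<longlonglongrightarrow> 0" if g: "g \<in> bounded_L0" for i g
  proof -
    have "(LINT x|leb01. (c n i x - \<beta> i x) * g x) = (LINT x|leb01. c n i x * g x) - (LINT x|leb01. \<beta> i x * g x)" for n
      unfolding left_diff_distrib
      by (intro Bochner_Integration.integral_diff bounded_L0_integrable bounded_L0_mult c \<beta>b g)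
    moreover have "(\<lambda>n. (LINT x|leb01. c n i x * g x) - (LINT x|leb01. \<beta> i x * g x)) \<longlonglongrightarrow> 0"
      using tendsto_diff[OF weak[OF g, of i] tendsto_const[of "LINT x|leb01. \<beta> i x * g x"]] unfolding c_def G_def by simp
    ultimately show ?thesis by simp
  qed
  have \<beta>_step: "(LINT x|leb01. \<bar>\<beta> (Suc i) x - \<beta> i x\<bar>) \<le> q i" for i
  proof -
    \<comment> \<open>Testing with the sign of the difference turns weak limits into an L^1 norm.
      Raising the height from \<open>i\<close> to \<open>i + 1\<close> changes a truncation by at
      most the indicator of the tail set.\<close>
    define g where "g = (\<lambda>x. sgn (\<beta> (Suc i) x - \<beta> i x))"
    have g: "g \<in> bounded_L0"
      unfolding g_def using \<beta>(1) by (intro bounded_L0I[of _ 1]) (auto simp: sgn_if)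
    have "(\<lambda>n. (LINT x|leb01. c n (Suc i) x * g x) - (LINT x|leb01. c n i x * g x)) \<longlonglongrightarrow>
        (LINT x|leb01. \<beta> (Suc i) x * g x) - (LINT x|leb01. \<beta> i x * g x)"
      unfolding c_def G_def by (intro tendsto_diff weak g)
    also have "(LINT x|leb01. \<beta> (Suc i) x * g x) - (LINT x|leb01. \<beta> i x * g x) = (LINT x|leb01. \<bar>\<beta> (Suc i) x - \<beta> i x\<bar>)"
    proof -
      have "(LINT x|leb01. \<beta> (Suc i) x * g x) - (LINT x|leb01. \<beta> i x * g x) = (LINT x|leb01. \<beta> (Suc i) x * g x - \<beta> i x * g x)"
        by (intro Bochner_Integration.integral_diff[symmetric] bounded_L0_integrable bounded_L0_mult \<beta>b g)
      also have "\<dots> = (LINT x|leb01. \<bar>\<beta> (Suc i) x - \<beta> i x\<bar>)"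
        by (intro Bochner_Integration.integral_cong) (auto simp: g_def sgn_if)
      finally show ?thesis .
    qed
    finally show ?thesis
    proof (rule LIMSEQ_le[OF _ q])
      have "(LINT x|leb01. c n (Suc i) x * g x) - (LINT x|leb01. c n i x * g x)
          \<le> measure leb01 {x\<in>space leb01. real i < F (r0 n) x}" for n
      proof -
        let ?A = "{x\<in>space leb01. real i < F (r0 n) x}"
        have A: "?A \<in> sets leb01" using meas by measurable
        have "(LINT x|leb01. c n (Suc i) x * g x) - (LINT x|leb01. c n i x * g x) = (LINT x|leb01. c n (Suc i) x * g x - c n i x * g x)"
          by (intro Bochner_Integration.integral_diff[symmetric] bounded_L0_integrable bounded_L0_mult c g)
        also have "\<dots> \<le> (LINT x|leb01. indicator ?A x)"
        proof (rule integral_mono)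
          show "integrable leb01 (\<lambda>x. c n (Suc i) x * g x - c n i x * g x)"
            by (intro bounded_L0_integrable bounded_L0_diff bounded_L0_mult c g)
          show "integrable leb01 (indicat_real ?A)"
            using A by (intro bounded_L0_integrable bounded_L0_indicator)
          fix x assume x: "x \<in> space leb01"
          show "c n (Suc i) x * g x - c n i x * g x \<le> indicator ?A x"
          proof (cases "real i < F (r0 n) x")
            case True
            then have "\<bar>c n (Suc i) x - c n i x\<bar> \<le> 1" by (simp add: c_def G_def min_def)
            moreover have "\<bar>g x\<bar> \<le> 1" by (simp add: g_def sgn_if)
            ultimately have "\<bar>(c n (Suc i) x - c n i x) * g x\<bar> \<le> 1 * 1"
              unfolding abs_mult by (intro mult_mono) auto
            then show ?thesis using True x by (simp add: left_diff_distrib)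
          next
            case False
            then show ?thesis by (simp add: c_def G_def min_def)
          qed
        qed
        also have "\<dots> = measure leb01 ?A" using sets.Int_space_eq2[OF A] by simp
        finally show ?thesis .
      qed
      then show "\<exists>N. \<forall>n\<ge>N. (LINT x|leb01. c n (Suc i) x * g x) - (LINT x|leb01. c n i x * g x)
          \<le> measure leb01 {x\<in>space leb01. real i < F (r0 n) x}" by blast
    qed
  qed
  define b where "b = (\<lambda>x. lim (\<lambda>j. \<beta> j x))"
  have b: "b \<in> borel_measurable leb01"
    unfolding b_def using \<beta>(1) by measurable
  have AE_b: "AE x in leb01. (\<lambda>j. \<beta> j x) \<longlonglongrightarrow> b x"
  proof -
    have "AE x in leb01. summable (\<lambda>i. \<bar>\<beta> (Suc i) x - \<beta> i x\<bar>)"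
    proof (rule summable_AE)
      show "integrable leb01 (\<lambda>x. \<bar>\<beta> (Suc i) x - \<beta> i x\<bar>)" for i
        by (intro bounded_L0_integrable bounded_L0_abs bounded_L0_diff \<beta>b)
      show "summable (\<lambda>i. LINT x|leb01. \<bar>\<beta> (Suc i) x - \<beta> i x\<bar>)"
        by (rule summable_comparison_test'[OF q_summable, of 0]) (use \<beta>_step in simp)
    qed simp
    then show ?thesis
    proof eventually_elim
      case (elim x)
      then have "summable (\<lambda>i. \<beta> (Suc i) x - \<beta> i x)" by (rule summable_rabs_cancel)
      then have "convergent (\<lambda>n. \<Sum>i<n. \<beta> (Suc i) x - \<beta> i x)" by (simp add: summable_iff_convergent)
      then have "convergent (\<lambda>n. \<beta> n x - \<beta> 0 x)" by (simp only: sum_lessThan_telescope[of "\<lambda>i. \<beta> i x"])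
      from convergent_add[OF this convergent_const[of "\<beta> 0 x"]]
      have "convergent (\<lambda>n. \<beta> n x)" by simp
      then show ?case unfolding b_def by (simp add: convergent_LIMSEQ_iff)
    qed
  qed
  let ?p = "\<lambda>i n. measure leb01 {x\<in>space leb01. real i < G n x}"
  let ?y = "\<lambda>n i x. c n i x - \<beta> i x"
  have yb: "?y n i \<in> bounded_L0" for n i
    by (intro bounded_L0_diff c \<beta>b)
  \<comment> \<open>Admissibility of \<open>k\<close> at stage \<open>n\<close> after indices up to
    \<open>B\<close>: tails close to their limits, controlled products with the weak limits, tiny
    products with the centred truncations of indices up to \<open>B\<close>. All heights up to
    \<open>n\<close> are included because the position of the term in a later subsequence is not yet
    known.\<close>
  define P where "P = (\<lambda>n B k. (\<forall>i\<le>n. ?p i k \<le> q i + (1/2) ^ n \<and> \<bar>LINT x|leb01. ?y k i x * \<beta> i x\<bar> \<le> 1) \<and>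
    (\<forall>m\<le>B. \<forall>i\<le>n. \<forall>j\<le>n. \<bar>LINT x|leb01. ?y k j x * ?y m i x\<bar> \<le> (1/2) ^ n))"
  have ev: "\<forall>\<^sub>F k in sequentially. P n B k" for n B
  proof -
    have "\<forall>\<^sub>F k in sequentially. ?p i k \<le> q i + (1/2) ^ n" for i
      using order_tendstoD(2)[OF q[of i], of "q i + (1/2) ^ n"] unfolding G_def
      by (auto elim!: eventually_mono)
    moreover have small: "\<forall>\<^sub>F k in sequentially. \<bar>LINT x|leb01. ?y k i x * g x\<bar> \<le> e"
      if "g \<in> bounded_L0" "e > 0" for i g e
      using order_tendstoD(2)[OF tendsto_rabs_zero[OF weak_c[OF that(1), of i]] that(2)]
      by (rule eventually_mono) simp
    moreover have "\<forall>\<^sub>F k in sequentially. \<bar>LINT x|leb01. ?y k i x * \<beta> i x\<bar> \<le> 1" for i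
      by (rule small[OF \<beta>b]) simp
    moreover have "\<forall>\<^sub>F k in sequentially. \<bar>LINT x|leb01. ?y k j x * ?y m i x\<bar> \<le> (1/2) ^ n" for i j m
      by (rule small[OF yb]) simp
    ultimately show ?thesis
      unfolding P_def all_conj_distrib imp_conjR Ball_def[symmetric] atMost_iff[symmetric]
      by (intro eventually_conj eventually_ball_finite ballI finite_atMost)
  qed
  obtain r1 where r1: "strict_mono r1" "P 0 0 (r1 0)" "\<And>n. P (Suc n) (r1 n) (r1 (Suc n))"
    using eventual_selection[of P] ev by blast
  show ?thesis
  proof (rule that[of "r0 \<circ> r1" b])
    show "strict_mono (r0 \<circ> r1)" using r0 r1(1) by (rule strict_mono_o)
    show "b \<in> borel_measurable leb01" by (rule b)
    fix s :: "nat \<Rightarrow> nat" assume s: "strict_mono s"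
    have s_ge: "j \<le> s j" for j using s by (rule strict_mono_imp_increasing)
    \<comment> \<open>The term at position \<open>j\<close> of the subsequence \<open>s\<close> was
      chosen at stage \<open>s j\<close>, which is at least \<open>j\<close>, so its error bound is
      good enough for that position.\<close>
    have half: "(1/2::real) ^ s j \<le> (1/2) ^ i" if "i \<le> j" for i j
      using that s_ge[of j] by (intro power_decreasing) auto
    have Pn: "\<exists>B. P n B (r1 n)" for n using r1 by (cases n) auto
    show "AE x in leb01. (\<lambda>n. (\<Sum>j<n. F ((r0 \<circ> r1) (s j)) x) / real n) \<longlonglongrightarrow> b x"
    proof (rule near_orthogonal_truncated_averages[of "\<lambda>j. F ((r0 \<circ> r1) (s j))" \<beta> "\<lambda>i. q i + (1/2) ^ i" b])
      show "summable (\<lambda>i. q i + (1/2) ^ i)"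
        by (intro summable_add q_summable summable_geometric) simp
      show "measure leb01 {x\<in>space leb01. real i < F ((r0 \<circ> r1) (s k)) x} \<le> q i + (1/2) ^ i" if "i \<le> k" for i k
      proof -
        have "?p i (r1 (s k)) \<le> q i + (1/2) ^ s k"
          using Pn[of "s k"] that s_ge[of k] unfolding P_def by (meson order_trans)
        then show ?thesis using half[OF that] unfolding G_def o_def by linarith
      qed
      show "\<bar>LINT x|leb01. (min (F ((r0 \<circ> r1) (s i)) x) (real i) - \<beta> i x) * (min (F ((r0 \<circ> r1) (s j)) x) (real j) - \<beta> j x)\<bar>
          \<le> (1/2) ^ j" if ij: "i < j" for i j
      proof -
        have "s i < s j" using s ij by (simp add: strict_mono_less)
        then obtain n where n: "s j = Suc n" "s i \<le> n" by (cases "s j") auto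
        then have "r1 (s i) \<le> r1 n" using r1(1) by (simp add: strict_mono_less_eq)
        moreover have "i \<le> s j" "j \<le> s j" using s_ge[of j] ij by auto
        ultimately have "\<bar>LINT x|leb01. ?y (r1 (s j)) j x * ?y (r1 (s i)) i x\<bar> \<le> (1/2) ^ s j"
          using r1(3)[of n] unfolding n(1) P_def by blast
        also have "\<dots> \<le> (1/2) ^ j" by (rule half) simp
        finally show ?thesis unfolding c_def G_def by (simp add: mult.commute)
      qed
      show "\<bar>LINT x|leb01. (min (F ((r0 \<circ> r1) (s j)) x) (real j) - \<beta> j x) * \<beta> j x\<bar> \<le> 1" for j
        using Pn[of "s j"] s_ge[of j] unfolding P_def c_def G_def by auto
    qed (use meas nonneg \<beta> q0 AE_b in \<open>auto\<close>)
  qed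
qed

text \<open>Positive and negative parts are treated in succession. The second extraction leaves the
  first limit intact because that limit holds along every subsequence.\<close>

lemma komlos:
  fixes F :: "nat \<Rightarrow> real \<Rightarrow> real"
  assumes int: "\<And>n. integrable leb01 (F n)" and L1: "\<And>n. (LINT x|leb01. \<bar>F n x\<bar>) \<le> C"
  obtains r :: "nat \<Rightarrow> nat" and b where "strict_mono r" "b \<in> borel_measurable leb01"
    "\<And>s. strict_mono s \<Longrightarrow>
      AE x in leb01. (\<lambda>n. (\<Sum>j<n. F (r (s j)) x) / real n) \<longlonglongrightarrow> b x"
proof -
  have part: "integrable leb01 (\<lambda>x. max 0 (f x))" "(LINT x|leb01. max 0 (f x)) \<le> (LINT x|leb01. \<bar>f x\<bar>)"
    if "integrable leb01 f" for f :: "real \<Rightarrow> real"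
  proof -
    show i: "integrable leb01 (\<lambda>x. max 0 (f x))"
      using that by (intro integrable_max) auto
    show "(LINT x|leb01. max 0 (f x)) \<le> (LINT x|leb01. \<bar>f x\<bar>)"
      using i that by (intro integral_mono) auto
  qed
  show ?thesis
  proof (rule komlos_nonneg[of "\<lambda>n x. max 0 (F n x)" C])
    show "integrable leb01 (\<lambda>x. max 0 (F n x))" for n
      using part(1)[OF int] .
    show "(LINT x|leb01. max 0 (F n x)) \<le> C" for n
      using part(2)[OF int, of n] L1[of n] by linarith
    fix r1 :: "nat \<Rightarrow> nat" and b1
    assume 1: "strict_mono r1" "b1 \<in> borel_measurable leb01"
      "\<And>s. strict_mono s \<Longrightarrow>
        AE x in leb01. (\<lambda>n. (\<Sum>j<n. max 0 (F (r1 (s j)) x)) / real n) \<longlonglongrightarrow> b1 x"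
    show ?thesis
    proof (rule komlos_nonneg[of "\<lambda>n x. max 0 (- F (r1 n) x)" C])
      show "integrable leb01 (\<lambda>x. max 0 (- F (r1 n) x))" for n
        using part(1)[of "\<lambda>x. - F (r1 n) x"] int by simp
      show "(LINT x|leb01. max 0 (- F (r1 n) x)) \<le> C" for n
        using part(2)[of "\<lambda>x. - F (r1 n) x"] int L1[of "r1 n"] by simp
      fix r2 :: "nat \<Rightarrow> nat" and b2
      assume 2: "strict_mono r2" "b2 \<in> borel_measurable leb01"
        "\<And>s. strict_mono s \<Longrightarrow>
          AE x in leb01. (\<lambda>n. (\<Sum>j<n. max 0 (- F (r1 (r2 (s j))) x)) / real n) \<longlonglongrightarrow> b2 x"
      show ?thesis
      proof (rule that[of "r1 \<circ> r2" "\<lambda>x. b1 x - b2 x"])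
        show "strict_mono (r1 \<circ> r2)" using 1(1) 2(1) by (rule strict_mono_o)
        show "(\<lambda>x. b1 x - b2 x) \<in> borel_measurable leb01" using 1(2) 2(2) by simp
        fix s :: "nat \<Rightarrow> nat" assume s: "strict_mono s"
        have "AE x in leb01. (\<lambda>n. (\<Sum>j<n. max 0 (F (r1 (r2 (s j))) x)) / real n) \<longlonglongrightarrow> b1 x"
          using 1(3)[OF strict_mono_o[OF 2(1) s]] by simp
        then show "AE x in leb01. (\<lambda>n. (\<Sum>j<n. F ((r1 \<circ> r2) (s j)) x) / real n) \<longlonglongrightarrow> b1 x - b2 x"
          using 2(3)[OF s]
        proof eventually_elim
          case (elim x)
          have "(\<Sum>j<n. F ((r1 \<circ> r2) (s j)) x) / real n =
            (\<Sum>j<n. max 0 (F (r1 (r2 (s j))) x)) / real n - (\<Sum>j<n. max 0 (- F (r1 (r2 (s j))) x)) / real n" for n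
            unfolding diff_divide_distrib[symmetric] sum_subtractf[symmetric]
            by (intro arg_cong2[where f = "(/)"] sum.cong) (auto simp: max_def)
          then show ?case using tendsto_diff[OF elim] by simp
        qed
      qed
    qed simp
  qed simp
qed

section \<open>Norming functionals\<close>

text \<open>Vectors are functions taken from a set rather than elements of a type, so the
  Hahn-Banach argument spells out the linear structure pointwise.\<close>

definition function_subspace :: "('a \<Rightarrow> real) set \<Rightarrow> bool" where
  "function_subspace V \<longleftrightarrow> (\<lambda>_. 0) \<in> V \<and> (\<forall>x\<in>V. \<forall>y\<in>V. (\<lambda>t. x t + y t) \<in> V) \<and>
    (\<forall>x\<in>V. \<forall>c. (\<lambda>t. c * x t) \<in> V)"

definition sublinear_on :: "('a \<Rightarrow> real) set \<Rightarrow> (('a \<Rightarrow> real) \<Rightarrow> real) \<Rightarrow> bool" where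
  "sublinear_on V q \<longleftrightarrow> (\<forall>x\<in>V. \<forall>y\<in>V. q (\<lambda>t. x t + y t) \<le> q x + q y) \<and>
    (\<forall>x\<in>V. \<forall>c\<ge>0. q (\<lambda>t. c * x t) = c * q x)"

lemma function_subspace_uminus:
  assumes "function_subspace V" "x \<in> V"
  shows "(\<lambda>t. - x t) \<in> V"
proof -
  have "(\<lambda>t. (-1) * x t) \<in> V"
    using assms by (simp only: function_subspace_def)
  then show ?thesis by simp
qed

lemma sublinear_on_lower_bound:
  assumes V: "function_subspace V" and q: "sublinear_on V q" and "x \<in> V"
  shows "- q (\<lambda>t. - x t) \<le> q x"
proof -
  have m: "(\<lambda>t. - x t) \<in> V"
    by (rule function_subspace_uminus[OF V assms(3)])
  have "q (\<lambda>t. 0 * x t) = 0 * q x"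
    using q assms(3) by (simp only: sublinear_on_def)
  then have "q (\<lambda>t. 0) = 0" by simp
  moreover have "q (\<lambda>t. x t + - x t) \<le> q x + q (\<lambda>t. - x t)"
    by (rule q[unfolded sublinear_on_def, THEN conjunct1, rule_format, OF assms(3) m])
  ultimately show ?thesis by simp
qed

text \<open>The largest sublinear functional below \<open>q\<close> that is linear along \<open>y\<close>.\<close>

definition sublinear_along :: "(('a \<Rightarrow> real) \<Rightarrow> real) \<Rightarrow> ('a \<Rightarrow> real) \<Rightarrow> ('a \<Rightarrow> real) \<Rightarrow> real" where
  "sublinear_along q y x = (INF c\<in>{0..}. q (\<lambda>t. x t + c * y t) - c * q y)"

lemma sublinear_along:
  assumes V: "function_subspace V" and q: "sublinear_on V q" and y: "y \<in> V"
  shows "sublinear_on V (sublinear_along q y)"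
    and "\<And>x c. x \<in> V \<Longrightarrow> 0 \<le> c \<Longrightarrow> sublinear_along q y x \<le> q (\<lambda>t. x t + c * y t) - c * q y"
proof -
  have add: "(\<lambda>t. x t + z t) \<in> V" if "x \<in> V" "z \<in> V" for x z
    using V that by (simp add: function_subspace_def)
  have scale: "(\<lambda>t. c * x t) \<in> V" if "x \<in> V" for x c
    using V that by (simp add: function_subspace_def)
  have neg: "(\<lambda>t. - x t) \<in> V" if "x \<in> V" for x
    using scale[OF that, of "-1"] by simp
  have q_add: "q (\<lambda>t. x t + z t) \<le> q x + q z" if "x \<in> V" "z \<in> V" for x z
    using q that by (simp add: sublinear_on_def)
  have q_scale: "q (\<lambda>t. c * x t) = c * q x" if "x \<in> V" "0 \<le> c" for x c
    using q that by (simp add: sublinear_on_def)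
  \<comment> \<open>This lower bound keeps the infimum in \<open>sublinear_along\<close>
    finite.\<close>
  have below: "- q (\<lambda>t. - x t) \<le> q (\<lambda>t. x t + c * y t) - c * q y" if x: "x \<in> V" and c: "0 \<le> c" for x c
  proof -
    have "q (\<lambda>t. (x t + c * y t) + - x t) \<le> q (\<lambda>t. x t + c * y t) + q (\<lambda>t. - x t)"
      using x y by (intro q_add add scale neg)
    then have "q (\<lambda>t. c * y t) \<le> q (\<lambda>t. x t + c * y t) + q (\<lambda>t. - x t)" by simp
    then show ?thesis using q_scale[OF y c] by simp
  qed
  have bdd: "bdd_below ((\<lambda>c. q (\<lambda>t. x t + c * y t) - c * q y) ` {0..})" if "x \<in> V" for x
    using below[OF that] by (intro bdd_belowI[of _ "- q (\<lambda>t. - x t)"]) auto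
  show upper: "sublinear_along q y x \<le> q (\<lambda>t. x t + c * y t) - c * q y" if "x \<in> V" "0 \<le> c" for x c
    unfolding sublinear_along_def using that bdd by (intro cINF_lower) auto
  have greatest: "m \<le> sublinear_along q y x" if "\<And>c. 0 \<le> c \<Longrightarrow> m \<le> q (\<lambda>t. x t + c * y t) - c * q y" for m x
    unfolding sublinear_along_def using that by (intro cINF_greatest) auto
  have sub: "sublinear_along q y (\<lambda>t. x t + z t) \<le> sublinear_along q y x + sublinear_along q y z"
    if x: "x \<in> V" and z: "z \<in> V" for x z
  proof -
    have "sublinear_along q y (\<lambda>t. x t + z t) - sublinear_along q y x \<le> sublinear_along q y z"
    proof (rule greatest)
      fix d :: real assume d: "0 \<le> d"
      have "sublinear_along q y (\<lambda>t. x t + z t) - (q (\<lambda>t. z t + d * y t) - d * q y) \<le> sublinear_along q y x"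
      proof (rule greatest)
        fix c :: real assume c: "0 \<le> c"
        \<comment> \<open>A parameter \<open>c\<close> for \<open>x\<close> and a parameter
          \<open>d\<close> for \<open>z\<close> combine to the parameter \<open>c + d\<close> for
          the sum.\<close>
        have "sublinear_along q y (\<lambda>t. x t + z t) \<le> q (\<lambda>t. (x t + z t) + (c + d) * y t) - (c + d) * q y"
          using c d by (intro upper add x z) auto
        also have "(\<lambda>t. (x t + z t) + (c + d) * y t) = (\<lambda>t. (x t + c * y t) + (z t + d * y t))"
          by (auto simp: algebra_simps)
        also have "q \<dots> \<le> q (\<lambda>t. x t + c * y t) + q (\<lambda>t. z t + d * y t)"
          by (intro q_add add scale x y z)
        finally show "sublinear_along q y (\<lambda>t. x t + z t) - (q (\<lambda>t. z t + d * y t) - d * q y)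
            \<le> q (\<lambda>t. x t + c * y t) - c * q y"
          by (simp add: algebra_simps)
      qed
      then show "sublinear_along q y (\<lambda>t. x t + z t) - sublinear_along q y x \<le> q (\<lambda>t. z t + d * y t) - d * q y"
        by simp
    qed
    then show ?thesis by simp
  qed
  have half: "sublinear_along q y (\<lambda>t. c * x t) \<le> c * sublinear_along q y x" if x: "x \<in> V" and c: "c > 0" for x c
  proof -
    have "sublinear_along q y (\<lambda>t. c * x t) / c \<le> sublinear_along q y x"
    proof (rule greatest)
      fix d :: real assume d: "0 \<le> d"
      have "sublinear_along q y (\<lambda>t. c * x t) \<le> q (\<lambda>t. c * x t + (c * d) * y t) - (c * d) * q y"
        using c d x by (intro upper scale) auto
      also have "(\<lambda>t. c * x t + (c * d) * y t) = (\<lambda>t. c * (x t + d * y t))"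
        by (auto simp: algebra_simps)
      also have "q \<dots> = c * q (\<lambda>t. x t + d * y t)"
        using c x y by (intro q_scale add scale) auto
      finally show "sublinear_along q y (\<lambda>t. c * x t) / c \<le> q (\<lambda>t. x t + d * y t) - d * q y"
        using c by (simp add: field_simps)
    qed
    then show ?thesis using c by (simp add: field_simps)
  qed
  have hom: "sublinear_along q y (\<lambda>t. c * x t) = c * sublinear_along q y x" if x: "x \<in> V" and c: "0 \<le> c" for x c
  proof (cases "c = 0")
    case True
    have "sublinear_along q y (\<lambda>t. 0) = 0"
    proof (rule antisym)
      have 0: "(\<lambda>t. 0) \<in> V" using scale[OF y, of 0] by simp
      have q0: "q (\<lambda>t. 0) = 0" using q_scale[OF y, of 0] by simp
      show "sublinear_along q y (\<lambda>t. 0) \<le> 0" using upper[OF 0, of 0] q0 by simp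
      show "0 \<le> sublinear_along q y (\<lambda>t. 0)"
        using q_scale[OF y] by (intro greatest) simp
    qed
    then show ?thesis using True by simp
  next
    case False
    then have c: "c > 0" using c by simp
    \<comment> \<open>The reverse inequality is \<open>half\<close> for the factor
      \<open>1 / c\<close>.\<close>
    have "sublinear_along q y (\<lambda>t. (1 / c) * (c * x t)) \<le> (1 / c) * sublinear_along q y (\<lambda>t. c * x t)"
      using c x by (intro half scale) auto
    then have "c * sublinear_along q y x \<le> sublinear_along q y (\<lambda>t. c * x t)"
      using c by (simp add: field_simps)
    with half[OF x c] show ?thesis by simp
  qed
  show "sublinear_on V (sublinear_along q y)"
    unfolding sublinear_on_def using sub hom by blast
qed

text \<open>A minimal sublinear functional is linear along every \<open>y\<close>.\<close>

lemma linear_below_sublinear: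
  fixes p :: "('a \<Rightarrow> real) \<Rightarrow> real"
  assumes V: "function_subspace V" and p: "sublinear_on V p"
  obtains \<phi> where "\<And>x y. x \<in> V \<Longrightarrow> y \<in> V \<Longrightarrow> \<phi> (\<lambda>t. x t + y t) = \<phi> x + \<phi> y"
    "\<And>x c. x \<in> V \<Longrightarrow> \<phi> (\<lambda>t. c * x t) = c * \<phi> x" "\<And>x. x \<in> V \<Longrightarrow> \<phi> x \<le> p x"
proof -
  have add: "(\<lambda>t. x t + z t) \<in> V" if "x \<in> V" "z \<in> V" for x z
    using V that by (simp add: function_subspace_def)
  have scale: "(\<lambda>t. c * x t) \<in> V" if "x \<in> V" for x c
    using V that by (simp add: function_subspace_def)
  have neg: "(\<lambda>t. - x t) \<in> V" if "x \<in> V" for x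
    using scale[OF that, of "-1"] by simp
  \<comment> \<open>Values outside \<open>V\<close> are fixed to 0; otherwise they could be lowered
    forever and no minimal element would exist.\<close>
  define A where "A = {q. sublinear_on V q \<and> (\<forall>x\<in>V. q x \<le> p x) \<and> (\<forall>x. x \<notin> V \<longrightarrow> q x = 0)}"
  have pA: "(\<lambda>x. if x \<in> V then p x else 0) \<in> A"
    using p add scale by (auto simp: A_def sublinear_on_def)
  have "\<exists>m\<in>A. \<forall>a\<in>A. a \<le> m \<longrightarrow> a = m"
  proof (rule predicate_Zorn)
    show "partial_order_on A (relation_of (\<lambda>a b. b \<le> a) A)"
      by (rule partial_order_on_relation_ofI) auto
    fix C assume C: "C \<in> Chains (relation_of (\<lambda>a b. b \<le> a) A)"
    then have CA: "C \<subseteq> A" and lin: "\<And>a b. a \<in> C \<Longrightarrow> b \<in> C \<Longrightarrow> a \<le> b \<or> b \<le> a"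
      unfolding Chains_def relation_of_def by auto
    show "\<exists>u\<in>A. \<forall>a\<in>C. u \<le> a"
    proof (cases "C = {}")
      case True then show ?thesis using pA by auto
    next
      case False
      define u where "u = (\<lambda>x. INF q\<in>C. q x)"
      have bdd: "bdd_below ((\<lambda>q. q x) ` C)" for x
      proof (cases "x \<in> V")
        case True
        have "- p (\<lambda>t. - x t) \<le> q x" if "q \<in> C" for q
        proof -
          have q: "sublinear_on V q" "q (\<lambda>t. - x t) \<le> p (\<lambda>t. - x t)"
            using that CA neg[OF True] by (auto simp: A_def)
          show ?thesis using sublinear_on_lower_bound[OF V q(1) True] q(2) by linarith
        qed
        then show ?thesis by (intro bdd_belowI[of _ "- p (\<lambda>t. - x t)"]) auto
      next
        case False
        then show ?thesis using CA by (intro bdd_belowI[of _ 0]) (auto simp: A_def)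
      qed
      have lower: "u x \<le> q x" if "q \<in> C" for q x
        unfolding u_def using bdd that by (intro cINF_lower) auto
      have greatest: "m \<le> u x" if "\<And>q. q \<in> C \<Longrightarrow> m \<le> q x" for m x
        unfolding u_def using False that by (intro cINF_greatest) auto
      have "u \<in> A"
        unfolding A_def
      proof (intro CollectI conjI ballI allI impI)
        show "sublinear_on V u"
          unfolding sublinear_on_def
        proof (intro conjI ballI allI impI)
          fix x y assume x: "x \<in> V" and y: "y \<in> V"
          have "u (\<lambda>t. x t + y t) - u x \<le> u y"
          proof (rule greatest)
            fix q2 assume q2: "q2 \<in> C"
            have "u (\<lambda>t. x t + y t) - q2 y \<le> u x"
            proof (rule greatest)
              fix q1 assume q1: "q1 \<in> C"
              \<comment> \<open>Of two members of a chain the smaller one can be used at both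
                arguments, which rescues subadditivity of the infimum.\<close>
              obtain q where q: "q \<in> C" "q \<le> q1" "q \<le> q2"
                using lin[OF q1 q2] q1 q2 by blast
              have "u (\<lambda>t. x t + y t) \<le> q (\<lambda>t. x t + y t)" using q(1) by (rule lower)
              also have "\<dots> \<le> q x + q y"
                using q(1) CA x y by (auto simp: A_def sublinear_on_def)
              also have "\<dots> \<le> q1 x + q2 y"
                using q(2,3) by (intro add_mono) (auto simp: le_fun_def)
              finally show "u (\<lambda>t. x t + y t) - q2 y \<le> q1 x" by simp
            qed
            then show "u (\<lambda>t. x t + y t) - u x \<le> q2 y" by simp
          qed
          then show "u (\<lambda>t. x t + y t) \<le> u x + u y" by simp
        next
          fix x and c :: real assume x: "x \<in> V" and c: "0 \<le> c"
          have hom: "q (\<lambda>t. c * x t) = c * q x" if "q \<in> C" for q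
            using that CA x c by (auto simp: A_def sublinear_on_def)
          show "u (\<lambda>t. c * x t) = c * u x"
          proof (rule antisym)
            show "c * u x \<le> u (\<lambda>t. c * x t)"
              using lower c by (intro greatest) (simp add: hom mult_left_mono)
            show "u (\<lambda>t. c * x t) \<le> c * u x"
            proof (cases "c = 0")
              case True
              then show ?thesis using False lower[of _ "\<lambda>t. c * x t"] hom by force
            next
              case c0: False
              have "u (\<lambda>t. c * x t) / c \<le> u x"
                using lower[of _ "\<lambda>t. c * x t"] c c0 by (intro greatest) (simp add: hom pos_divide_le_eq mult.commute)
              then show ?thesis using c c0 by (simp add: pos_divide_le_eq mult.commute)
            qed
          qed
        qed
        obtain q where q: "q \<in> C" using False by blast
        show "u x \<le> p x" if "x \<in> V" for x
          using lower[OF q, of x] q CA that by (force simp: A_def)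
        have outside: "q x = 0" if "x \<notin> V" "q \<in> C" for q x
          using that CA by (auto simp: A_def)
        show "u x = 0" if "x \<notin> V" for x
          using lower[OF q, of x] greatest[of 0 x] outside[OF that] q by force
      qed
      then show ?thesis using lower by (auto simp: le_fun_def)
    qed
  qed
  then obtain m where mA: "m \<in> A" and min: "\<And>a. a \<in> A \<Longrightarrow> a \<le> m \<Longrightarrow> a = m" by blast
  have m: "sublinear_on V m" "\<And>x. x \<in> V \<Longrightarrow> m x \<le> p x" "\<And>x. x \<notin> V \<Longrightarrow> m x = 0"
    using mA by (auto simp: A_def)
  have m0: "m (\<lambda>t. 0) = 0" and zero: "(\<lambda>t. 0) \<in> V"
  proof -
    show "(\<lambda>t. 0) \<in> V" using V by (simp add: function_subspace_def)
    then have "m (\<lambda>t. 0 * 0) = 0 * m (\<lambda>t. 0)"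
      by (rule m(1)[unfolded sublinear_on_def, THEN conjunct2, rule_format]) simp
    then show "m (\<lambda>t. 0) = 0" by simp
  qed
  have m_add: "m (\<lambda>t. x t + y t) = m x + m y" if x: "x \<in> V" and y: "y \<in> V" for x y
  proof (rule antisym)
    show "m (\<lambda>t. x t + y t) \<le> m x + m y" using m(1) x y by (simp add: sublinear_on_def)
    \<comment> \<open>This functional lies in \<open>A\<close> and below \<open>m\<close>, so
      minimality makes it equal to \<open>m\<close>; its upper bound for the parameter 1 is then
      superadditivity of \<open>m\<close>.\<close>
    define a where "a = (\<lambda>z. if z \<in> V then sublinear_along m y z else 0)"
    have le: "sublinear_along m y z \<le> m z" if "z \<in> V" for z
      using sublinear_along(2)[OF V m(1) y that, of 0] by simp
    have "sublinear_on V a"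
      using sublinear_along(1)[OF V m(1) y] add scale by (simp add: a_def sublinear_on_def)
    then have "a \<in> A"
      using le m(2) by (force simp: A_def a_def)
    moreover have "a \<le> m"
      using le m(3) by (simp add: le_fun_def a_def)
    ultimately have "a = m" by (rule min)
    then have "m x = sublinear_along m y x" using x by (metis a_def)
    also have "\<dots> \<le> m (\<lambda>t. x t + y t) - m y"
      using sublinear_along(2)[OF V m(1) y x, of 1] by simp
    finally show "m x + m y \<le> m (\<lambda>t. x t + y t)" by simp
  qed
  have m_neg: "m (\<lambda>t. - x t) = - m x" if "x \<in> V" for x
    using m_add[OF that neg[OF that]] m0 by simp
  have m_scale: "m (\<lambda>t. c * x t) = c * m x" if x: "x \<in> V" for x c
  proof (cases "0 \<le> c")
    case True then show ?thesis using m(1) x by (simp add: sublinear_on_def)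
  next
    case False
    then have "m (\<lambda>t. (- c) * x t) = - c * m x"
      by (intro m(1)[unfolded sublinear_on_def, THEN conjunct2, rule_format] x) simp
    moreover have "m (\<lambda>t. - (c * x t)) = - m (\<lambda>t. c * x t)" by (intro m_neg scale x)
    ultimately show ?thesis by simp
  qed
  show ?thesis by (rule that[of m]) (auto simp: m_add m_scale m(2))
qed

text \<open>Starting from \<open>sublinear_along p v\<close> instead of \<open>p\<close> forces the
  value at \<open>v\<close>: at the negative of \<open>v\<close> it is at most \<open>- p v\<close>,
  so a linear functional below it is at least \<open>p v\<close> at \<open>v\<close>.\<close>

lemma hahn_banach_norming:
  fixes p :: "('a \<Rightarrow> real) \<Rightarrow> real"
  assumes V: "function_subspace V"
    and tri: "\<And>x y. x \<in> V \<Longrightarrow> y \<in> V \<Longrightarrow> p (\<lambda>t. x t + y t) \<le> p x + p y"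
    and hom: "\<And>x c. x \<in> V \<Longrightarrow> p (\<lambda>t. c * x t) = \<bar>c\<bar> * p x"
    and v: "v \<in> V"
  shows "\<exists>\<phi>. (\<forall>x\<in>V. \<forall>y\<in>V. \<phi> (\<lambda>t. x t + y t) = \<phi> x + \<phi> y) \<and>
    (\<forall>x\<in>V. \<forall>c. \<phi> (\<lambda>t. c * x t) = c * \<phi> x) \<and> (\<forall>x\<in>V. \<bar>\<phi> x\<bar> \<le> p x) \<and> \<phi> v = p v"
proof -
  have p: "sublinear_on V p"
    using tri hom by (simp add: sublinear_on_def)
  have neg: "(\<lambda>t. - x t) \<in> V" if "x \<in> V" for x
    by (rule function_subspace_uminus[OF V that])
  show ?thesis
  proof (rule linear_below_sublinear[OF V sublinear_along(1)[OF V p v]])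
    fix \<phi> assume \<phi>: "\<And>x y. x \<in> V \<Longrightarrow> y \<in> V \<Longrightarrow> \<phi> (\<lambda>t. x t + y t) = \<phi> x + \<phi> y"
      "\<And>x c. x \<in> V \<Longrightarrow> \<phi> (\<lambda>t. c * x t) = c * \<phi> x" "\<And>x. x \<in> V \<Longrightarrow> \<phi> x \<le> sublinear_along p v x"
    have up: "\<phi> x \<le> p x" if "x \<in> V" for x
      using \<phi>(3)[OF that] sublinear_along(2)[OF V p v that, of 0] by simp
    have \<phi>_neg: "\<phi> (\<lambda>t. - x t) = - \<phi> x" if "x \<in> V" for x
      using \<phi>(2)[OF that, of "-1"] by simp
    have p_neg: "p (\<lambda>t. - x t) = p x" if "x \<in> V" for x
      using hom[OF that, of "-1"] by simp
    have abs: "\<bar>\<phi> x\<bar> \<le> p x" if "x \<in> V" for x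
      using up[OF that] up[OF neg[OF that]] \<phi>_neg[OF that] p_neg[OF that] by linarith
    have p0: "p (\<lambda>t. 0) = 0" using hom[OF v, of 0] by simp
    have "\<phi> (\<lambda>t. - v t) \<le> p (\<lambda>t. - v t + 1 * v t) - 1 * p v"
      using \<phi>(3)[OF neg[OF v]] sublinear_along(2)[OF V p v neg[OF v], of 1] by linarith
    then have "p v \<le> \<phi> v" using p0 \<phi>_neg[OF v] by simp
    then have "\<phi> v = p v" using up[OF v] by simp
    then show ?thesis using \<phi>(1,2) abs by (intro exI[of _ \<phi>]) blast
  qed
qed

section \<open>Banach function spaces\<close>

lemma dominated_inI: "h \<in> pos_cone X \<Longrightarrow> (\<And>n. AE t in leb01. \<bar>F n t\<bar> \<le> h t) \<Longrightarrow> dominated_in X F"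
  by (auto simp: dominated_in_def)

lemma weakly_nullD:
  "weakly_null Y N F \<Longrightarrow> bounded_functional Y N \<phi> \<Longrightarrow> (\<lambda>n. \<phi> (F n)) \<longlonglongrightarrow> 0"
  by (simp add: weakly_null_def)

context banach_function_space
begin

lemma measurable_mem: "f \<in> X \<Longrightarrow> f \<in> borel_measurable leb01"
  using subset_L0 by (auto simp: L0_def)

lemma dominated_mem:
  assumes "f \<in> borel_measurable leb01" "g \<in> X" "AE t in leb01. \<bar>f t\<bar> \<le> \<bar>g t\<bar>"
  shows "f \<in> X" "N f \<le> N g"
  using ideal[of f g] assms by (auto simp: L0_def)

lemma diff_mem: "f \<in> X \<Longrightarrow> g \<in> X \<Longrightarrow> (\<lambda>t. f t - g t) \<in> X"
  using add_mem[OF _ scale_mem[of g "-1"], of f] by simp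

lemma abs_mem:
  assumes "f \<in> X" shows "(\<lambda>t. \<bar>f t\<bar>) \<in> X" "N (\<lambda>t. \<bar>f t\<bar>) = N f"
proof -
  show 1: "(\<lambda>t. \<bar>f t\<bar>) \<in> X"
    by (rule dominated_mem(1)[OF _ assms]) (use measurable_mem[OF assms] in auto)
  show "N (\<lambda>t. \<bar>f t\<bar>) = N f"
  proof (rule antisym)
    show "N (\<lambda>t. \<bar>f t\<bar>) \<le> N f"
      by (rule dominated_mem(2)[OF _ assms]) (use measurable_mem[OF assms] in auto)
    show "N f \<le> N (\<lambda>t. \<bar>f t\<bar>)"
      by (rule dominated_mem(2)[OF _ 1]) (use measurable_mem[OF assms] in auto)
  qed
qed

lemma sum_mem:
  assumes "\<And>i. i \<in> I \<Longrightarrow> f i \<in> X"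
  shows "(\<lambda>t. \<Sum>i\<in>I. f i t) \<in> X" "N (\<lambda>t. \<Sum>i\<in>I. f i t) \<le> (\<Sum>i\<in>I. N (f i))"
proof -
  have N0: "N (\<lambda>t. 0) = 0" using norm_eq_0_iff[OF zero_mem] by simp
  from assms have "(\<lambda>t. \<Sum>i\<in>I. f i t) \<in> X \<and> N (\<lambda>t. \<Sum>i\<in>I. f i t) \<le> (\<Sum>i\<in>I. N (f i))"
  proof (induct I rule: infinite_finite_induct)
    case (insert i I)
    then have I: "(\<lambda>t. \<Sum>i\<in>I. f i t) \<in> X" "N (\<lambda>t. \<Sum>i\<in>I. f i t) \<le> (\<Sum>i\<in>I. N (f i))" "f i \<in> X" by auto
    then show ?case
      using insert(1,2) add_mem[OF I(3,1)] norm_triangle[OF I(3,1)] by simp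
  qed (simp_all add: zero_mem N0)
  then show "(\<lambda>t. \<Sum>i\<in>I. f i t) \<in> X" "N (\<lambda>t. \<Sum>i\<in>I. f i t) \<le> (\<Sum>i\<in>I. N (f i))" by auto
qed

lemma cesaro_mem: "(\<And>n. F n \<in> X) \<Longrightarrow> cesaro F m \<in> X"
  using scale_mem[OF sum_mem(1)[of "{..m}" F], of "1 / real (Suc m)"] by (simp add: cesaro_def)

text \<open>The pointwise infimum of countably many representatives belongs to \<open>X\<close> by
  the ideal property, so it may be inserted as the lower bound \<open>u\<close> of the lattice
  infimum and must vanish a.e.\<close>

lemma decreases_to_0_AE:
  assumes G: "decreases_to_0 X G"
  shows "AE t in leb01. (\<lambda>n. G n t) \<longlonglongrightarrow> 0"
proof -
  have GX: "G n \<in> X" for n using G by (simp add: decreases_to_0_def)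
  have dec: "AE t in leb01. \<forall>n. G (Suc n) t \<le> G n t" and pos: "AE t in leb01. \<forall>n. 0 \<le> G n t"
    using G by (simp_all add: decreases_to_0_def AE_all_countable)
  \<comment> \<open>Clipping at 0 makes the infimum finite at every point, also where the a.e.
    inequalities fail.\<close>
  define u where "u = (\<lambda>t. INF n. max 0 (G n t))"
  have bdd: "bdd_below (range (\<lambda>n. max 0 (G n t)))" for t
    by (rule bdd_belowI[of _ 0]) auto
  have u_le: "u t \<le> max 0 (G n t)" for n t
    unfolding u_def by (rule cINF_lower[OF bdd]) simp
  have u_nonneg: "0 \<le> u t" for t
    unfolding u_def by (rule cINF_greatest) auto
  have u_meas: "u \<in> borel_measurable leb01"
    unfolding u_def using measurable_mem[OF GX] bdd by (intro borel_measurable_cINF) auto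
  have "u \<in> X"
  proof (rule dominated_mem(1)[OF u_meas GX[of 0]])
    show "AE t in leb01. \<bar>u t\<bar> \<le> \<bar>G 0 t\<bar>"
      using pos
    proof eventually_elim
      case (elim t)
      then have "max 0 (G 0 t) = G 0 t" by simp
      then show ?case using u_le[of t 0] u_nonneg[of t] by simp
    qed
  qed
  moreover have "AE t in leb01. u t \<le> G n t" for n
    using pos
  proof eventually_elim
    case (elim t)
    then have "max 0 (G n t) = G n t" by simp
    then show ?case using u_le[of t n] by simp
  qed
  ultimately have "AE t in leb01. u t \<le> 0"
    using G by (simp add: decreases_to_0_def)
  with dec pos show ?thesis
  proof eventually_elim
    case (elim t)
    then have u0: "u t = 0" using u_nonneg[of t] by simp
    have G_eq: "max 0 (G n t) = G n t" for n using elim(2) by simp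
    have "decseq (\<lambda>n. G n t)" using elim(1) by (simp add: decseq_Suc_iff)
    moreover have "bdd_below (range (\<lambda>n. G n t))" using bdd[of t] by (simp add: G_eq)
    ultimately have "(\<lambda>n. G n t) \<longlonglongrightarrow> (INF n. G n t)" by (intro LIMSEQ_decseq_INF)
    then show ?case using u0 by (simp add: u_def G_eq)
  qed
qed

lemma order_converges_AE:
  assumes "order_converges X F f"
  shows "AE t in leb01. (\<lambda>n. F n t) \<longlonglongrightarrow> f t"
proof -
  obtain G where G: "decreases_to_0 X G" "\<And>n. AE t in leb01. \<bar>F n t - f t\<bar> \<le> G n t"
    using assms by (auto simp: order_converges_def)
  have "AE t in leb01. \<forall>n. \<bar>F n t - f t\<bar> \<le> G n t" using G(2) by (simp add: AE_all_countable)
  with decreases_to_0_AE[OF G(1)] show ?thesis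
  proof eventually_elim
    case (elim t)
    have "(\<lambda>n. F n t - f t) \<longlonglongrightarrow> 0"
      by (rule Lim_null_comparison[OF _ elim(1)]) (use elim(2) in simp)
    then show ?case by (simp add: LIM_zero_iff)
  qed
qed

lemma order_converges_dominated:
  assumes "order_converges X F f"
  shows "dominated_in X F"
proof -
  obtain G where G: "decreases_to_0 X G" "\<And>n. AE t in leb01. \<bar>F n t - f t\<bar> \<le> G n t" and f: "f \<in> X"
    using assms by (auto simp: order_converges_def)
  have GX: "G n \<in> X" for n using G(1) by (simp add: decreases_to_0_def)
  have G_dec: "AE t in leb01. G n t \<le> G 0 t" for n
  proof (induct n)
    case (Suc n)
    have "AE t in leb01. G (Suc n) t \<le> G n t" using G(1) by (simp add: decreases_to_0_def)
    with Suc show ?case by eventually_elim simp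
  qed simp
  have le: "AE t in leb01. \<bar>F n t\<bar> \<le> G 0 t + \<bar>f t\<bar>" for n
    using G(2)[of n] G_dec[of n] by eventually_elim linarith
  have "(\<lambda>t. G 0 t + \<bar>f t\<bar>) \<in> pos_cone X"
  proof -
    have "AE t in leb01. 0 \<le> G 0 t" using G(1) by (simp add: decreases_to_0_def)
    then have "AE t in leb01. 0 \<le> G 0 t + \<bar>f t\<bar>" by eventually_elim simp
    then show ?thesis using add_mem[OF GX abs_mem(1)[OF f]] by (simp add: pos_cone_def)
  qed
  then show ?thesis using le by (rule dominated_inI)
qed

text \<open>The decreasing majorants are the tail suprema of the distances to \<open>f\<close>;
  domination keeps them, and \<open>f\<close> itself, inside \<open>X\<close>.\<close>

lemma order_convergesI:
  assumes F: "\<And>n. F n \<in> X" and f: "f \<in> borel_measurable leb01"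
    and lim: "AE t in leb01. (\<lambda>n. F n t) \<longlonglongrightarrow> f t" and dom: "dominated_in X F"
  shows "order_converges X F f"
proof -
  obtain h where h: "h \<in> X" "\<And>n. AE t in leb01. \<bar>F n t\<bar> \<le> h t"
    using dom by (auto simp: dominated_in_def pos_cone_def)
  have h_all: "AE t in leb01. \<forall>n. \<bar>F n t\<bar> \<le> h t" using h(2) by (simp add: AE_all_countable)
  have f_h: "AE t in leb01. \<bar>f t\<bar> \<le> h t"
    using h_all lim
  proof eventually_elim
    case (elim t)
    show ?case by (rule LIMSEQ_le_const2[OF tendsto_rabs[OF elim(2)]]) (use elim(1) in simp)
  qed
  have fX: "f \<in> X"
    by (rule dominated_mem(1)[OF f h(1)]) (use f_h in \<open>eventually_elim, simp\<close>)
  \<comment> \<open>Clipping at \<open>2 * \<bar>h t\<bar>\<close> bounds the suprema at every point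
    and changes nothing outside a null set.\<close>
  define d where "d = (\<lambda>k t. min \<bar>F k t - f t\<bar> (2 * \<bar>h t\<bar>))"
  define G where "G = (\<lambda>n t. SUP k. d (n + k) t)"
  have d0: "0 \<le> d k t" and dh: "d k t \<le> 2 * \<bar>h t\<bar>" for k t by (auto simp: d_def)
  have bdd: "bdd_above (range (\<lambda>k. d (n + k) t))" for n t
    using dh by (intro bdd_aboveI[of _ "2 * \<bar>h t\<bar>"]) auto
  have G_up: "d (n + k) t \<le> G n t" for n k t
    unfolding G_def by (rule cSUP_upper[OF _ bdd]) simp
  have G_le: "G n t \<le> c" if "\<And>k. d (n + k) t \<le> c" for n t c
    unfolding G_def using that by (intro cSUP_least) auto
  have G0: "0 \<le> G n t" for n t using G_up[of n 0 t] d0[of n t] by simp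
  have G_dec: "G (Suc n) t \<le> G n t" for n t
    using G_up[of n "Suc k" t for k] by (intro G_le) simp
  have G_meas: "G n \<in> borel_measurable leb01" for n
    unfolding G_def
  proof (rule borel_measurable_cSUP)
    show "d (n + k) \<in> borel_measurable leb01" for k
      unfolding d_def using measurable_mem[OF F] f measurable_mem[OF h(1)] by measurable
  qed (use bdd in auto)
  have GX: "G n \<in> X" for n
  proof (rule dominated_mem(1)[OF G_meas scale_mem[OF h(1), of 2]])
    have "\<bar>G n t\<bar> \<le> \<bar>2 * h t\<bar>" for t
      using G0[of n t] G_le[of n t "2 * \<bar>h t\<bar>"] dh by (simp add: abs_mult)
    then show "AE t in leb01. \<bar>G n t\<bar> \<le> \<bar>2 * h t\<bar>" by simp
  qed
  have G_lim: "AE t in leb01. (\<lambda>n. G n t) \<longlonglongrightarrow> 0"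
    using lim
  proof eventually_elim
    case (elim t)
    show ?case
    proof (rule LIMSEQ_I)
      fix e :: real assume e: "e > 0"
      from LIMSEQ_D[OF elim, of "e / 2"] e obtain n0 where n0: "\<And>n. n \<ge> n0 \<Longrightarrow> \<bar>F n t - f t\<bar> < e / 2"
        by (auto simp: real_norm_def)
      have "G n t \<le> e / 2" if "n \<ge> n0" for n
      proof (rule G_le)
        fix k
        have "d (n + k) t \<le> \<bar>F (n + k) t - f t\<bar>" by (simp add: d_def)
        then show "d (n + k) t \<le> e / 2" using n0[of "n + k"] that by linarith
      qed
      then show "\<exists>no. \<forall>n\<ge>no. norm (G n t - 0) < e"
        using G0 e by (intro exI[of _ n0]) (force simp: abs_of_nonneg)
    qed
  qed
  have "decreases_to_0 X G"
    unfolding decreases_to_0_def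
  proof (intro conjI allI ballI impI)
    fix u assume "\<forall>n. AE t in leb01. u t \<le> G n t"
    then have "AE t in leb01. \<forall>n. u t \<le> G n t" by (simp add: AE_all_countable)
    then show "AE t in leb01. u t \<le> 0"
      using G_lim
    proof eventually_elim
      case (elim t)
      show ?case by (rule LIMSEQ_le_const[OF elim(2)]) (use elim(1) in simp)
    qed
  qed (use GX G_dec G0 in auto)
  moreover have "AE t in leb01. \<bar>F n t - f t\<bar> \<le> G n t" for n
    using h_all f_h
  proof eventually_elim
    case (elim t)
    have "\<bar>F n t\<bar> \<le> h t" using elim(1) by simp
    then have "\<bar>F n t - f t\<bar> \<le> 2 * \<bar>h t\<bar>" using elim(2) by linarith
    then have "d n t = \<bar>F n t - f t\<bar>" by (simp add: d_def)
    then show ?case using G_up[of n 0 t] by simp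
  qed
  ultimately show ?thesis using F fX unfolding order_converges_def by blast
qed

lemma dominated_cesaro:
  assumes "dominated_in X F" shows "dominated_in X (cesaro F)"
proof -
  obtain h where h: "h \<in> pos_cone X" "\<And>n. AE t in leb01. \<bar>F n t\<bar> \<le> h t"
    using assms by (auto simp: dominated_in_def)
  have "AE t in leb01. \<bar>cesaro F m t\<bar> \<le> h t" for m
  proof -
    have "AE t in leb01. \<forall>n. \<bar>F n t\<bar> \<le> h t" using h(2) by (simp add: AE_all_countable)
    then show ?thesis
    proof eventually_elim
      case (elim t)
      have "\<bar>\<Sum>n\<le>m. F n t\<bar> \<le> (\<Sum>n\<le>m. h t)"
        by (rule order_trans[OF sum_abs sum_mono]) (use elim in simp)
      then show ?case by (simp add: cesaro_def field_simps)
    qed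
  qed
  then show ?thesis using h(1) unfolding dominated_in_def by blast
qed

lemma dominated_add:
  assumes "dominated_in X F" "dominated_in X G"
  shows "dominated_in X (\<lambda>n t. F n t + G n t)"
proof -
  obtain h k where h: "h \<in> pos_cone X" "\<And>n. AE t in leb01. \<bar>F n t\<bar> \<le> h t"
    and k: "k \<in> pos_cone X" "\<And>n. AE t in leb01. \<bar>G n t\<bar> \<le> k t"
    using assms by (auto simp: dominated_in_def)
  have le: "AE t in leb01. \<bar>F n t + G n t\<bar> \<le> h t + k t" for n
    using h(2)[of n] k(2)[of n] by eventually_elim simp
  have "(\<lambda>t. h t + k t) \<in> pos_cone X"
  proof -
    have "AE t in leb01. 0 \<le> h t" "AE t in leb01. 0 \<le> k t" using h(1) k(1) by (simp_all add: pos_cone_def)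
    then have "AE t in leb01. 0 \<le> h t + k t" by eventually_elim simp
    then show ?thesis using h(1) k(1) add_mem by (simp add: pos_cone_def)
  qed
  then show ?thesis using le by (rule dominated_inI)
qed

lemma dominated_scale:
  assumes "dominated_in X F"
  shows "dominated_in X (\<lambda>n t. c * F n t)"
proof -
  obtain h where h: "h \<in> pos_cone X" "\<And>n. AE t in leb01. \<bar>F n t\<bar> \<le> h t"
    using assms by (auto simp: dominated_in_def)
  have le: "AE t in leb01. \<bar>c * F n t\<bar> \<le> \<bar>c\<bar> * h t" for n
    using h(2)[of n] by eventually_elim (simp add: abs_mult mult_left_mono)
  have "(\<lambda>t. \<bar>c\<bar> * h t) \<in> pos_cone X"
  proof -
    have "AE t in leb01. 0 \<le> h t" using h(1) by (simp add: pos_cone_def)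
    then have "AE t in leb01. 0 \<le> \<bar>c\<bar> * h t" by eventually_elim simp
    then show ?thesis using h(1) scale_mem by (simp add: pos_cone_def)
  qed
  then show ?thesis using le by (rule dominated_inI)
qed

text \<open>The upper bound is the norm limit of the partial sums \<open>S m\<close>. The positive
  part of \<open>h n - s\<close> lies below \<open>\<bar>S m - s\<bar>\<close> for every
  \<open>m > n\<close>, so its norm is 0.\<close>

lemma series_upper_bound:
  assumes h: "\<And>n. h n \<in> X" "\<And>n t. 0 \<le> h n t" "\<And>n. N (h n) \<le> (1/2) ^ n"
  obtains s where "s \<in> X" "\<And>n. AE t in leb01. h n t \<le> s t"
proof -
  define S where "S = (\<lambda>n t. \<Sum>i<n. h i t)"
  have SX: "S n \<in> X" for n
    unfolding S_def using h(1) by (rule sum_mem(1))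
  have step: "N (\<lambda>t. S m t - S n t) \<le> 2 * (1/2) ^ n" if "n \<le> m" for m n
  proof -
    have "S m t - S n t = (\<Sum>i=n..<m. h i t)" for t
      unfolding S_def using that by (simp add: lessThan_atLeast0 sum_diff_nat_ivl)
    then have "N (\<lambda>t. S m t - S n t) \<le> (\<Sum>i=n..<m. N (h i))"
      using sum_mem(2)[of "{n..<m}" h] h(1) by simp
    also have "\<dots> \<le> (\<Sum>i=n..<m. (1/2) ^ i)" by (rule sum_mono) (rule h(3))
    also have "\<dots> \<le> 2 * (1/2) ^ n"
    proof -
      have "(\<Sum>i=n..<m. (1/2::real) ^ i) = 2 * (1/2) ^ n - 2 * (1/2) ^ m"
        using that by (induct m rule: dec_induct) (auto simp: sum.atLeastLessThan_Suc)
      then show ?thesis by simp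
    qed
    finally show ?thesis .
  qed
  have sym: "N (\<lambda>t. S m t - S n t) = N (\<lambda>t. S n t - S m t)" for m n
    using norm_scale[OF diff_mem[OF SX SX], of "-1" n m] by simp
  have "\<exists>s\<in>X. (\<lambda>n. N (\<lambda>t. S n t - s t)) \<longlonglongrightarrow> 0"
  proof (rule complete[OF SX])
    fix e :: real assume e: "e > 0"
    have "(\<lambda>n. 2 * (1/2::real) ^ n) \<longlonglongrightarrow> 2 * 0"
      by (intro tendsto_mult tendsto_const LIMSEQ_power_zero) simp
    then have "\<forall>\<^sub>F n in sequentially. 2 * (1/2::real) ^ n < e"
      using e by (intro order_tendstoD(2)) simp_all
    then obtain K where K: "\<And>n. n \<ge> K \<Longrightarrow> 2 * (1/2::real) ^ n < e"
      unfolding eventually_sequentially by blast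
    have "N (\<lambda>t. S m t - S n t) < e" if "m \<ge> K" "n \<ge> K" for m n
    proof (cases "n \<le> m")
      case True then show ?thesis using step[of n m] K[OF that(2)] by linarith
    next
      case False then show ?thesis using step[of m n] K[OF that(1)] sym[of m n] by linarith
    qed
    then show "\<exists>K. \<forall>m\<ge>K. \<forall>n\<ge>K. N (\<lambda>t. S m t - S n t) < e" by blast
  qed
  then obtain s where s: "s \<in> X" "(\<lambda>n. N (\<lambda>t. S n t - s t)) \<longlonglongrightarrow> 0" by blast
  have "AE t in leb01. h n t \<le> s t" for n
  proof -
    let ?p = "\<lambda>t. max 0 (h n t - s t)"
    have p_meas: "?p \<in> borel_measurable leb01"
      using measurable_mem[OF h(1)] measurable_mem[OF s(1)] by measurable
    have p_le: "\<bar>?p t\<bar> \<le> \<bar>S m t - s t\<bar>" if "m > n" for m t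
    proof -
      have "h n t \<le> S m t" unfolding S_def using that h(2) by (intro member_le_sum) auto
      then show ?thesis by linarith
    qed
    have pX: "?p \<in> X"
      by (rule dominated_mem(1)[OF p_meas diff_mem[OF SX[of "Suc n"] s(1)]]) (use p_le[of "Suc n"] in simp)
    have "N ?p \<le> N (\<lambda>t. S m t - s t)" if "m > n" for m
      by (rule dominated_mem(2)[OF p_meas diff_mem[OF SX s(1)]]) (use p_le[OF that] in simp)
    then have "N ?p \<le> 0"
      by (intro LIMSEQ_le_const[OF s(2)] exI[of _ "Suc n"]) simp
    then have "N ?p = 0" using norm_nonneg[OF pX] by simp
    then have "AE t in leb01. ?p t = 0" using norm_eq_0_iff[OF pX] by simp
    then show ?thesis by eventually_elim simp
  qed
  with s(1) show ?thesis by (rule that)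
qed

text \<open>If no bound existed, ever worse violations could be scaled to a norm convergent series
  whose upper bound \<open>s\<close> in \<open>X\<close> has a product with \<open>g\<close> of
  infinite integral.\<close>

lemma associate_integral_bounded:
  assumes g: "g \<in> associate_space X"
  obtains C where "\<And>f. f \<in> X \<Longrightarrow> \<bar>LINT t|leb01. f t * g t\<bar> \<le> C * N f"
proof -
  have int: "integrable leb01 (\<lambda>t. f t * g t)" if "f \<in> X" for f
    using g that by (simp add: associate_space_def)
  have "\<exists>C. \<forall>f\<in>X. \<bar>LINT t|leb01. f t * g t\<bar> \<le> C * N f"
  proof (rule ccontr)
    assume "\<not> ?thesis"
    \<comment> \<open>The factor \<open>2 ^ n\<close> is spent on making the norms summable; the
      factor \<open>n\<close> survives in the integrals.\<close>
    then have "\<forall>n::nat. \<exists>f\<in>X. real n * 2 ^ n * N f < \<bar>LINT t|leb01. f t * g t\<bar>"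
      by (meson not_le)
    then obtain f where f: "\<And>n. f n \<in> X" "\<And>n. real n * 2 ^ n * N (f n) < \<bar>LINT t|leb01. f n t * g t\<bar>"
      by metis
    have Npos: "N (f n) > 0" for n
    proof (rule ccontr)
      assume "\<not> N (f n) > 0"
      then have "N (f n) = 0" using norm_nonneg[OF f(1)[of n]] by simp
      then have "AE t in leb01. f n t = 0" using norm_eq_0_iff[OF f(1)] by simp
      then have "AE t in leb01. f n t * g t = 0" by eventually_elim simp
      then have "(LINT t|leb01. f n t * g t) = 0" by (rule integral_eq_zero_AE)
      then show False using f(2)[of n] \<open>N (f n) = 0\<close> by simp
    qed
    define c where "c = (\<lambda>n. 1 / (2 ^ n * N (f n)))"
    have c: "c n > 0" for n using Npos by (simp add: c_def)
    define h where "h = (\<lambda>n t. c n * \<bar>f n t\<bar>)"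
    have hX: "h n \<in> X" for n unfolding h_def by (intro scale_mem abs_mem f)
    have "N (h n) \<le> (1/2) ^ n" for n
      unfolding h_def using norm_scale[OF abs_mem(1)[OF f(1)], of "c n" n] abs_mem(2)[OF f(1), of n] Npos[of n]
      by (simp add: c_def power_divide)
    moreover have "0 \<le> h n t" for n t unfolding h_def using c[of n] by simp
    ultimately obtain s where s: "s \<in> X" "\<And>n. AE t in leb01. h n t \<le> s t"
      using series_upper_bound[of h] hX by blast
    have "real n \<le> (LINT t|leb01. \<bar>s t * g t\<bar>)" for n
    proof -
      have "real n \<le> c n * \<bar>LINT t|leb01. f n t * g t\<bar>"
        using f(2)[of n] Npos[of n] by (simp add: c_def field_simps)
      also have "\<dots> \<le> c n * (LINT t|leb01. \<bar>f n t * g t\<bar>)"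
        using c[of n] by (intro mult_left_mono integral_abs_bound) auto
      also have "\<dots> = (LINT t|leb01. \<bar>h n t * g t\<bar>)"
        using c[of n] by (simp add: h_def abs_mult mult.assoc flip: integral_mult_right_zero)
      also have "\<dots> \<le> (LINT t|leb01. \<bar>s t * g t\<bar>)"
      proof (rule integral_mono_AE)
        show "integrable leb01 (\<lambda>t. \<bar>h n t * g t\<bar>)" "integrable leb01 (\<lambda>t. \<bar>s t * g t\<bar>)"
          using int[OF hX] int[OF s(1)] by auto
        show "AE t in leb01. \<bar>h n t * g t\<bar> \<le> \<bar>s t * g t\<bar>"
          using s(2)[of n]
        proof eventually_elim
          case (elim t)
          have "0 \<le> h n t" unfolding h_def using c[of n] by simp
          then have "\<bar>h n t\<bar> \<le> \<bar>s t\<bar>" using elim by linarith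
          then show ?case unfolding abs_mult by (rule mult_right_mono) simp
        qed
      qed
      finally show ?thesis .
    qed
    then show False using reals_Archimedean2 by (meson not_le)
  qed
  then show ?thesis using that by blast
qed

lemma weakly_null_assoc_null:
  assumes "weakly_null X N F" shows "assoc_null X F"
  unfolding assoc_null_def
proof (intro conjI allI ballI)
  show "F n \<in> X" for n using assms by (simp add: weakly_null_def)
  fix g assume g: "g \<in> associate_space X"
  have int: "integrable leb01 (\<lambda>t. f t * g t)" if "f \<in> X" for f
    using g that by (simp add: associate_space_def)
  obtain C where C: "\<And>f. f \<in> X \<Longrightarrow> \<bar>LINT t|leb01. f t * g t\<bar> \<le> C * N f"
    using associate_integral_bounded[OF g] by blast
  have "bounded_functional X N (\<lambda>f. LINT t|leb01. f t * g t)"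
    unfolding bounded_functional_def using C int
    by (auto simp: distrib_right mult.assoc intro!: exI[of _ C])
  from weakly_nullD[OF assms this] show "(\<lambda>n. LINT t|leb01. F n t * g t) \<longlonglongrightarrow> 0" .
qed

lemma norming_functional:
  assumes "v \<in> X"
  shows "\<exists>\<phi>. (\<forall>x\<in>X. \<forall>y\<in>X. \<phi> (\<lambda>t. x t + y t) = \<phi> x + \<phi> y) \<and>
    (\<forall>x\<in>X. \<forall>c. \<phi> (\<lambda>t. c * x t) = c * \<phi> x) \<and> (\<forall>x\<in>X. \<bar>\<phi> x\<bar> \<le> N x) \<and> \<phi> v = N v"
proof (rule hahn_banach_norming[OF _ norm_triangle norm_scale assms])
  show "function_subspace X"
    by (simp add: function_subspace_def zero_mem add_mem scale_mem)
qed

text \<open>Gliding hump: norming functionals of a rapidly growing subsequence, each almost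
  annihilating the later terms, add up to a functional unbounded along the sequence.\<close>

lemma weakly_null_bounded:
  assumes w: "weakly_null X N F"
  obtains C where "\<And>n. N (F n) \<le> C"
proof -
  have FX: "F n \<in> X" for n using w by (simp add: weakly_null_def)
  have "\<exists>C. \<forall>n. N (F n) \<le> C"
  proof (rule ccontr)
    assume unbdd: "\<not> ?thesis"
    have "\<forall>n. \<exists>\<phi>. (\<forall>x\<in>X. \<forall>y\<in>X. \<phi> (\<lambda>t. x t + y t) = \<phi> x + \<phi> y) \<and>
      (\<forall>x\<in>X. \<forall>c. \<phi> (\<lambda>t. c * x t) = c * \<phi> x) \<and> (\<forall>x\<in>X. \<bar>\<phi> x\<bar> \<le> N x) \<and> \<phi> (F n) = N (F n)"
      using norming_functional[OF FX] by blast
    from choice[OF this] obtain \<phi> where \<phi>: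
      "\<And>n x y. x \<in> X \<Longrightarrow> y \<in> X \<Longrightarrow> \<phi> n (\<lambda>t. x t + y t) = \<phi> n x + \<phi> n y"
      "\<And>n x c. x \<in> X \<Longrightarrow> \<phi> n (\<lambda>t. c * x t) = c * \<phi> n x"
      "\<And>n x. x \<in> X \<Longrightarrow> \<bar>\<phi> n x\<bar> \<le> N x" "\<And>n. \<phi> n (F n) = N (F n)"
      by blast
    have "bounded_functional X N (\<phi> n)" for n
      unfolding bounded_functional_def using \<phi>(1,2,3) by (auto intro!: exI[of _ 1])
    then have \<phi>_lim: "(\<lambda>k. \<phi> n (F k)) \<longlonglongrightarrow> 0" for n
      using w by (simp add: weakly_null_def)
    \<comment> \<open>The functional at \<open>r (Suc k)\<close> has weight
      \<open>(1/4) ^ Suc k\<close> in \<open>\<Phi>\<close>, so this growth makes its own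
      contribution at least 3. The later functionals take away at most a third of it and the earlier
      ones at most \<open>4 / 3\<close>, which leaves \<open>2 / 3\<close>.\<close>
    let ?R = "\<lambda>k n n'. n < n' \<and> 3 * 4 ^ Suc k \<le> N (F n') \<and> (\<forall>m\<le>n. \<bar>\<phi> m (F n')\<bar> \<le> 1)"
    have "\<exists>r. \<forall>k. True \<and> ?R k (r k) (r (Suc k))"
    proof (rule dependent_nat_choice)
      fix n k :: nat
      have "\<forall>\<^sub>F k in sequentially. \<bar>\<phi> m (F k)\<bar> \<le> 1" for m
        using order_tendstoD(2)[OF tendsto_rabs_zero[OF \<phi>_lim[of m]], of 1] by (rule eventually_mono) simp_all
      then have "\<forall>\<^sub>F k in sequentially. \<forall>m\<in>{..n}. \<bar>\<phi> m (F k)\<bar> \<le> 1"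
        by (intro eventually_ball_finite) auto
      then obtain K where K: "\<And>k m. k \<ge> K \<Longrightarrow> m \<le> n \<Longrightarrow> \<bar>\<phi> m (F k)\<bar> \<le> 1"
        by (auto simp: eventually_sequentially)
      have "\<exists>n'. n' > max n K \<and> 3 * 4 ^ Suc k \<le> N (F n')"
      proof (rule ccontr)
        assume "\<not> ?thesis"
        then have late: "N (F i) \<le> 3 * 4 ^ Suc k" if "i > max n K" for i
          using that by (meson linear)
        have "N (F i) \<le> 3 * 4 ^ Suc k + (\<Sum>j\<le>max n K. N (F j))" for i
        proof (cases "i \<le> max n K")
          case True
          then have "N (F i) \<le> (\<Sum>j\<le>max n K. N (F j))"
            using norm_nonneg[OF FX] by (intro member_le_sum) auto
          moreover have "0 \<le> (3 * 4 ^ Suc k :: real)" by simp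
          ultimately show ?thesis by linarith
        next
          case False
          moreover have "0 \<le> (\<Sum>j\<le>max n K. N (F j))" using norm_nonneg[OF FX] by (intro sum_nonneg) auto
          ultimately show ?thesis using late[of i] by linarith
        qed
        then show False using unbdd by blast
      qed
      then obtain n' where "n' > max n K" "3 * 4 ^ Suc k \<le> N (F n')" by blast
      then show "\<exists>n'. True \<and> ?R k n n'" using K by (intro exI[of _ n']) auto
    qed simp
    then obtain r where r: "\<And>k. r k < r (Suc k)" "\<And>k. 3 * 4 ^ Suc k \<le> N (F (r (Suc k)))"
      "\<And>k m. m \<le> r k \<Longrightarrow> \<bar>\<phi> m (F (r (Suc k)))\<bar> \<le> 1" by blast
    have r_mono: "strict_mono r" using r(1) by (simp add: strict_mono_Suc_iff)
    define \<Phi> where "\<Phi> = (\<lambda>x. \<Sum>j. (1/4) ^ j * \<phi> (r j) x)"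
    have geo: "summable (\<lambda>j. (1/4::real) ^ j * c)" for c
      by (intro summable_mult2 summable_geometric) simp
    have term_le: "norm ((1/4) ^ j * \<phi> (r j) x) \<le> (1/4) ^ j * N x" if "x \<in> X" for j x
      using \<phi>(3)[OF that] by (simp add: abs_mult mult_left_mono)
    have summ: "summable (\<lambda>j. (1/4) ^ j * \<phi> (r j) x)" if "x \<in> X" for x
      using term_le[OF that] by (intro summable_comparison_test'[OF geo, of 0]) auto
    have "bounded_functional X N \<Phi>"
      unfolding bounded_functional_def
    proof (intro conjI ballI allI exI)
      show "\<Phi> (\<lambda>t. x t + y t) = \<Phi> x + \<Phi> y" if "x \<in> X" "y \<in> X" for x y
        unfolding \<Phi>_def using suminf_add[OF summ[OF that(1)] summ[OF that(2)]] \<phi>(1)[OF that]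
        by (simp add: distrib_left)
      show "\<Phi> (\<lambda>t. c * x t) = c * \<Phi> x" if "x \<in> X" for x c
        unfolding \<Phi>_def using suminf_mult[OF summ[OF that], of c] \<phi>(2)[OF that]
        by (simp add: mult.left_commute)
      show "\<bar>\<Phi> x\<bar> \<le> (\<Sum>j. (1/4) ^ j) * N x" if "x \<in> X" for x
      proof -
        have "norm (\<Phi> x) \<le> (\<Sum>j. (1/4) ^ j * N x)"
          unfolding \<Phi>_def using term_le[OF that] by (intro norm_suminf_le geo) auto
        also have "\<dots> = (\<Sum>j. (1/4) ^ j) * N x"
          by (rule suminf_mult2[symmetric]) (intro summable_geometric, simp)
        finally show ?thesis by simp
      qed
    qed
    then have "(\<lambda>k. \<Phi> (F k)) \<longlonglongrightarrow> 0"
      using w by (simp add: weakly_null_def)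
    from LIMSEQ_subseq_LIMSEQ[OF this r_mono]
    have lim: "(\<lambda>k. \<Phi> (F (r (Suc k)))) \<longlonglongrightarrow> 0" by (auto simp: o_def dest: LIMSEQ_Suc)
    have big: "2 / 3 \<le> \<Phi> (F (r (Suc k)))" for k
    proof -
      let ?x = "F (r (Suc k))"
      let ?a = "\<lambda>j. (1/4) ^ j * \<phi> (r j) ?x"
      have "\<Phi> ?x = (\<Sum>j. ?a (j + Suc (Suc k))) + (\<Sum>j<Suc (Suc k). ?a j)"
        unfolding \<Phi>_def by (rule suminf_split_initial_segment[OF summ[OF FX]])
      then have eq: "\<Phi> ?x = (\<Sum>j. ?a (j + Suc (Suc k))) + (\<Sum>j<Suc k. ?a j) + (1/4) ^ Suc k * N ?x"
        using \<phi>(4) by simp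
      have "norm (\<Sum>j. ?a (j + Suc (Suc k))) \<le> (\<Sum>j. (1/4) ^ j * ((1/4) ^ Suc (Suc k) * N ?x))"
      proof (intro norm_suminf_le geo)
        show "norm (?a (j + Suc (Suc k))) \<le> (1/4) ^ j * ((1/4) ^ Suc (Suc k) * N ?x)" for j
          using term_le[OF FX, of "j + Suc (Suc k)" "r (Suc k)"] by (simp add: power_add mult_ac)
      qed
      also have "\<dots> = (\<Sum>j. (1/4) ^ j) * ((1/4) ^ Suc (Suc k) * N ?x)"
        by (rule suminf_mult2[symmetric]) (intro summable_geometric, simp)
      also have "\<dots> = (1/3) * ((1/4) ^ Suc k * N ?x)"
        by (subst suminf_geometric) auto
      finally have tail: "\<bar>\<Sum>j. ?a (j + Suc (Suc k))\<bar> \<le> (1/3) * ((1/4) ^ Suc k * N ?x)" by simp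
      have "\<bar>\<Sum>j<Suc k. ?a j\<bar> \<le> (\<Sum>j<Suc k. (1/4) ^ j)"
      proof (rule order_trans[OF sum_abs sum_mono])
        fix j assume "j \<in> {..<Suc k}"
        then have "r j \<le> r k" using r_mono by (simp add: strict_mono_less_eq)
        then show "\<bar>?a j\<bar> \<le> (1/4) ^ j"
          using r(3)[of "r j" k] by (simp add: abs_mult mult_left_le)
      qed
      also have "\<dots> \<le> 4 / 3"
        using sum_le_suminf[of "\<lambda>j. (1/4::real) ^ j" "{..<Suc k}"] suminf_geometric[of "1/4::real"]
        by (simp add: summable_geometric)
      finally have head: "\<bar>\<Sum>j<Suc k. ?a j\<bar> \<le> 4 / 3" .
      have "(1/4) ^ Suc k * (3 * 4 ^ Suc k) \<le> (1/4) ^ Suc k * N ?x"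
        using r(2)[of k] by (intro mult_left_mono) auto
      moreover have "(1/4) ^ Suc k * (3 * 4 ^ Suc k) = (3::real)"
        by (simp add: power_divide)
      ultimately have "3 \<le> (1/4) ^ Suc k * N ?x" by linarith
      then show ?thesis using eq tail head by linarith
    qed
    have "(2/3::real) \<le> 0"
      by (rule LIMSEQ_le_const[OF lim]) (use big in simp)
    then show False by simp
  qed
  then show ?thesis using that by blast
qed

end

section \<open>Rearrangement invariant spaces\<close>

text \<open>A sum of indicators counts the sets that contain \<open>t\<close>. In a decreasing chain
  these are the first ones, so a level set is a single member of the chain or empty.\<close>

lemma chain_level_set:
  fixes x :: real
  assumes dec: "\<And>l m. l \<le> m \<Longrightarrow> A m \<subseteq> A l" and x: "0 \<le> x"
  shows "x < (\<Sum>l<L. indicator (A l) t) \<longleftrightarrow> nat \<lfloor>x\<rfloor> < L \<and> t \<in> A (nat \<lfloor>x\<rfloor>)"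
proof -
  let ?K = "{l\<in>{..<L}. t \<in> A l}" and ?m = "nat \<lfloor>x\<rfloor>"
  have sum: "(\<Sum>l<L. indicator (A l) t) = real (card ?K)"
    by (simp add: indicator_def sum.If_cases Int_def)
  have m: "real ?m \<le> x" "x < real ?m + 1" using x by linarith+
  show ?thesis
  proof (cases "?m < L \<and> t \<in> A ?m")
    case True
    then have "{..?m} \<subseteq> ?K" using dec by (force simp: subset_iff)
    from card_mono[OF _ this] have "?m + 1 \<le> card ?K" by simp
    then have "x < real (card ?K)" using m(2) by linarith
    then show ?thesis using True sum by simp
  next
    case False
    have "l < ?m" if l: "l < L" "t \<in> A l" for l
    proof (rule ccontr)
      assume "\<not> l < ?m"
      then have "?m \<le> l" by simp
      then have "?m < L" "t \<in> A ?m" using l dec[of ?m l] by auto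
      then show False using False by blast
    qed
    then have "?K \<subseteq> {..<?m}" by auto
    from card_mono[OF _ this] have "card ?K \<le> ?m" by simp
    then have "\<not> x < real (card ?K)" using m(1) by linarith
    then show ?thesis using False sum by simp
  qed
qed

text \<open>The cells are half-open and hence disjoint; the point 1 lies in none of them, gets the
  value 0 and is later discarded as a null set.\<close>

definition cell_step :: "nat \<Rightarrow> (nat \<Rightarrow> real) \<Rightarrow> real \<Rightarrow> real" where
  "cell_step n w t = (\<Sum>k<n. w k * indicator {real k / n..<real (Suc k) / n} t)"

lemma cell_disjoint:
  fixes n :: nat
  assumes "t \<in> {real k / n..<real (Suc k) / n}" "t \<in> {real j / n..<real (Suc j) / n}" "n > 0"
  shows "k = j"
proof -
  have "real k < real (Suc j)" "real j < real (Suc k)"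
    using assms by (auto simp: field_simps intro: order.strict_trans1)
  then show ?thesis by simp
qed

lemma cell_step_eq:
  assumes "k < n" "t \<in> {real k / n..<real (Suc k) / n}"
  shows "cell_step n w t = w k"
proof -
  have "cell_step n w t = (\<Sum>j\<in>{k}. w j * indicator {real j / n..<real (Suc j) / n} t)"
    unfolding cell_step_def
  proof (rule sum.mono_neutral_right)
    show "\<forall>j\<in>{..<n} - {k}. w j * indicator {real j / n..<real (Suc j) / n} t = 0"
      using cell_disjoint[OF _ assms(2)] assms(1) by (auto simp: indicator_def)
  qed (use assms(1) in auto)
  then show ?thesis using assms(2) by (simp add: indicator_def del: sum_mult_indicator)
qed

lemma cell_exists:
  fixes n :: nat
  assumes "n > 0" "t \<in> {0..<1}"
  obtains k where "k < n" "t \<in> {real k / n..<real (Suc k) / n}"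
proof -
  let ?k = "nat \<lfloor>n * t\<rfloor>"
  have k: "real ?k \<le> n * t" "n * t < real (Suc ?k)" using assms by (simp_all, linarith)
  have "real n * t < real n * 1" using assms by (intro mult_strict_left_mono) auto
  then have "real ?k < real n" using k(1) by simp
  moreover have "t \<in> {real ?k / n..<real (Suc ?k) / n}"
    using k assms(1) by (auto simp: field_simps)
  ultimately show ?thesis using that by simp
qed

lemma cell_subset:
  fixes n :: nat
  assumes "k < n" shows "{real k / n..<real (Suc k) / n} \<subseteq> {0..1}"
proof -
  have *: "real (Suc k) / n \<le> 1" "0 \<le> real k / n" using assms by (simp_all add: divide_le_eq)
  show ?thesis
  proof
    fix x assume "x \<in> {real k / n..<real (Suc k) / n}"
    then have "real k / n \<le> x" "x < real (Suc k) / n" by auto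
    with * show "x \<in> {0..1}" unfolding atLeastAtMost_iff by linarith
  qed
qed

lemma cell_sets:
  fixes n :: nat
  shows "k < n \<Longrightarrow> {real k / n..<real (Suc k) / n} \<in> sets leb01"
  using cell_subset by (auto simp: sets_leb01_iff)

lemma cell_measure:
  fixes n :: nat
  assumes "k < n" shows "measure leb01 {real k / n..<real (Suc k) / n} = 1 / n"
proof -
  have "real k / n \<le> real (Suc k) / n" by (simp add: divide_right_mono)
  then show ?thesis
    unfolding measure_leb01[OF cell_subset[OF assms]] by (simp add: diff_divide_distrib[symmetric])
qed

lemma cell_step_measurable: "cell_step n w \<in> borel_measurable leb01"
proof -
  have "(\<lambda>t. \<Sum>k<n. w k * indicator {real k / n..<real (Suc k) / n} t) \<in> borel_measurable leb01"
    using cell_sets by (intro borel_measurable_sum borel_measurable_times borel_measurable_indicator) auto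
  then show ?thesis by (simp add: cell_step_def[abs_def])
qed

lemma cell_step_level_measure:
  assumes "n > 0" "0 \<le> l"
  shows "measure leb01 {x\<in>{0..1}. l < \<bar>cell_step n w x\<bar>} = real (card {k\<in>{..<n}. l < \<bar>w k\<bar>}) / n"
proof -
  let ?K = "{k\<in>{..<n}. l < \<bar>w k\<bar>}" and ?I = "\<lambda>k. {real k / n..<real (Suc k) / n}"
  have "{x\<in>{0..1}. l < \<bar>cell_step n w x\<bar>} = (\<Union>k\<in>?K. ?I k)"
  proof (intro set_eqI iffI)
    fix t assume t: "t \<in> {x\<in>{0..1}. l < \<bar>cell_step n w x\<bar>}"
    have "t \<noteq> 1"
    proof
      assume "t = 1"
      have "\<not> (1::real) < real (Suc k) / n" if "k < n" for k
        using that by (simp add: field_simps)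
      then have "cell_step n w t = 0"
        unfolding cell_step_def \<open>t = 1\<close> by (intro sum.neutral) (auto simp: indicator_def)
      then show False using t assms(2) by simp
    qed
    then have "t \<in> {0..<1}" using t by simp
    then obtain k where k: "k < n" "t \<in> ?I k"
      by (rule cell_exists[OF assms(1)])
    then have "k \<in> ?K" using t cell_step_eq[OF k, of w] by simp
    then show "t \<in> (\<Union>k\<in>?K. ?I k)" using k(2) by blast
  next
    fix t assume "t \<in> (\<Union>k\<in>?K. ?I k)"
    then obtain k where k: "k < n" "t \<in> ?I k" "l < \<bar>w k\<bar>" by blast
    moreover have "t \<in> {0..1}" using cell_sets[OF k(1)] k(2) by (auto simp: sets_leb01_iff)
    ultimately show "t \<in> {x\<in>{0..1}. l < \<bar>cell_step n w x\<bar>}"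
      using cell_step_eq[OF k(1,2), of w] by simp
  qed
  also have "measure leb01 \<dots> = (\<Sum>k\<in>?K. measure leb01 (?I k))"
  proof (rule leb01.finite_measure_finite_Union)
    show "disjoint_family_on ?I ?K"
      unfolding disjoint_family_on_def using cell_disjoint[OF _ _ assms(1)] by blast
  qed (use cell_sets in auto)
  also have "\<dots> = real (card ?K) / n"
    using cell_measure by simp
  finally show ?thesis .
qed

text \<open>Addition modulo \<open>n\<close> for arguments below \<open>n\<close>. Its symmetry in
  shift and cell turns a sum over all shifts at one cell into a sum over all cells.\<close>

definition rotate_cell :: "nat \<Rightarrow> nat \<Rightarrow> nat \<Rightarrow> nat" where
  "rotate_cell n i k = (if k + i < n then k + i else k + i - n)"

lemma bij_rotate_cell:
  assumes "i < n" shows "bij_betw (rotate_cell n i) {..<n} {..<n}"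
proof -
  have "inj_on (rotate_cell n i) {..<n}"
    using assms by (auto simp: inj_on_def rotate_cell_def split: if_splits)
  moreover have "rotate_cell n i ` {..<n} \<subseteq> {..<n}"
    using assms by (auto simp: rotate_cell_def)
  ultimately show ?thesis
    unfolding bij_betw_def using endo_inj_surj[of "{..<n}"] by blast
qed

lemma rotate_cell_commute: "rotate_cell n i k = rotate_cell n k i"
  by (simp add: rotate_cell_def add.commute)

section \<open>Averaging over cyclic shifts\<close>

context ri_space
begin

lemma equimeasurable_mem:
  assumes "h \<in> borel_measurable leb01" "f \<in> X"
    and "\<And>l. 0 \<le> l \<Longrightarrow> measure leb01 {x\<in>{0..1}. l < \<bar>h x\<bar>} = measure leb01 {x\<in>{0..1}. l < \<bar>f x\<bar>}"
  shows "h \<in> X" "N h = N f"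
proof -
  have "decr_rearr h t = decr_rearr f t" for t
    unfolding decr_rearr_def using assms(3) by (intro arg_cong[where f = Inf]) auto
  then show "h \<in> X" "N h = N f"
    using rearr_inv[of h f] assms(1,2) by (auto simp: L0_def)
qed

text \<open>Rotating the cells preserves the measures of the level sets and hence the norm. At each
  point below 1 the \<open>n\<close> rotations run through all cells, so they add up to a constant,
  and the triangle inequality bounds its norm.\<close>

lemma cell_step_average:
  assumes n: "n > 0" and X: "cell_step n w \<in> X"
  shows "(\<lambda>t. (\<Sum>k<n. w k) * indicator {0..<1} t) \<in> X"
    and "N (\<lambda>t. (\<Sum>k<n. w k) * indicator {0..<1} t) \<le> n * N (cell_step n w)"
proof -
  let ?g = "\<lambda>i. cell_step n (w \<circ> rotate_cell n i)"
  have g: "?g i \<in> X \<and> N (?g i) = N (cell_step n w)" if i: "i < n" for i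
  proof -
    have "card {k\<in>{..<n}. l < \<bar>(w \<circ> rotate_cell n i) k\<bar>} = card {k\<in>{..<n}. l < \<bar>w k\<bar>}" for l
    proof (rule bij_betw_same_card[of "rotate_cell n i"])
      have b: "bij_betw (rotate_cell n i) {..<n} {..<n}" using i by (rule bij_rotate_cell)
      show "bij_betw (rotate_cell n i) {k\<in>{..<n}. l < \<bar>(w \<circ> rotate_cell n i) k\<bar>} {k\<in>{..<n}. l < \<bar>w k\<bar>}"
        unfolding bij_betw_def
      proof
        show "inj_on (rotate_cell n i) {k\<in>{..<n}. l < \<bar>(w \<circ> rotate_cell n i) k\<bar>}"
          using bij_betw_imp_inj_on[OF b] by (rule inj_on_subset) auto
        show "rotate_cell n i ` {k\<in>{..<n}. l < \<bar>(w \<circ> rotate_cell n i) k\<bar>} = {k\<in>{..<n}. l < \<bar>w k\<bar>}"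
        proof (intro set_eqI iffI)
          fix k assume k: "k \<in> {k\<in>{..<n}. l < \<bar>w k\<bar>}"
          then obtain j where j: "j < n" "k = rotate_cell n i j"
            using bij_betw_imp_surj_on[OF b] by (metis (no_types, lifting) imageE lessThan_iff mem_Collect_eq)
          show "k \<in> rotate_cell n i ` {k\<in>{..<n}. l < \<bar>(w \<circ> rotate_cell n i) k\<bar>}"
            unfolding j(2) by (rule imageI) (use j k in auto)
        next
          fix k assume "k \<in> rotate_cell n i ` {k\<in>{..<n}. l < \<bar>(w \<circ> rotate_cell n i) k\<bar>}"
          then show "k \<in> {k\<in>{..<n}. l < \<bar>w k\<bar>}"
            using bij_betwE[OF b] by auto
        qed
      qed
    qed
    then have "measure leb01 {x\<in>{0..1}. l < \<bar>?g i x\<bar>} = measure leb01 {x\<in>{0..1}. l < \<bar>cell_step n w x\<bar>}"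
      if "0 \<le> l" for l
      unfolding cell_step_level_measure[OF n that] by (simp only:)
    from equimeasurable_mem[OF cell_step_measurable X this] show ?thesis by blast
  qed
  have sum: "(\<Sum>i<n. ?g i t) = (\<Sum>k<n. w k) * indicator {0..<1} t" if "t \<in> {0..1}" "t \<noteq> 1" for t
  proof -
    have "t \<in> {0..<1}" using that by simp
    then obtain k where k: "k < n" "t \<in> {real k / n..<real (Suc k) / n}"
      by (rule cell_exists[OF n])
    have "(\<Sum>i<n. ?g i t) = (\<Sum>i<n. w (rotate_cell n k i))"
      using cell_step_eq[OF k] by (simp add: rotate_cell_commute[of n k])
    also have "\<dots> = (\<Sum>k<n. w k)"
      by (rule sum.reindex_bij_betw[OF bij_rotate_cell[OF k(1)]])
    finally show ?thesis using that by simp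
  qed
  from AE_neq_1 have AE_sum: "AE t in leb01. \<bar>(\<Sum>k<n. w k) * indicator {0..<1} t\<bar> \<le> \<bar>\<Sum>i<n. ?g i t\<bar>"
  proof (rule AE_mp, intro AE_I2 impI)
    fix t :: real assume "t \<in> space leb01" "t \<noteq> 1"
    then have "(\<Sum>i<n. ?g i t) = (\<Sum>k<n. w k) * indicator {0..<1} t" by (intro sum) auto
    then show "\<bar>(\<Sum>k<n. w k) * indicator {0..<1} t\<bar> \<le> \<bar>\<Sum>i<n. ?g i t\<bar>" by (simp only: order_refl)
  qed
  have meas: "(\<lambda>t. (\<Sum>k<n. w k) * indicator {0..<1} t) \<in> borel_measurable leb01"
  proof -
    have "{0..<1::real} \<in> sets leb01" by (auto simp: sets_leb01_iff)
    then show ?thesis by simp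
  qed
  have gX: "(\<lambda>t. \<Sum>i<n. ?g i t) \<in> X"
    using g by (intro sum_mem(1)) auto
  show "(\<lambda>t. (\<Sum>k<n. w k) * indicator {0..<1} t) \<in> X"
    by (rule dominated_mem(1)[OF meas gX AE_sum])
  have "N (\<lambda>t. (\<Sum>k<n. w k) * indicator {0..<1} t) \<le> N (\<lambda>t. \<Sum>i<n. ?g i t)"
    by (rule dominated_mem(2)[OF meas gX AE_sum])
  also have "\<dots> \<le> (\<Sum>i<n. N (?g i))"
    using g by (intro sum_mem(2)) auto
  also have "\<dots> = n * N (cell_step n w)" using g by simp
  finally show "N (\<lambda>t. (\<Sum>k<n. w k) * indicator {0..<1} t) \<le> n * N (cell_step n w)" .
qed

text \<open>The counting function of the chain \<open>A\<close> is rearranged to a decreasing one, discretized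
  from below on \<open>n\<close> cells, and averaged over the cyclic shifts of the cells.\<close>

lemma chain_average:
  assumes A: "\<And>l. A l \<in> sets leb01" and dec: "\<And>l m. l \<le> m \<Longrightarrow> A m \<subseteq> A l"
    and s: "(\<lambda>t. \<Sum>l<L. indicator (A l) t) \<in> X" and n: "n > (0::nat)"
  obtains W where "real n * (\<Sum>l<L. measure leb01 (A l)) - real L \<le> W" "0 \<le> W"
    "(\<lambda>t. W * indicator {0..<1} t) \<in> X"
    "N (\<lambda>t. W * indicator {0..<1} t) \<le> n * N (\<lambda>t. \<Sum>l<L. indicator (A l) t)"
proof -
  \<comment> \<open>Initial intervals of the same measures as the sets \<open>A l\<close> form a
    chain with an equimeasurable counting function that is decreasing.\<close>
  define d where "d = (\<lambda>l. measure leb01 (A l))"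
  define B where "B = (\<lambda>l. {0..<d l})"
  have d: "0 \<le> d l" "d l \<le> 1" for l unfolding d_def using measure_leb01_le_1 by auto
  have B: "B l \<in> sets leb01" for l
    unfolding B_def using d(2)[of l] by (auto simp: sets_leb01_iff)
  have mB: "measure leb01 (B l) = d l" for l
    unfolding B_def using d[of l] by (subst measure_leb01) auto
  have B_dec: "B m \<subseteq> B l" if "l \<le> m" for l m
    using leb01.finite_measure_mono[OF dec[OF that] A] by (auto simp: B_def d_def)
  let ?s = "\<lambda>t. \<Sum>l<L. indicator (A l) t :: real"
  let ?S = "\<lambda>t. \<Sum>l<L. indicator (B l) t :: real"
  have level: "measure leb01 {x\<in>{0..1}. l < \<bar>\<Sum>i<L. indicator (E i) x\<bar>} =
      (if nat \<lfloor>l\<rfloor> < L then measure leb01 (E (nat \<lfloor>l\<rfloor>)) else 0)"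
    if E: "\<And>i. E i \<in> sets leb01" "\<And>i j. i \<le> j \<Longrightarrow> E j \<subseteq> E i" and l: "0 \<le> l" for E and l :: real
  proof -
    have "0 \<le> (\<Sum>i<L. indicator (E i) x :: real)" for x by (intro sum_nonneg) auto
    then have "l < \<bar>\<Sum>i<L. indicator (E i) x\<bar> \<longleftrightarrow> nat \<lfloor>l\<rfloor> < L \<and> x \<in> E (nat \<lfloor>l\<rfloor>)" for x
      using chain_level_set[of E l x L, OF E(2) l] by (simp only: abs_of_nonneg)
    moreover have "E i \<subseteq> {0..1}" for i using E(1) by (simp add: sets_leb01_iff)
    ultimately have "{x\<in>{0..1}. l < \<bar>\<Sum>i<L. indicator (E i) x\<bar>} = (if nat \<lfloor>l\<rfloor> < L then E (nat \<lfloor>l\<rfloor>) else {})"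
      by (auto simp only: if_True if_False split: if_split)
    then show ?thesis by simp
  qed
  have S_meas: "?S \<in> borel_measurable leb01"
    using B by (intro borel_measurable_sum borel_measurable_indicator)
  have S: "?S \<in> X" "N ?S = N ?s"
    using equimeasurable_mem[OF S_meas s] level[OF A dec] level[OF B B_dec] mB by (simp_all add: d_def)
  \<comment> \<open>\<open>w k\<close> counts the intervals that contain cell \<open>k\<close>
    entirely, which keeps the step function below the counting function.\<close>
  define w where "w = (\<lambda>k. \<Sum>l<L. of_bool (real (Suc k) \<le> n * d l) :: real)"
  have w0: "0 \<le> w k" for k unfolding w_def by (intro sum_nonneg) auto
  have le: "\<bar>cell_step n w t\<bar> \<le> \<bar>?S t\<bar>" for t
  proof (cases "\<exists>k<n. t \<in> {real k / n..<real (Suc k) / n}")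
    case True
    then obtain k where k: "k < n" "t \<in> {real k / n..<real (Suc k) / n}" by blast
    have "0 \<le> t" using k(2) by (auto intro: order_trans[of 0 "real k / n"])
    have "w k \<le> ?S t"
      unfolding w_def
    proof (rule sum_mono)
      fix l
      have "t < d l" if "real (Suc k) \<le> n * d l"
      proof -
        have "real (Suc k) / n \<le> d l" using that n by (simp add: field_simps)
        then show ?thesis using k(2) by auto
      qed
      then show "of_bool (real (Suc k) \<le> n * d l) \<le> (indicator (B l) t :: real)"
        using \<open>0 \<le> t\<close> by (auto simp: B_def indicator_def)
    qed
    then show ?thesis using cell_step_eq[OF k, of w] w0[of k] by simp
  next
    case False
    then have "cell_step n w t = 0"
      unfolding cell_step_def by (intro sum.neutral) (auto simp: indicator_def)
    then show ?thesis by simp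
  qed
  have PX: "cell_step n w \<in> X"
    by (rule dominated_mem(1)[OF cell_step_measurable S(1)]) (use le in simp)
  have "N (cell_step n w) \<le> N ?S"
    by (rule dominated_mem(2)[OF cell_step_measurable S(1)]) (use le in simp)
  then have "n * N (cell_step n w) \<le> n * N ?s" using S(2) by (simp add: mult_left_mono)
  moreover note cell_step_average[OF n PX]
  moreover have "n * (\<Sum>l<L. d l) - real L \<le> (\<Sum>k<n. w k)"
  proof -
    \<comment> \<open>Rounding to whole cells loses at most one cell for each \<open>l\<close>,
      hence \<open>real L\<close> in total.\<close>
    have "n * d l - 1 \<le> (\<Sum>k<n. of_bool (real (Suc k) \<le> n * d l))" for l
    proof -
      let ?m = "nat \<lfloor>n * d l\<rfloor>"
      have m: "real ?m \<le> n * d l" "n * d l < real ?m + 1" using mult_nonneg_nonneg[of "real n" "d l"] d(1)[of l] by linarith+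
      have "real n * d l \<le> real n * 1" using d by (intro mult_left_mono) auto
      then have "?m \<le> n" using m by linarith
      then have "real ?m = (\<Sum>k<?m. of_bool (real (Suc k) \<le> n * d l))"
        using m(1) by (subst sum.cong[OF refl, of _ _ "\<lambda>_. 1"]) (auto simp: of_bool_def)
      also have "\<dots> \<le> (\<Sum>k<n. of_bool (real (Suc k) \<le> n * d l))"
        using \<open>?m \<le> n\<close> by (intro sum_mono2) auto
      finally show ?thesis using m(2) by linarith
    qed
    then have "(\<Sum>l<L. n * d l - 1) \<le> (\<Sum>l<L. \<Sum>k<n. of_bool (real (Suc k) \<le> n * d l))"
      by (intro sum_mono)
    also have "\<dots> = (\<Sum>k<n. w k)" unfolding w_def by (rule sum.swap)
    finally show ?thesis by (simp add: sum_subtractf sum_distrib_left)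
  qed
  moreover have "0 \<le> (\<Sum>k<n. w k)" using w0 by (intro sum_nonneg)
  ultimately show ?thesis
    by (intro that[of "\<Sum>k<n. w k"]) (auto simp: d_def intro: order_trans)
qed

end

lemma bounded_increasing_integrals:
  fixes u :: "real \<Rightarrow> real"
  assumes g: "\<And>i. integrable leb01 (g i)" and mono: "\<And>x. incseq (\<lambda>i. g i x)"
    and lim: "\<And>x. (\<lambda>i. g i x) \<longlonglongrightarrow> u x" and u: "u \<in> borel_measurable leb01"
    and K: "\<And>i. (LINT x|leb01. g i x) \<le> K"
  shows "integrable leb01 u" "(LINT x|leb01. u x) \<le> K"
proof -
  have inc: "incseq (\<lambda>i. LINT x|leb01. g i x)"
    using g mono by (auto intro!: incseq_SucI integral_mono dest: incseq_SucD)
  obtain L where L: "(\<lambda>i. LINT x|leb01. g i x) \<longlonglongrightarrow> L" "\<And>i. (LINT x|leb01. g i x) \<le> L"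
    using incseq_convergent[OF inc, of K] K by blast
  have mono': "AE x in leb01. mono (\<lambda>i. g i x)" using mono by simp
  have lim': "AE x in leb01. (\<lambda>i. g i x) \<longlonglongrightarrow> u x" using lim by simp
  show "integrable leb01 u"
    by (rule integrable_monotone_convergence[OF g mono' lim' L(1) u])
  have "(LINT x|leb01. u x) = L"
    by (rule integral_monotone_convergence[OF g mono' lim' L(1) u])
  also have "L \<le> K" using L(1) K by (intro LIMSEQ_le_const2) auto
  finally show "(LINT x|leb01. u x) \<le> K" .
qed

section \<open>Constants in X and integrability of the elements of X\<close>

context ri_space
begin

lemma AE_unit: "AE t in leb01. indicator {0..<1} t = (1::real)"
  using AE_neq_1 by (rule AE_mp) (auto intro!: AE_I2 simp: indicator_def)

text \<open>A nonzero element exceeds some \<open>e > 0\<close> in modulus on a set of positive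
  measure. Averaging the indicator of this set, a chain of length one, produces a positive constant
  in \<open>X\<close>.\<close>

lemma unit_mem: "(\<lambda>_. 1) \<in> X"
proof -
  obtain f where f: "f \<in> X" "\<not> (AE t in leb01. f t = 0)" using nontrivial by blast
  define A where "A = (\<lambda>e. {x\<in>space leb01. e < \<bar>f x\<bar>})"
  have A: "A e \<in> sets leb01" for e
    unfolding A_def using measurable_mem[OF f(1)] by measurable
  have "\<exists>n. measure leb01 (A (1 / real (Suc n))) > 0"
  proof (rule ccontr)
    assume "\<not> ?thesis"
    have "measure leb01 (A (1 / real (Suc n))) = 0" for n
    proof -
      have "\<not> 0 < measure leb01 (A (1 / real (Suc n)))"
        using \<open>\<not> (\<exists>n. measure leb01 (A (1 / real (Suc n))) > 0)\<close> by (rule contrapos_nn) (rule exI)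
      then show ?thesis using measure_nonneg[of leb01 "A (1 / real (Suc n))"] by linarith
    qed
    then have "A (1 / real (Suc n)) \<in> null_sets leb01" for n
      using A by (simp add: null_sets_def leb01.emeasure_eq_measure)
    then have "AE t in leb01. \<forall>n. t \<notin> A (1 / real (Suc n))"
      unfolding AE_all_countable by (intro allI AE_not_in)
    then have "AE t in leb01. f t = 0"
    proof (rule AE_mp, intro AE_I2 impI)
      fix t assume t: "t \<in> space leb01" "\<forall>n. t \<notin> A (1 / real (Suc n))"
      then have le: "\<bar>f t\<bar> \<le> 1 / real (Suc n)" for n by (auto simp: A_def not_less)
      have "\<bar>f t\<bar> \<le> 0"
        by (rule LIMSEQ_le_const[OF LIMSEQ_Suc[OF lim_1_over_n]]) (use le in blast)
      then show "f t = 0" by simp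
    qed
    with f(2) show False by simp
  qed
  then obtain e where e: "e > 0" "measure leb01 (A e) > 0" by (metis of_nat_0_less_iff zero_less_Suc zero_less_divide_1_iff)
  have ind: "(\<lambda>t. \<Sum>l<1::nat. indicator (A e) t) \<in> X"
  proof (rule dominated_mem(1)[OF _ scale_mem[OF f(1), of "1 / e"]])
    show "(\<lambda>t. \<Sum>l<1::nat. indicator (A e) t) \<in> borel_measurable leb01" using A by simp
    show "AE t in leb01. \<bar>\<Sum>l<1::nat. indicator (A e) t\<bar> \<le> \<bar>1 / e * f t\<bar>"
      using e(1) by (auto intro!: AE_I2 simp: indicator_def A_def abs_mult field_simps)
  qed
  \<comment> \<open>Once \<open>n\<close> times the measure exceeds 1, the rounding loss of 1 still
    leaves \<open>W\<close> positive.\<close>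
  obtain n :: nat where n: "1 / measure leb01 (A e) < real n" using reals_Archimedean2 by blast
  have n0: "n > 0" using n e(2) by (metis gr0I less_asym of_nat_0 zero_less_divide_1_iff)
  have "1 < real n * measure leb01 (A e)" using n e(2) by (simp add: field_simps)
  obtain W where W: "real n * (\<Sum>l<1::nat. measure leb01 (A e)) - real 1 \<le> W" "(\<lambda>t. W * indicator {0..<1} t) \<in> X"
    by (rule chain_average[of "\<lambda>_. A e" 1 n, OF A _ ind n0]) auto
  have Wpos: "W > 0" using W(1) \<open>1 < real n * measure leb01 (A e)\<close> by simp
  show ?thesis
  proof (rule dominated_mem(1)[OF _ scale_mem[OF W(2), of "1 / W"]])
    show "AE t in leb01. \<bar>1\<bar> \<le> \<bar>1 / W * (W * indicator {0..<1} t)\<bar>"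
      using AE_unit by (rule AE_mp) (use Wpos in \<open>auto intro!: AE_I2\<close>)
  qed simp
qed

definition unit_norm :: real where "unit_norm = N (\<lambda>_. 1)"

lemma unit_norm_pos: "0 < unit_norm"
proof -
  have "\<not> (AE t in leb01. (1::real) = 0)"
  proof
    assume "AE t in leb01. (1::real) = 0"
    then have "emeasure leb01 (space leb01) = 0"
      by (subst (asm) AE_iff_measurable[of "space leb01"]) auto
    then show False by (simp add: leb01.emeasure_eq_measure)
  qed
  then have "unit_norm \<noteq> 0" using norm_eq_0_iff[OF unit_mem] by (simp add: unit_norm_def)
  moreover have "0 \<le> unit_norm" using norm_nonneg[OF unit_mem] by (simp add: unit_norm_def)
  ultimately show ?thesis by simp
qed

lemma bounded_mem:
  assumes "f \<in> borel_measurable leb01" "AE t in leb01. \<bar>f t\<bar> \<le> B" "0 \<le> B"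
  shows "f \<in> X" "N f \<le> B * unit_norm"
proof -
  have dom: "AE t in leb01. \<bar>f t\<bar> \<le> \<bar>B * 1\<bar>"
    using assms(2,3) by simp
  show "f \<in> X"
    by (rule dominated_mem(1)[OF assms(1) scale_mem[OF unit_mem, of B] dom])
  have "N f \<le> N (\<lambda>t. B * 1)"
    by (rule dominated_mem(2)[OF assms(1) scale_mem[OF unit_mem, of B] dom])
  also have "\<dots> = B * unit_norm" using norm_scale[OF unit_mem, of B] assms(3) by (simp only: unit_norm_def abs_of_nonneg)
  finally show "N f \<le> B * unit_norm" .
qed

lemma bounded_L0_mem: "f \<in> bounded_L0 \<Longrightarrow> f \<in> X"
  by (erule bounded_L0E) (rule bounded_mem(1), auto)

lemma indicator_mem: "A \<in> sets leb01 \<Longrightarrow> indicator A \<in> X"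
  by (intro bounded_L0_mem bounded_L0_indicator)

text \<open>The level sets at integer heights form a chain whose counting function is at most
  \<open>\<bar>f\<bar> + 1\<close>, so its norm is at most \<open>N f + unit_norm\<close>.
  Comparison with the constants from \<open>chain_average\<close> bounds the sum of their measures,
  and this sum controls the integral; the summand 1 in the bound comes from rounding heights to
  integers.\<close>

lemma integrable_mem:
  assumes f: "f \<in> X"
  shows "integrable leb01 f" "(LINT t|leb01. \<bar>f t\<bar>) \<le> N f / unit_norm + 1"
proof -
  let ?K = "N f / unit_norm + 1"
  define A where "A = (\<lambda>l::nat. {x\<in>space leb01. real l < \<bar>f x\<bar>})"
  have meas: "f \<in> borel_measurable leb01" by (rule measurable_mem[OF f])
  have A: "A l \<in> sets leb01" for l
    unfolding A_def using meas by measurable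
  have dec: "A m \<subseteq> A l" if "l \<le> m" for l m
    using that by (auto simp: A_def)
  have count: "(\<Sum>l<L. indicator (A l) t) = (\<Sum>l<L. of_bool (real l < \<bar>f t\<bar>) :: real)" if "t \<in> space leb01" for L t
    using that by (intro sum.cong) (auto simp: A_def indicator_def)
  have level_sum: "(\<Sum>l<L. measure leb01 (A l)) \<le> ?K" for L
  proof -
    let ?s = "\<lambda>t. \<Sum>l<L. indicator (A l) t :: real"
    let ?f1 = "\<lambda>t. \<bar>f t\<bar> + 1"
    have f1: "?f1 \<in> X" "N ?f1 \<le> N f + unit_norm"
      using add_mem[OF abs_mem(1)[OF f] unit_mem] norm_triangle[OF abs_mem(1)[OF f] unit_mem] abs_mem(2)[OF f]
      by (simp_all add: unit_norm_def)
    have s_meas: "?s \<in> borel_measurable leb01" using A by simp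
    have s_le: "AE t in leb01. \<bar>?s t\<bar> \<le> \<bar>?f1 t\<bar>"
    proof (rule AE_I2)
      fix t assume t: "t \<in> space leb01"
      have "0 \<le> ?s t" by (intro sum_nonneg) simp
      moreover have "?s t \<le> \<bar>f t\<bar> + 1"
        unfolding count[OF t] sum_of_bool_less by (simp add: min_def) linarith
      ultimately show "\<bar>?s t\<bar> \<le> \<bar>?f1 t\<bar>" by linarith
    qed
    have s: "?s \<in> X" by (rule dominated_mem(1)[OF s_meas f1(1) s_le])
    have Ns: "N ?s \<le> N f + unit_norm"
      using dominated_mem(2)[OF s_meas f1(1) s_le] f1(2) by linarith
    have each: "(real n * (\<Sum>l<L. measure leb01 (A l)) - real L) * unit_norm \<le> real n * (N f + unit_norm)"
      if n: "n > 0" for n :: nat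
    proof (rule chain_average[OF A dec s n])
      fix W assume W: "real n * (\<Sum>l<L. measure leb01 (A l)) - real L \<le> W" "0 \<le> W"
        "(\<lambda>t. W * indicator {0..<1} t) \<in> X" "N (\<lambda>t. W * indicator {0..<1} t) \<le> n * N ?s"
      have dom: "AE t in leb01. \<bar>W * 1\<bar> \<le> \<bar>W * indicator {0..<1} t\<bar>"
        using AE_unit by eventually_elim simp
      have "N (\<lambda>t. W * 1) \<le> N (\<lambda>t. W * indicator {0..<1} t)"
        by (rule dominated_mem(2)[OF _ W(3) dom]) simp
      moreover have "N (\<lambda>t. W * 1) = W * unit_norm"
        using norm_scale[OF unit_mem, of W] W(2) by (simp only: unit_norm_def abs_of_nonneg)
      ultimately have "W * unit_norm \<le> n * N ?s" using W(4) by linarith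
      also have "\<dots> \<le> n * (N f + unit_norm)" using Ns by (intro mult_left_mono) auto
      finally have "W * unit_norm \<le> n * (N f + unit_norm)" .
      moreover have "(real n * (\<Sum>l<L. measure leb01 (A l)) - real L) * unit_norm \<le> W * unit_norm"
        using W(1) unit_norm_pos by (intro mult_right_mono) auto
      ultimately show ?thesis by linarith
    qed auto
    \<comment> \<open>The rounding loss \<open>L\<close> is fixed while the other terms grow like
      \<open>n\<close>, so it disappears for large \<open>n\<close>.\<close>
    show ?thesis
    proof (rule ccontr)
      assume "\<not> ?thesis"
      then have d: "(\<Sum>l<L. measure leb01 (A l)) - ?K > 0" by simp
      obtain n :: nat where n: "real L / ((\<Sum>l<L. measure leb01 (A l)) - ?K) < real n"
        using reals_Archimedean2 by blast
      have "0 \<le> real L / ((\<Sum>l<L. measure leb01 (A l)) - ?K)" using d by simp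
      then have n0: "n > 0" using n by (metis gr0I not_less of_nat_0)
      have "real L < real n * ((\<Sum>l<L. measure leb01 (A l)) - ?K)"
        using n d by (simp add: pos_divide_less_eq)
      then have "real n * ?K < real n * (\<Sum>l<L. measure leb01 (A l)) - real L"
        by (simp only: right_diff_distrib)
      then have "real n * ?K * unit_norm < (real n * (\<Sum>l<L. measure leb01 (A l)) - real L) * unit_norm"
        using unit_norm_pos by (rule mult_strict_right_mono)
      moreover have "real n * ?K * unit_norm = real n * (N f + unit_norm)"
        using unit_norm_pos by (simp add: field_simps)
      ultimately show False using each[OF n0] by linarith
    qed
  qed
  let ?g = "\<lambda>(i::nat) t. min \<bar>f t\<bar> (real i)"
  have g: "?g i \<in> bounded_L0" for i
    using meas by (intro bounded_L0I[of _ "real i"]) auto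
  then have p1: "integrable leb01 (?g i)" for i by (rule bounded_L0_integrable)
  have p5: "(LINT t|leb01. ?g i t) \<le> ?K" for i
  proof -
    have ind: "(\<lambda>t. \<Sum>l<i. indicator (A l) t :: real) \<in> bounded_L0"
      by (intro bounded_L0_sum bounded_L0_indicator A)
    have "(LINT t|leb01. ?g i t) \<le> (LINT t|leb01. (\<Sum>l<i. indicator (A l) t))"
    proof (rule integral_mono)
      fix t assume t: "t \<in> space leb01"
      show "?g i t \<le> (\<Sum>l<i. indicator (A l) t)"
        unfolding count[OF t] sum_of_bool_less by (simp add: min_def) linarith
    qed (intro bounded_L0_integrable g ind)+
    also have "\<dots> = (\<Sum>l<i. LINT t|leb01. indicator (A l) t)"
      by (intro Bochner_Integration.integral_sum bounded_L0_integrable bounded_L0_indicator A)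
    also have "\<dots> = (\<Sum>l<i. measure leb01 (A l))"
      using sets.Int_space_eq2[OF A] by simp
    finally show ?thesis using level_sum[of i] by linarith
  qed
  have p2: "incseq (\<lambda>i. ?g i t)" for t by (auto simp: incseq_def min_def)
  have p3: "(\<lambda>i. ?g i t) \<longlonglongrightarrow> \<bar>f t\<bar>" for t
  proof (rule tendsto_eventually)
    obtain n :: nat where "\<bar>f t\<bar> \<le> real n" using real_arch_simple by blast
    then show "\<forall>\<^sub>F i in sequentially. ?g i t = \<bar>f t\<bar>"
      unfolding eventually_sequentially by (intro exI[of _ n]) (auto simp: min_def)
  qed
  have p4: "(\<lambda>t. \<bar>f t\<bar>) \<in> borel_measurable leb01" using meas by simp
  note lim = bounded_increasing_integrals[of ?g, OF p1 p2 p3 p4 p5]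
  show "integrable leb01 f" using lim(1) integrable_abs_iff[OF meas] by blast
  show "(LINT t|leb01. \<bar>f t\<bar>) \<le> ?K" by (rule lim(2))
qed

text \<open>Each set rearranges to an initial interval, so the norm of an indicator is an increasing
  function of the measure alone. One set of positive measure and small norm then controls all sets
  of smaller measure.\<close>

lemma indicator_norm_dichotomy:
  obtains (bounded) c where "c > 0" "\<And>A. A \<in> sets leb01 \<Longrightarrow> measure leb01 A > 0 \<Longrightarrow> c \<le> N (indicator A)"
  | (small) "\<And>e. e > 0 \<Longrightarrow> \<exists>d>0. \<forall>A\<in>sets leb01. measure leb01 A < d \<longrightarrow> N (indicator A) < e"
proof (cases "\<exists>c>0. \<forall>A\<in>sets leb01. measure leb01 A > 0 \<longrightarrow> c \<le> N (indicator A)")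
  case True
  then show ?thesis using bounded by blast
next
  case False
  have "\<exists>d>0. \<forall>A\<in>sets leb01. measure leb01 A < d \<longrightarrow> N (indicator A) < e" if e: "e > 0" for e
  proof -
    obtain A0 where A0: "A0 \<in> sets leb01" "measure leb01 A0 > 0" "N (indicator A0) < e"
      using False e by (meson not_le)
    let ?B = "\<lambda>d. {0..<d} :: real set"
    have initial: "N (indicator A) = N (indicator (?B (measure leb01 A)))" if A: "A \<in> sets leb01" for A
    proof -
      let ?d = "measure leb01 A"
      have d: "0 \<le> ?d" "?d \<le> 1" using measure_leb01_le_1 by auto
      have B: "?B ?d \<in> sets leb01" using d by (auto simp: sets_leb01_iff)
      have mB: "measure leb01 (?B ?d) = ?d" using d by (subst measure_leb01) auto
      have level: "{x\<in>{0..1}. l < \<bar>indicator E x :: real\<bar>} = (if l < 1 then E else {})"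
        if "E \<in> sets leb01" "0 \<le> l" for E l
        using that by (auto simp: indicator_def sets_leb01_iff)
      show ?thesis
      proof (rule equimeasurable_mem(2))
        show "indicator A \<in> borel_measurable leb01" using A by simp
        show "indicator (?B ?d) \<in> X" using B by (rule indicator_mem)
        show "measure leb01 {x\<in>{0..1}. l < \<bar>indicator A x :: real\<bar>} = measure leb01 {x\<in>{0..1}. l < \<bar>indicator (?B ?d) x :: real\<bar>}"
          if "0 \<le> l" for l
          unfolding level[OF A that] level[OF B that] using mB by simp
      qed
    qed
    have "N (indicator A) < e" if A: "A \<in> sets leb01" "measure leb01 A < measure leb01 A0" for A
    proof -
      have B: "?B (measure leb01 E) \<in> sets leb01" for E
        using measure_leb01_le_1[of E] by (auto simp: sets_leb01_iff)
      have "N (indicator (?B (measure leb01 A))) \<le> N (indicator (?B (measure leb01 A0)))"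
        using B[of A] A(2) by (intro dominated_mem(2)[OF _ indicator_mem[OF B]] AE_I2) (auto simp: indicator_def)
      then show ?thesis using initial[OF A(1)] initial[OF A0(1)] A0(3) by simp
    qed
    then show ?thesis using A0(2) by blast
  qed
  then show ?thesis by (rule small)
qed

text \<open>An order null sequence converges in measure. Below a bounded \<open>f\<close>, the
  function \<open>F n\<close> is thus at most \<open>a\<close> outside a set of small measure and at
  most \<open>B\<close> on it, and \<open>small\<close> makes the indicator of that set small in
  norm.\<close>

lemma bounded_L0_oc_part:
  assumes small: "\<And>e. e > 0 \<Longrightarrow> \<exists>d>0. \<forall>A\<in>sets leb01. measure leb01 A < d \<longrightarrow> N (indicator A) < e"
    and f: "f \<in> bounded_L0"
  shows "f \<in> oc_part X N"
proof -
  obtain B where B: "0 \<le> B" "\<And>x. x \<in> {0..1} \<Longrightarrow> \<bar>f x\<bar> \<le> B" using f by (rule bounded_L0E) blast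
  have "(\<lambda>n. N (F n)) \<longlonglongrightarrow> 0" if oc: "order_converges X F (\<lambda>_. 0)" and dom: "\<And>n. AE t in leb01. \<bar>F n t\<bar> \<le> \<bar>f t\<bar>" for F
  proof (rule LIMSEQ_I)
    fix e :: real assume e: "e > 0"
    have FX: "F n \<in> X" for n using oc by (simp add: order_converges_def)
    have meas: "F n \<in> borel_measurable leb01" for n by (rule measurable_mem[OF FX])
    have lim: "AE t in leb01. (\<lambda>n. F n t) \<longlonglongrightarrow> 0" by (rule order_converges_AE[OF oc])
    \<comment> \<open>The part below height \<open>a\<close> receives half of \<open>e\<close>, the
      exceptional set the other half.\<close>
    define a where "a = e / (2 * unit_norm)"
    have a: "a > 0" using e unit_norm_pos by (simp add: a_def)
    have "e / (2 * (B + 1)) > 0" using e B(1) by simp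
    from small[OF this] obtain d where d: "d > 0"
      "\<And>A. A \<in> sets leb01 \<Longrightarrow> measure leb01 A < d \<Longrightarrow> N (indicator A) < e / (2 * (B + 1))" by blast
    let ?A = "\<lambda>n. {x\<in>space leb01. a < \<bar>F n x\<bar>}"
    have A: "?A n \<in> sets leb01" for n using meas by measurable
    have "(\<lambda>n. LINT x|leb01. indicator (?A n) x) \<longlonglongrightarrow> (LINT x|leb01. (0::real))"
    proof (rule integral_dominated_convergence[of _ _ _ "\<lambda>_. 1"])
      show "AE x in leb01. (\<lambda>n. indicator (?A n) x :: real) \<longlonglongrightarrow> 0"
        using lim
      proof eventually_elim
        case (elim x)
        have "\<forall>\<^sub>F n in sequentially. \<bar>F n x\<bar> < a"
          using order_tendstoD(2)[OF tendsto_rabs_zero[OF elim] a] .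
        then have "\<forall>\<^sub>F n in sequentially. indicator (?A n) x = (0::real)"
          by (rule eventually_mono) (simp add: indicator_def)
        then show ?case by (rule tendsto_eventually)
      qed
      show "AE x in leb01. norm (indicator (?A n) x :: real) \<le> 1" for n by (simp add: indicator_def)
    qed (use A in auto)
    then have "(\<lambda>n. measure leb01 (?A n)) \<longlonglongrightarrow> 0"
      using sets.Int_space_eq2[OF A] by simp
    then have "\<forall>\<^sub>F n in sequentially. measure leb01 (?A n) < d"
      using d(1) by (rule order_tendstoD(2))
    then obtain n0 where n0: "\<And>n. n \<ge> n0 \<Longrightarrow> measure leb01 (?A n) < d"
      unfolding eventually_sequentially by blast
    have "N (F n) < e" if n: "n \<ge> n0" for n
    proof -
      let ?h = "\<lambda>x. a * 1 + B * indicator (?A n) x"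
      have h1: "(\<lambda>x. a * 1) \<in> X" "(\<lambda>x. B * indicator (?A n) x) \<in> X"
        by (rule scale_mem[OF unit_mem], rule scale_mem[OF indicator_mem[OF A]])
      have "AE x in leb01. \<bar>F n x\<bar> \<le> \<bar>?h x\<bar>"
        using dom[of n]
      proof (rule AE_mp, intro AE_I2 impI)
        fix x assume x: "x \<in> space leb01" "\<bar>F n x\<bar> \<le> \<bar>f x\<bar>"
        then have "\<bar>F n x\<bar> \<le> B" using B(2)[of x] by simp
        then show "\<bar>F n x\<bar> \<le> \<bar>?h x\<bar>" using x(1) a B(1) by (auto simp: indicator_def)
      qed
      then have "N (F n) \<le> N ?h"
        by (rule dominated_mem(2)[OF meas add_mem[OF h1]])
      also have "\<dots> \<le> N (\<lambda>x. a * 1) + N (\<lambda>x. B * indicator (?A n) x)"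
        by (rule norm_triangle[OF h1])
      also have "N (\<lambda>x. a * 1) = a * unit_norm"
        using norm_scale[OF unit_mem, of a] a by (simp only: unit_norm_def abs_of_pos)
      also have "N (\<lambda>x. B * indicator (?A n) x) = B * N (indicator (?A n))"
        using norm_scale[OF indicator_mem[OF A], of B n] B(1) by simp
      also have "a * unit_norm = e / 2" using unit_norm_pos by (simp add: a_def)
      also have "B * N (indicator (?A n)) < e / 2"
      proof -
        have "B * N (indicator (?A n)) \<le> B * (e / (2 * (B + 1)))"
          using d(2)[OF A n0[OF n]] B(1) by (intro mult_left_mono) auto
        also have "\<dots> < e / 2" using B(1) e by (simp add: field_simps)
        finally show ?thesis .
      qed
      finally show ?thesis by simp
    qed
    then show "\<exists>no. \<forall>n\<ge>no. norm (N (F n) - 0) < e"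
      using norm_nonneg[OF FX] by (intro exI[of _ n0]) (simp add: abs_of_nonneg)
  qed
  then show ?thesis
    unfolding oc_part_def using bounded_L0_mem[OF f] by simp
qed

text \<open>By \<open>small\<close> the set function given by \<open>\<phi>\<close> on indicators is
  absolutely continuous and has a density \<open>g\<close>. Both sides of the representation are
  continuous for uniform convergence, which carries it from simple to bounded functions. Membership
  of \<open>g\<close> in the associate space follows by testing \<open>\<phi>\<close> on bounded
  cut-offs of \<open>\<bar>f\<bar> * sgn g\<close>.\<close>

lemma oc_functional_representation:
  assumes small: "\<And>e. e > 0 \<Longrightarrow> \<exists>d>0. \<forall>A\<in>sets leb01. measure leb01 A < d \<longrightarrow> N (indicator A) < e"
    and \<phi>: "bounded_functional (oc_part X N) N \<phi>"
  obtains g where "g \<in> associate_space X" "\<And>f. f \<in> bounded_L0 \<Longrightarrow> \<phi> f = (LINT t|leb01. f t * g t)"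
proof -
  have oc: "f \<in> oc_part X N" if "f \<in> bounded_L0" for f
    using bounded_L0_oc_part[OF small that] .
  have \<phi>_add: "\<phi> (\<lambda>t. f t + g t) = \<phi> f + \<phi> g" if "f \<in> bounded_L0" "g \<in> bounded_L0" for f g
    using \<phi> oc that by (simp add: bounded_functional_def)
  have \<phi>_scale: "\<phi> (\<lambda>t. c * f t) = c * \<phi> f" if "f \<in> bounded_L0" for f c
    using \<phi> oc that by (simp add: bounded_functional_def)
  obtain C0 where C0: "\<And>f. f \<in> oc_part X N \<Longrightarrow> \<bar>\<phi> f\<bar> \<le> C0 * N f"
    using \<phi> unfolding bounded_functional_def by blast
  define C where "C = max C0 1"
  have C: "C \<ge> 1" "\<bar>\<phi> f\<bar> \<le> C * N f" if "f \<in> bounded_L0" for f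
  proof -
    have "C0 * N f \<le> C * N f"
      unfolding C_def using norm_nonneg[OF bounded_L0_mem[OF that]] by (intro mult_right_mono) auto
    then show "\<bar>\<phi> f\<bar> \<le> C * N f" using C0[OF oc[OF that]] by linarith
  qed (simp add: C_def)
  have C1: "C \<ge> 1" by (simp add: C_def)
  define \<nu> where "\<nu> = (\<lambda>A. \<phi> (indicator A))"
  obtain g where g: "integrable leb01 g" "\<And>A. A \<in> sets leb01 \<Longrightarrow> \<nu> A = (LINT x|leb01. g x * indicator A x)"
  proof (rule leb01.signed_set_function_density[of \<nu> "C * unit_norm"])
    fix A B assume AB: "A \<in> sets leb01" "B \<in> sets leb01" "A \<inter> B = {}"
    have "indicator (A \<union> B) = (\<lambda>t. indicator A t + indicator B t :: real)"
      using AB(3) by (intro ext) (auto simp: indicator_def)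
    then show "\<nu> (A \<union> B) = \<nu> A + \<nu> B"
      unfolding \<nu>_def using \<phi>_add[OF bounded_L0_indicator bounded_L0_indicator] AB by simp
  next
    fix e :: real assume e: "e > 0"
    then have "e / C > 0" using C1 by simp
    from small[OF this] obtain d where d: "d > 0"
      "\<And>A. A \<in> sets leb01 \<Longrightarrow> measure leb01 A < d \<Longrightarrow> N (indicator A) < e / C" by blast
    have "\<bar>\<nu> A\<bar> < e" if "A \<in> sets leb01" "measure leb01 A < d" for A
    proof -
      have "\<bar>\<nu> A\<bar> \<le> C * N (indicator A)"
        unfolding \<nu>_def by (intro C bounded_L0_indicator that)
      also have "\<dots> < C * (e / C)"
        using d(2)[OF that] C1 by (intro mult_strict_left_mono) auto
      also have "\<dots> = e" using C1 by simp
      finally show ?thesis .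
    qed
    then show "\<exists>d>0. \<forall>A\<in>sets leb01. measure leb01 A < d \<longrightarrow> \<bar>\<nu> A\<bar> < e" using d(1) by blast
  next
    fix A assume A: "A \<in> sets leb01"
    have "\<bar>\<nu> A\<bar> \<le> C * N (indicator A)"
      unfolding \<nu>_def by (intro C bounded_L0_indicator A)
    also have "\<dots> \<le> C * (1 * unit_norm)"
      using A C1 by (intro mult_left_mono bounded_mem(2)) (auto simp: indicator_def)
    finally show "\<bar>\<nu> A\<bar> \<le> C * unit_norm" by simp
  qed blast
  have rep: "\<phi> f = (LINT t|leb01. f t * g t)" if f: "f \<in> bounded_L0" for f
  proof -
    obtain B where B: "f \<in> borel_measurable leb01" "\<And>x. x \<in> {0..1} \<Longrightarrow> \<bar>f x\<bar> \<le> B" using f by (rule bounded_L0E) blast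
    \<comment> \<open>Collects the two effects of a uniform error: \<open>C * unit_norm\<close>
      through \<open>\<phi>\<close> and the L^1 norm of \<open>g\<close> through the
      integral.\<close>
    define K where "K = C * unit_norm + (LINT t|leb01. \<bar>g t\<bar>) + 1"
    have K: "K > 0" unfolding K_def using C1 unit_norm_pos by (simp add: add_pos_pos add_nonneg_pos)
    have "\<bar>\<phi> f - (LINT t|leb01. f t * g t)\<bar> \<le> 0 + e" if e: "e > 0" for e
    proof -
      define d where "d = e / K"
      have d: "d > 0" using e K by (simp add: d_def)
      show ?thesis
      proof (rule bounded_simple_approx[OF B(1) _ d, of B])
        show "\<bar>f x\<bar> \<le> B" if "x \<in> space leb01" for x using B(2) that by simp
        fix m :: nat and c :: "nat \<Rightarrow> real" and A
        assume A: "\<And>i. A i \<in> sets leb01"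
          and approx: "\<And>x. x \<in> space leb01 \<Longrightarrow> \<bar>f x - (\<Sum>i<m. c i * indicator (A i) x)\<bar> \<le> d"
        define s where "s = (\<lambda>m x. \<Sum>i<m. c i * indicator (A i) x)"
        have s: "s m \<in> bounded_L0" for m
          unfolding s_def by (intro bounded_L0_sum bounded_L0_mult bounded_L0_const bounded_L0_indicator A)
        have gi: "integrable leb01 (\<lambda>x. h x * g x)" if "h \<in> bounded_L0" for h
        proof -
          obtain D where "h \<in> borel_measurable leb01" "\<And>x. x \<in> {0..1} \<Longrightarrow> \<bar>h x\<bar> \<le> D"
            using \<open>h \<in> bounded_L0\<close> by (rule bounded_L0E) blast
          from integrable_mult_bounded[OF g(1) this] show ?thesis by (simp add: mult.commute)
        qed
        have "\<phi> (s m) = (LINT t|leb01. s m t * g t)" for m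
        proof (induct m)
          case 0
          have "\<phi> (\<lambda>t. 0 * 0) = 0 * \<phi> (\<lambda>t. 0)" by (intro \<phi>_scale bounded_L0_const)
          then show ?case by (simp add: s_def)
        next
          case (Suc m)
          have ci: "(\<lambda>t. c m * indicator (A m) t) \<in> bounded_L0"
            by (intro bounded_L0_mult bounded_L0_const bounded_L0_indicator A)
          have eq: "s (Suc m) = (\<lambda>t. s m t + c m * indicator (A m) t)"
            by (simp add: s_def del: sum_mult_indicator)
          have "\<phi> (s (Suc m)) = \<phi> (s m) + c m * \<nu> (A m)"
            unfolding eq \<phi>_add[OF s ci] \<nu>_def using \<phi>_scale[OF bounded_L0_indicator[OF A]] by simp
          also have "\<dots> = (LINT t|leb01. s m t * g t) + (LINT t|leb01. c m * indicator (A m) t * g t)"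
            unfolding Suc g(2)[OF A] by (simp add: mult_ac flip: integral_mult_right_zero)
          also have "\<dots> = (LINT t|leb01. s (Suc m) t * g t)"
            unfolding eq using gi[OF s] gi[OF ci] by (simp add: distrib_right)
          finally show ?case .
        qed
        then have s_eq: "\<phi> (s m) = (LINT t|leb01. s m t * g t)" .
        let ?D = "\<lambda>t. f t - s m t"
        have D: "?D \<in> bounded_L0" by (intro bounded_L0_diff f s)
        have D_le: "\<bar>?D t\<bar> \<le> d" if "t \<in> space leb01" for t using approx[OF that] by (simp only: s_def)
        have "\<phi> (\<lambda>t. ?D t + s m t) = \<phi> ?D + \<phi> (s m)" by (rule \<phi>_add[OF D s])
        then have "\<phi> f = \<phi> ?D + \<phi> (s m)" by simp
        moreover have "(LINT t|leb01. f t * g t) = (LINT t|leb01. ?D t * g t) + (LINT t|leb01. s m t * g t)"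
          using gi[OF D] gi[OF s[of m]] by (subst Bochner_Integration.integral_add[symmetric]) (auto simp: algebra_simps)
        moreover have "\<bar>\<phi> ?D\<bar> \<le> C * (d * unit_norm)"
        proof -
          have "N ?D \<le> d * unit_norm"
            using bounded_L0_measurable[OF D] D_le d by (intro bounded_mem(2) AE_I2) auto
          then have "C * N ?D \<le> C * (d * unit_norm)" using C1 by (intro mult_left_mono) auto
          then show ?thesis using C(2)[OF D] by linarith
        qed
        moreover have "\<bar>LINT t|leb01. ?D t * g t\<bar> \<le> d * (LINT t|leb01. \<bar>g t\<bar>)"
        proof -
          have "\<bar>LINT t|leb01. ?D t * g t\<bar> \<le> (LINT t|leb01. \<bar>?D t * g t\<bar>)" by (rule integral_abs_bound)
          also have "\<dots> \<le> (LINT t|leb01. d * \<bar>g t\<bar>)"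
          proof (rule integral_mono)
            show "integrable leb01 (\<lambda>t. \<bar>?D t * g t\<bar>)" using gi[OF D] by (rule integrable_abs)
            show "integrable leb01 (\<lambda>t. d * \<bar>g t\<bar>)" using g(1) by simp
            show "\<bar>?D t * g t\<bar> \<le> d * \<bar>g t\<bar>" if "t \<in> space leb01" for t
              unfolding abs_mult using D_le[OF that] by (rule mult_right_mono) simp
          qed
          finally show ?thesis by simp
        qed
        ultimately have "\<bar>\<phi> f - (LINT t|leb01. f t * g t)\<bar> \<le> C * (d * unit_norm) + d * (LINT t|leb01. \<bar>g t\<bar>)"
          using s_eq by linarith
        also have "\<dots> \<le> d * K" unfolding K_def using d by (simp add: algebra_simps)
        also have "\<dots> = e" using K by (simp add: d_def)
        finally show "\<bar>\<phi> f - (LINT t|leb01. f t * g t)\<bar> \<le> 0 + e" by simp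
      qed
    qed
    then have "\<bar>\<phi> f - (LINT t|leb01. f t * g t)\<bar> \<le> 0" by (rule field_le_epsilon)
    then show ?thesis by simp
  qed
  have "integrable leb01 (\<lambda>t. f t * g t)" if f: "f \<in> X" for f
  proof -
    have fm: "f \<in> borel_measurable leb01" by (rule measurable_mem[OF f])
    have gm: "g \<in> borel_measurable leb01" using g(1) by (rule borel_measurable_integrable)
    \<comment> \<open>The product with \<open>g\<close> is \<open>\<bar>f * g\<bar>\<close>
      restricted to \<open>\<bar>f\<bar> \<le> k\<close>: nonnegative, increasing in
      \<open>k\<close>, and with integral at most \<open>C * N f\<close> because the norm of
      \<open>u k\<close> never exceeds that of \<open>f\<close>.\<close>
    define u where "u = (\<lambda>(k::nat) t. if \<bar>f t\<bar> \<le> real k then \<bar>f t\<bar> * sgn (g t) else 0)"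
    have u_meas: "u k \<in> borel_measurable leb01" for k
      unfolding u_def using fm gm by measurable
    have u_le: "\<bar>u k t\<bar> \<le> \<bar>f t\<bar>" "\<bar>u k t\<bar> \<le> real k" for k t
      by (auto simp: u_def abs_mult sgn_if)
    have u: "u k \<in> bounded_L0" for k
      using u_meas u_le(2) by (intro bounded_L0I)
    have ug: "u k t * g t = (if \<bar>f t\<bar> \<le> real k then \<bar>f t * g t\<bar> else 0)" for k t
      by (auto simp: u_def abs_mult sgn_if)
    have int: "integrable leb01 (\<lambda>t. u k t * g t)" for k
    proof -
      have "integrable leb01 (\<lambda>t. g t * u k t)"
        using integrable_mult_bounded[OF g(1) u_meas u_le(2)] .
      then show ?thesis by (simp add: mult.commute)
    qed
    have "integrable leb01 (\<lambda>t. \<bar>f t * g t\<bar>)"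
    proof (rule bounded_increasing_integrals(1)[of "\<lambda>k t. u k t * g t" _ "C * N f"])
      show "incseq (\<lambda>k. u k t * g t)" for t unfolding ug by (auto simp: incseq_def)
      show "(\<lambda>k. u k t * g t) \<longlonglongrightarrow> \<bar>f t * g t\<bar>" for t
      proof (rule tendsto_eventually)
        obtain n :: nat where "\<bar>f t\<bar> \<le> real n" using real_arch_simple by blast
        then show "\<forall>\<^sub>F k in sequentially. u k t * g t = \<bar>f t * g t\<bar>"
          unfolding eventually_sequentially ug by (intro exI[of _ n]) auto
      qed
      show "(LINT t|leb01. u k t * g t) \<le> C * N f" for k
      proof -
        have "N (u k) \<le> N f" by (rule dominated_mem(2)[OF u_meas f]) (use u_le(1) in simp)
        then have "C * N (u k) \<le> C * N f" using C1 by (intro mult_left_mono) auto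
        then show ?thesis using C(2)[OF u, of k] rep[OF u, of k] by linarith
      qed
    qed (use int fm gm in auto)
    then show ?thesis using fm gm by (subst (asm) integrable_abs_iff) auto
  qed
  then have "g \<in> associate_space X"
    using borel_measurable_integrable[OF g(1)] by (simp add: associate_space_def L0_def)
  then show ?thesis using rep by (rule that)
qed

section \<open>The equivalence\<close>

lemma order_null_truncations:
  assumes f: "f \<in> X"
  shows "order_converges X (\<lambda>(k::nat) t. if real k < \<bar>f t\<bar> then \<bar>f t\<bar> else 0) (\<lambda>_. 0)"
proof (rule order_convergesI)
  have meas: "f \<in> borel_measurable leb01" by (rule measurable_mem[OF f])
  show "(\<lambda>t. if real k < \<bar>f t\<bar> then \<bar>f t\<bar> else 0) \<in> X" for k :: nat
  proof (rule dominated_mem(1)[OF _ f])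
    show "(\<lambda>t. if real k < \<bar>f t\<bar> then \<bar>f t\<bar> else 0) \<in> borel_measurable leb01"
      using meas by measurable
  qed simp
  have "(\<lambda>k::nat. if real k < \<bar>f t\<bar> then \<bar>f t\<bar> else 0) \<longlonglongrightarrow> 0" for t
  proof (rule tendsto_eventually)
    obtain n :: nat where "\<bar>f t\<bar> \<le> real n" using real_arch_simple by blast
    then show "\<forall>\<^sub>F k::nat in sequentially. (if real k < \<bar>f t\<bar> then \<bar>f t\<bar> else 0) = 0"
      unfolding eventually_sequentially by (intro exI[of _ n]) auto
  qed
  then show "AE t in leb01. (\<lambda>k::nat. if real k < \<bar>f t\<bar> then \<bar>f t\<bar> else 0) \<longlonglongrightarrow> 0" by simp
  show "dominated_in X (\<lambda>(k::nat) t. if real k < \<bar>f t\<bar> then \<bar>f t\<bar> else 0)"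
    by (rule dominated_inI[of "\<lambda>t. \<bar>f t\<bar>"]) (use abs_mem(1)[OF f] in \<open>auto simp: pos_cone_def\<close>)
qed simp

lemma measure_level_tendsto_0:
  assumes f: "f \<in> X"
  shows "(\<lambda>k. measure leb01 {x\<in>space leb01. real k < \<bar>f x\<bar>}) \<longlonglongrightarrow> 0"
proof -
  have meas: "f \<in> borel_measurable leb01" by (rule measurable_mem[OF f])
  have "(\<lambda>k. measure leb01 {x\<in>space leb01. real k < \<bar>f x\<bar>}) \<longlonglongrightarrow>
      measure leb01 (\<Inter>k. {x\<in>space leb01. real k < \<bar>f x\<bar>})"
  proof (rule leb01.finite_Lim_measure_decseq)
    show "range (\<lambda>k. {x\<in>space leb01. real k < \<bar>f x\<bar>}) \<subseteq> sets leb01"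
    proof (rule image_subsetI)
      show "{x\<in>space leb01. real k < \<bar>f x\<bar>} \<in> sets leb01" for k using meas by measurable
    qed
  qed (auto simp: decseq_def)
  also have "(\<Inter>k. {x\<in>space leb01. real k < \<bar>f x\<bar>}) = {}"
  proof (rule equals0I)
    fix x assume "x \<in> (\<Inter>k. {x\<in>space leb01. real k < \<bar>f x\<bar>})"
    then have "real k < \<bar>f x\<bar>" for k by blast
    then show False using real_arch_simple[of "\<bar>f x\<bar>"] by (meson not_less)
  qed
  finally show ?thesis by simp
qed

text \<open>By (M1) each \<open>G n\<close> can be cut at a level so high that the modulars of the cut-off parts
  are summable; (M2) then dominates a subsequence of these parts.\<close>

lemma special_modular_splitting:
  assumes \<rho>: "special_modular X N \<rho>" and G: "\<And>n. G n \<in> X" "\<And>n. N (G n) \<le> 1"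
  obtains z r where "\<And>n. z n \<in> X" "\<And>n. (\<lambda>t. G n t - z n t) \<in> bounded_L0"
    "AE t in leb01. (\<lambda>n. z n t) \<longlonglongrightarrow> 0" "strict_mono (r::nat\<Rightarrow>nat)" "dominated_in X (z \<circ> r)"
proof -
  let ?v = "\<lambda>n (k::nat) t. if real k < \<bar>G n t\<bar> then \<bar>G n t\<bar> else 0"
  have meas: "G n \<in> borel_measurable leb01" for n by (rule measurable_mem[OF G(1)])
  note sm = \<rho>[unfolded special_modular_def]
  have M1: "(\<lambda>n. \<rho> (F n)) \<longlonglongrightarrow> 0"
    if "f \<in> pos_cone X" "\<rho> f < \<infinity>" "order_converges X F (\<lambda>_. 0)"
      "\<And>n. AE t in leb01. 0 \<le> F n t \<and> F n t \<le> f t" for f F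
    by (rule sm[THEN conjunct2, THEN conjunct1, rule_format, OF that(1)]) (intro conjI allI that(2-4))
  have M2: "\<exists>r. strict_mono r \<and> dominated_in X (F \<circ> r)" if "\<And>n. F n \<in> X" "(\<Sum>n. \<rho> (F n)) < \<infinity>" for F
    by (rule sm[THEN conjunct2, THEN conjunct2, THEN conjunct1, rule_format]) (intro conjI allI that)
  have M3: "\<rho> f < \<infinity>" if "f \<in> X" "N f \<le> 1" for f
    by (rule sm[THEN conjunct2, THEN conjunct2, THEN conjunct2, rule_format, OF that])
  \<comment> \<open>The bound on the modular prepares (M2). The bound on the measure makes the
    cut-off parts vanish a.e. by Borel-Cantelli, so that their integrals against \<open>X'\<close>
    can later be sent to 0.\<close>
  have "\<exists>k. \<rho> (?v n k) < ennreal ((1/2) ^ n) \<and> measure leb01 {x\<in>space leb01. real k < \<bar>G n x\<bar>} < (1/2) ^ n" for n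
  proof -
    have "(\<lambda>k. \<rho> (?v n k)) \<longlonglongrightarrow> 0"
    proof (rule M1[of "\<lambda>t. \<bar>G n t\<bar>"])
      show "(\<lambda>t. \<bar>G n t\<bar>) \<in> pos_cone X" using abs_mem(1)[OF G(1)] by (simp add: pos_cone_def)
      show "\<rho> (\<lambda>t. \<bar>G n t\<bar>) < \<infinity>"
        using abs_mem[OF G(1), of n] G(2)[of n] by (intro M3) auto
      show "order_converges X (\<lambda>k. ?v n k) (\<lambda>_. 0)" by (rule order_null_truncations[OF G(1)])
    qed auto
    then have "\<forall>\<^sub>F k in sequentially. \<rho> (?v n k) < ennreal ((1/2) ^ n)"
      by (rule order_tendstoD(2)) simp
    moreover have "\<forall>\<^sub>F k in sequentially. measure leb01 {x\<in>space leb01. real k < \<bar>G n x\<bar>} < (1/2) ^ n"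
      by (rule order_tendstoD(2)[OF measure_level_tendsto_0[OF G(1)]]) simp
    ultimately have "\<forall>\<^sub>F k in sequentially. \<rho> (?v n k) < ennreal ((1/2) ^ n) \<and>
        measure leb01 {x\<in>space leb01. real k < \<bar>G n x\<bar>} < (1/2) ^ n"
      by (rule eventually_conj)
    then show ?thesis unfolding eventually_sequentially by blast
  qed
  then have "\<forall>n. \<exists>k. \<rho> (?v n k) < ennreal ((1/2) ^ n) \<and> measure leb01 {x\<in>space leb01. real k < \<bar>G n x\<bar>} < (1/2) ^ n"
    by blast
  from choice[OF this] obtain k where k: "\<And>n. \<rho> (?v n (k n)) < ennreal ((1/2) ^ n)"
    "\<And>n. measure leb01 {x\<in>space leb01. real (k n) < \<bar>G n x\<bar>} < (1/2) ^ n" by blast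
  \<comment> \<open>The cut-off part keeps the sign of \<open>G n\<close>, so that the remainder is
    bounded; the modular was applied to its absolute value because (M1) speaks of nonnegative
    functions.\<close>
  define z where "z = (\<lambda>n t. if real (k n) < \<bar>G n t\<bar> then G n t else 0)"
  have z_abs: "\<bar>z n t\<bar> = ?v n (k n) t" for n t by (simp add: z_def)
  have vX: "?v n (k n) \<in> X" for n
    using order_null_truncations[OF G(1)] by (simp add: order_converges_def)
  have "(\<Sum>n. \<rho> (?v n (k n))) \<le> (\<Sum>n. ennreal ((1/2) ^ n))"
    using k(1) by (intro suminf_le less_imp_le) auto
  also have "\<dots> = ennreal (\<Sum>n. (1/2) ^ n)"
    by (rule suminf_ennreal2) (auto intro: summable_geometric)
  finally have "(\<Sum>n. \<rho> (?v n (k n))) < \<infinity>"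
    by (simp add: less_top[symmetric] top_unique) (metis ennreal_neq_top top_unique)
  from M2[OF vX this] obtain r :: "nat \<Rightarrow> nat" where r: "strict_mono r"
    "dominated_in X ((\<lambda>n. ?v n (k n)) \<circ> r)" by blast
  show ?thesis
  proof (rule that[of z r])
    show "z n \<in> X" for n
      by (rule dominated_mem(1)[OF _ G(1)[of n]]) (use meas in \<open>simp_all add: z_def\<close>)
    show "(\<lambda>t. G n t - z n t) \<in> bounded_L0" for n
      using meas[of n] by (intro bounded_L0I[of _ "real (k n)"]) (auto simp: z_def)
    show "strict_mono r" by (rule r(1))
    have "\<bar>z (r n) t\<bar> = \<bar>?v (r n) (k (r n)) t\<bar>" for n t by (simp add: z_def)
    then show "dominated_in X (z \<circ> r)"
      using r(2) unfolding dominated_in_def o_def by (simp only:)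
    have "AE t in leb01. \<forall>\<^sub>F n in sequentially. t \<in> space leb01 - {x\<in>space leb01. real (k n) < \<bar>G n x\<bar>}"
    proof (rule borel_cantelli_AE1)
      show "{x\<in>space leb01. real (k n) < \<bar>G n x\<bar>} \<in> sets leb01" for n
        using meas by measurable
      show "emeasure leb01 {x\<in>space leb01. real (k n) < \<bar>G n x\<bar>} < \<infinity>" for n
        by (simp add: leb01.emeasure_finite less_top[symmetric])
      have "summable (\<lambda>n. (1/2::real) ^ n)" by (rule summable_geometric) simp
      then show "summable (\<lambda>n. measure leb01 {x\<in>space leb01. real (k n) < \<bar>G n x\<bar>})"
        by (rule summable_comparison_test'[of _ 0]) (use k(2) in \<open>simp add: less_imp_le\<close>)
    qed
    then show "AE t in leb01. (\<lambda>n. z n t) \<longlonglongrightarrow> 0"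
    proof eventually_elim
      case (elim t)
      then have "\<forall>\<^sub>F n in sequentially. z n t = 0"
        by eventually_elim (auto simp: z_def)
      then show ?case by (rule tendsto_eventually)
    qed
  qed
qed

lemma dominated_cesaro_subsequence:
  assumes \<rho>: "special_modular X N \<rho>"
    and oc: "\<And>F. weakly_null (oc_part X N) N F \<Longrightarrow> \<exists>r. strict_mono r \<and> dominated_in X (cesaro (F \<circ> r))"
    and F: "assoc_null X F" "\<And>n. N (F n) \<le> C" and C: "C > 0"
  shows "\<exists>r. strict_mono r \<and> dominated_in X (cesaro (F \<circ> r))"
proof (rule indicator_norm_dichotomy)
  have FX: "F n \<in> X" for n using F(1) by (simp add: assoc_null_def)
  fix c assume c: "c > 0" "\<And>A. A \<in> sets leb01 \<Longrightarrow> measure leb01 A > 0 \<Longrightarrow> c \<le> N (indicator A)"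
  \<comment> \<open>A Chebyshev bound: \<open>l\<close> times the norm of the indicator of
    \<open>{\<bar>F n\<bar> > l}\<close> is at most \<open>C\<close>, which puts this norm below
    \<open>c\<close> and forces the set to be null.\<close>
  define l where "l = (C + 1) / c"
  have l: "l > 0" using C c(1) by (simp add: l_def)
  have "AE t in leb01. \<bar>F n t\<bar> \<le> l" for n
  proof -
    let ?A = "{x\<in>space leb01. l < \<bar>F n x\<bar>}"
    have A: "?A \<in> sets leb01" using measurable_mem[OF FX] by measurable
    have ind: "indicator ?A \<in> borel_measurable leb01" using A by simp
    have "AE t in leb01. \<bar>indicator ?A t\<bar> \<le> \<bar>(1 / l) * F n t\<bar>"
      using l by (intro AE_I2) (auto simp: indicator_def abs_mult field_simps)
    from dominated_mem(2)[OF ind scale_mem[OF FX] this]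
    have "N (indicator ?A) \<le> (1 / l) * N (F n)"
      using norm_scale[OF FX, of "1 / l" n] l by simp
    also have "\<dots> \<le> (1 / l) * C" using F(2) l by (intro mult_left_mono) auto
    also have "\<dots> < c" using C c(1) by (simp add: l_def field_simps)
    finally have "\<not> measure leb01 ?A > 0" using c(2)[OF A] by auto
    then have "measure leb01 ?A = 0" using measure_nonneg[of leb01 ?A] by linarith
    then have "?A \<in> null_sets leb01" using A by (simp add: null_sets_def leb01.emeasure_eq_measure)
    from AE_not_in[OF this] show ?thesis by (rule AE_mp) (auto intro!: AE_I2)
  qed
  moreover have "(\<lambda>_. l) \<in> pos_cone X"
    using bounded_mem(1)[of "\<lambda>_. l" l] l by (simp add: pos_cone_def)
  ultimately have "dominated_in X F" by (intro dominated_inI)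
  then have "dominated_in X (cesaro (F \<circ> id))" by (simp add: dominated_cesaro)
  then show ?thesis using strict_mono_id by blast
next
  have FX: "F n \<in> X" for n using F(1) by (simp add: assoc_null_def)
  assume small: "\<And>e. e > 0 \<Longrightarrow> \<exists>d>0. \<forall>A\<in>sets leb01. measure leb01 A < d \<longrightarrow> N (indicator A) < e"
  \<comment> \<open>Scaling into the unit ball brings the sequence within reach of (M3); the factor
    is undone at the end.\<close>
  define G where "G = (\<lambda>n t. (1 / C) * F n t)"
  have GX: "G n \<in> X" for n unfolding G_def by (rule scale_mem[OF FX])
  have G1: "N (G n) \<le> 1" for n
    unfolding G_def norm_scale[OF FX] using F(2)[of n] C by simp
  show ?thesis
  proof (rule special_modular_splitting[OF \<rho> GX G1])
    fix z and r :: "nat \<Rightarrow> nat"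
    assume z: "\<And>n. z n \<in> X" "\<And>n. (\<lambda>t. G n t - z n t) \<in> bounded_L0"
      "AE t in leb01. (\<lambda>n. z n t) \<longlonglongrightarrow> 0" and r: "strict_mono r" and dom: "dominated_in X (z \<circ> r)"
    let ?u = "\<lambda>n t. G (r n) t - z (r n) t"
    obtain h where h: "h \<in> X" "\<And>n. AE t in leb01. \<bar>z (r n) t\<bar> \<le> h t"
      using dom by (auto simp: dominated_in_def pos_cone_def)
    \<comment> \<open>Against a representing \<open>g\<close>, the integrals of
      \<open>G (r n)\<close> vanish by hypothesis and those of \<open>z (r n)\<close> by dominated
      convergence with majorant \<open>\<bar>h t * g t\<bar>\<close>.\<close>
    have "weakly_null (oc_part X N) N ?u"
      unfolding weakly_null_def
    proof (intro conjI allI impI)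
      show "?u n \<in> oc_part X N" for n by (rule bounded_L0_oc_part[OF small z(2)])
      fix \<phi> assume \<phi>: "bounded_functional (oc_part X N) N \<phi>"
      show "(\<lambda>n. \<phi> (?u n)) \<longlonglongrightarrow> 0"
      proof (rule oc_functional_representation[OF small \<phi>])
        fix g assume g: "g \<in> associate_space X"
          and rep: "\<And>f. f \<in> bounded_L0 \<Longrightarrow> \<phi> f = (LINT t|leb01. f t * g t)"
        have int: "integrable leb01 (\<lambda>t. f t * g t)" if "f \<in> X" for f
          using g that by (simp add: associate_space_def)
        have gm: "g \<in> borel_measurable leb01" using g by (simp add: associate_space_def L0_def)
        have "(\<lambda>n. LINT t|leb01. z (r n) t * g t) \<longlonglongrightarrow> (LINT t|leb01. 0)"
        proof (rule integral_dominated_convergence[of _ _ _ "\<lambda>t. \<bar>h t * g t\<bar>"])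
          show "integrable leb01 (\<lambda>t. \<bar>h t * g t\<bar>)" using int[OF h(1)] by (rule integrable_abs)
          show "AE t in leb01. (\<lambda>n. z (r n) t * g t) \<longlonglongrightarrow> 0"
            using z(3)
          proof eventually_elim
            case (elim t)
            from LIMSEQ_subseq_LIMSEQ[OF elim r] have "(\<lambda>n. z (r n) t) \<longlonglongrightarrow> 0" by (simp add: o_def)
            then show ?case by (rule tendsto_mult_left_zero)
          qed
          show "AE t in leb01. norm (z (r n) t * g t) \<le> \<bar>h t * g t\<bar>" for n
            using h(2)[of n]
          proof eventually_elim
            case (elim t)
            then have "\<bar>z (r n) t\<bar> \<le> \<bar>h t\<bar>" by linarith
            then show ?case unfolding real_norm_def abs_mult by (rule mult_right_mono) simp
          qed
          show "(\<lambda>t. z (r n) t * g t) \<in> borel_measurable leb01" for n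
            using measurable_mem[OF z(1)] gm by simp
        qed simp
        then have zlim: "(\<lambda>n. LINT t|leb01. z (r n) t * g t) \<longlonglongrightarrow> 0" by simp
        have "(\<lambda>n. LINT t|leb01. F n t * g t) \<longlonglongrightarrow> 0" using F(1) g by (simp add: assoc_null_def)
        from tendsto_mult_right_zero[OF LIMSEQ_subseq_LIMSEQ[OF this r], of "1 / C"]
        have Glim: "(\<lambda>n. LINT t|leb01. G (r n) t * g t) \<longlonglongrightarrow> 0"
          by (simp add: G_def o_def)
        have "\<phi> (?u n) = (LINT t|leb01. G (r n) t * g t) - (LINT t|leb01. z (r n) t * g t)" for n
          unfolding rep[OF z(2)] using int[OF GX] int[OF z(1)] by (simp add: left_diff_distrib)
        then show ?thesis using tendsto_diff[OF Glim zlim] by simp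
      qed
    qed
    from oc[OF this] obtain r' where r': "strict_mono r'" "dominated_in X (cesaro (?u \<circ> r'))" by blast
    \<comment> \<open>Domination of the terms, unlike that of their means, is inherited by the
      subsequence chosen for the bounded parts.\<close>
    have "dominated_in X ((z \<circ> r) \<circ> r')"
      using dom unfolding dominated_in_def o_def by blast
    from dominated_scale[OF dominated_add[OF r'(2) dominated_cesaro[OF this]], of C]
    have "dominated_in X (\<lambda>n t. C * (cesaro (?u \<circ> r') n t + cesaro ((z \<circ> r) \<circ> r') n t))" .
    also have "(\<lambda>n t. C * (cesaro (?u \<circ> r') n t + cesaro ((z \<circ> r) \<circ> r') n t)) = cesaro (F \<circ> (r \<circ> r'))"
    proof (intro ext)
      fix n t
      have "cesaro (?u \<circ> r') n t + cesaro ((z \<circ> r) \<circ> r') n t = (\<Sum>i\<le>n. (1 / C) * F (r (r' i)) t) / real (Suc n)"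
        by (simp add: cesaro_def G_def add_divide_distrib[symmetric] sum.distrib[symmetric])
      also have "\<dots> = (1 / C) * cesaro (F \<circ> (r \<circ> r')) n t"
        by (simp add: cesaro_def sum_distrib_left)
      finally show "C * (cesaro (?u \<circ> r') n t + cesaro ((z \<circ> r) \<circ> r') n t) = cesaro (F \<circ> (r \<circ> r')) n t"
        using C by simp
    qed
    finally show ?thesis using strict_mono_o[OF r r'(1)] by blast
  qed
qed

lemma assoc_oBSP_of_oc_part:
  assumes \<rho>: "special_modular X N \<rho>"
    and oc: "\<And>F. weakly_null (oc_part X N) N F \<Longrightarrow> \<exists>r. strict_mono r \<and> dominated_in X (cesaro (F \<circ> r))"
  shows "assoc_oBSP X N"
  unfolding assoc_oBSP_def
proof (intro allI impI, elim conjE exE)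
  fix F C0 assume F: "assoc_null X F" and C0: "\<forall>n. N (F n) \<le> C0"
  define C where "C = max C0 1"
  have C: "C > 0" "N (F n) \<le> C" for n using C0[rule_format, of n] by (auto simp: C_def)
  have FX: "F n \<in> X" for n using F by (simp add: assoc_null_def)
  show "\<exists>r f. strict_mono r \<and> order_converges X (cesaro (F \<circ> r)) f"
  proof (rule komlos[of F "C / unit_norm + 1"])
    show "integrable leb01 (F n)" for n by (rule integrable_mem(1)[OF FX])
    show "(LINT x|leb01. \<bar>F n x\<bar>) \<le> C / unit_norm + 1" for n
      using integrable_mem(2)[OF FX, of n] divide_right_mono[OF C(2)[of n], of unit_norm] unit_norm_pos by simp
    fix r :: "nat \<Rightarrow> nat" and b
    assume r: "strict_mono r" and b: "b \<in> borel_measurable leb01"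
      and lim: "\<And>s. strict_mono s \<Longrightarrow>
        AE x in leb01. (\<lambda>n. (\<Sum>j<n. F (r (s j)) x) / real n) \<longlonglongrightarrow> b x"
    have Fr: "assoc_null X (F \<circ> r)"
      unfolding assoc_null_def
    proof (intro conjI allI ballI)
      fix g assume "g \<in> associate_space X"
      then have "(\<lambda>n. LINT t|leb01. F n t * g t) \<longlonglongrightarrow> 0" using F by (simp add: assoc_null_def)
      from LIMSEQ_subseq_LIMSEQ[OF this r]
      show "(\<lambda>n. LINT t|leb01. (F \<circ> r) n t * g t) \<longlonglongrightarrow> 0" by (simp add: o_def)
    qed (simp add: FX)
    have "\<exists>s. strict_mono s \<and> dominated_in X (cesaro ((F \<circ> r) \<circ> s))"
    proof (rule dominated_cesaro_subsequence[OF \<rho> _ Fr _ C(1)])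
      show "\<exists>s. strict_mono s \<and> dominated_in X (cesaro (H \<circ> s))" if "weakly_null (oc_part X N) N H" for H
        by (rule oc[OF that])
      show "N ((F \<circ> r) n) \<le> C" for n using C(2) by simp
    qed
    then obtain s where s: "strict_mono s" "dominated_in X (cesaro ((F \<circ> r) \<circ> s))" by blast
    have oconv: "order_converges X (cesaro ((F \<circ> r) \<circ> s)) b"
    proof (rule order_convergesI[OF _ b _ s(2)])
      show "cesaro ((F \<circ> r) \<circ> s) n \<in> X" for n by (rule cesaro_mem) (simp add: FX)
      show "AE t in leb01. (\<lambda>n. cesaro ((F \<circ> r) \<circ> s) n t) \<longlonglongrightarrow> b t"
        using lim[OF s(1)]
      proof eventually_elim
        case (elim t)
        \<comment> \<open>\<open>cesaro\<close> at \<open>n\<close> averages \<open>n + 1\<close>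
          terms, hence the shift of the limit by one.\<close>
        from LIMSEQ_Suc[OF elim] show ?case
          by (simp only: cesaro_def o_apply lessThan_Suc_atMost)
      qed
    qed
    show ?thesis
      by (intro exI[of _ "r \<circ> s"] exI[of _ b] conjI strict_mono_o[OF r s(1)]) (use oconv in \<open>simp only: o_assoc\<close>)
  qed
qed

end

theorem theorem2p4:
  fixes X :: "(real \<Rightarrow> real) set" and N :: "(real \<Rightarrow> real) \<Rightarrow> real"
  assumes "ri_space X N"
    and "\<exists>\<rho>. special_modular X N \<rho>"
  shows "(assoc_oBSP X N \<longleftrightarrow> weak_oBSP X N) \<and>
    (weak_oBSP X N \<longleftrightarrow>
      (\<forall>F. weakly_null (oc_part X N) N F \<longrightarrow>
        (\<exists>r. strict_mono r \<and> dominated_in X (cesaro (F \<circ> r)))))"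
proof -
  interpret ri_space X N by (rule assms(1))
  obtain \<rho> where \<rho>: "special_modular X N \<rho>" using assms(2) by blast
  let ?oc = "\<forall>F. weakly_null (oc_part X N) N F \<longrightarrow>
        (\<exists>r. strict_mono r \<and> dominated_in X (cesaro (F \<circ> r)))"
  have 12: "weak_oBSP X N" if "assoc_oBSP X N"
    unfolding weak_oBSP_def
  proof (intro allI impI)
    fix F assume F: "weakly_null X N F"
    \<comment> \<open>Weakly null sequences are norm bounded, which supplies the boundedness that
      (1) asks for.\<close>
    obtain C where "\<And>n. N (F n) \<le> C" using weakly_null_bounded[OF F] by blast
    then show "\<exists>r f. strict_mono r \<and> order_converges X (cesaro (F \<circ> r)) f"
      using that weakly_null_assoc_null[OF F] unfolding assoc_oBSP_def by blast
  qed
  have 23: ?oc if weak: "weak_oBSP X N"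
  proof (intro allI impI)
    fix F assume F: "weakly_null (oc_part X N) N F"
    have sub: "oc_part X N \<subseteq> X" by (auto simp: oc_part_def)
    \<comment> \<open>Bounded functionals on \<open>X\<close> restrict to the order continuous part,
      so weak nullity there implies weak nullity in \<open>X\<close>.\<close>
    have "weakly_null X N F"
      unfolding weakly_null_def
    proof (intro conjI allI impI)
      show "F n \<in> X" for n using F sub by (auto simp: weakly_null_def)
      fix \<phi> assume "bounded_functional X N \<phi>"
      then have "bounded_functional (oc_part X N) N \<phi>"
        using sub unfolding bounded_functional_def by (meson subsetD)
      then show "(\<lambda>n. \<phi> (F n)) \<longlonglongrightarrow> 0" by (rule weakly_nullD[OF F])
    qed
    then show "\<exists>r. strict_mono r \<and> dominated_in X (cesaro (F \<circ> r))"
      using weak order_converges_dominated unfolding weak_oBSP_def by blast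
  qed
  have 31: "assoc_oBSP X N" if ?oc
    by (rule assoc_oBSP_of_oc_part[OF \<rho>]) (use that in blast)
  show ?thesis using 12 23 31 by blast
qed

end
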